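(* Let $n\ge1$ and $1\le J\le n$. With the tensor product quasi-interpolation operators $\pi_{\otimes n}^{k,l}$, the BGG operators $\mathscr D^k$, the spaces $\mathbb E^k$ and $H(\mathscr D^k)$ defined in the context, set $l_k=J-1$ for $k\le J-1$ and $l_k=J$ for $k\ge J$. Then for every $0\le k\le n$ the operator $\pi_{\otimes n}^{k,l_k}$ is bounded in the $L^2$- and $H(\mathscr D^k)$-norms, i.e. there exist positive constants $C$ such that $$\|\pi_{\otimes n}^{k,l_k}u\|\le C\|u\|\qquad\text{for all }u\in L^2(\mathcal I^n)\otimes\mathbb E^k,$$ $$\|\pi_{\otimes n}^{k,l_k}u\|_{H(\mathscr D^k)}\le C\|u\|_{H(\mathscr D^k)}\qquad\text{for all }u\in H(\mathscr D^k).$$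
   Context: **Algebra.** $\mathrm{Alt}^k=\mathrm{Alt}^k\mathbb R^n$ is the space of alternating $k$-linear forms on $\mathbb R^n$ ($0$ if $k<0$ or $k>n$), and $\mathrm{Alt}^{k,l}=\mathrm{Alt}^k\otimes\mathrm{Alt}^l$. For $\sigma=\{\sigma_1<\dots<\sigma_k\}\subset\{1,\dots,n\}$ let $dx^\sigma=dx^{\sigma_1}\wedge\cdots\wedge dx^{\sigma_k}$, and let $\chi_m(\sigma)=1$ if $m\in\sigma$ and $0$ otherwise. $\mathrm{Alt}^{k,l}$ carries the inner product in which the forms $dx^\sigma\otimes dx^\tau$ ($|\sigma|=k$, $|\tau|=l$) are orthonormal. The linear map $s^{k,l}:\mathrm{Alt}^{k,l}\to\mathrm{Alt}^{k+1,l-1}$ is $$s^{k,l}\mu(v_0,\dots,v_k)(w_1,\dots,w_{l-1})=\sum_{i=0}^{k}(-1)^i\mu(v_0,\dots,\widehat{v_i},\dots,v_k)(v_i,w_1,\dots,w_{l-1}),$$ with $s^{-1,l}=0$. The map $s^{J-1,J}$ is bijective. **BGG operators.** On $\mathrm{Alt}^{k,l}$-valued distributions on the interior of $\mathcal I^n=[0,1]^n$, $d^k(f\,dx^\sigma\otimes dx^\tau)=\sum_m\partial_m f\,(dx^m\wedge dx^\sigma)\otimes dx^\tau$ (so $d^n=0$). Put $$\mathscr D^k=\begin{cases}(I\otimes P_{\mathcal R(s^{k,J})^\perp})\,d^k, & k<J-1,\\ d^{J-1}\,(I\otimes s^{J-1,J})^{-1}\,d^{J-1}, & k=J-1,\\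 d^k,& k\ge J,\end{cases}$$ where $P_{\mathcal R(s^{k,J})^\perp}$ is the orthogonal projection of $\mathrm{Alt}^{k+1,J-1}$ onto the orthogonal complement of the range of $s^{k,J}$. Let $\mathbb E^k=\mathcal R(s^{k-1,J})^\perp\subset\mathrm{Alt}^{k,J-1}$ for $k\le J-1$, $\mathbb E^k=\ker(s^{k,J})\subset\mathrm{Alt}^{k,J}$ for $J\le k\le n$, $\mathbb E^{n+1}=0$, and $$H(\mathscr D^k)=\{u\in L^2(\mathcal I^n)\otimes\mathbb E^k:\ \mathscr D^ku\in L^2(\mathcal I^n)\otimes\mathbb E^{k+1}\},\qquad \|u\|_{H(\mathscr D^k)}^2=\|u\|^2+\|\mathscr D^ku\|^2,$$ where $\|\cdot\|$ is the $L^2$-norm. **One-dimensional data.** Let $\mathcal I=[0,1]$. For each direction $m=1,\dots,n$ there are given finite-dimensional subspaces $\mathcal S^{(m)}_a\subset L^2(\mathcal I)$, $a=0,1,2$ (in the paper $\mathcal S^{(m)}_a=\mathcal S^{p_m-a}_{\mathbf r_m-a}$), such that for $a=0,1$ the weak derivative is defined on $\mathcal S_a^{(m)}$ and maps it onto $\mathcal S_{a+1}^{(m)}$. There are also given $L^2$-bounded linear operators $\tilde\pi_m^{i,j}:L^2(\mathcal I)\to\mathcal S^{(m)}_{i+j}$, $i,j\in\{0,1\}$ (the action on coefficients of the 1D quasi-interpolation operators $\pi^{i,j}$ of $(i,j)$-forms), with $$(\tilde\pi_m^{0,j}u)'=\tilde\pi_m^{1,j}u'\quad (u\in H^1(\mathcal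 I),\ j=0,1),\qquad \tilde\pi_m^{0,1}=\tilde\pi_m^{1,0}.$$ **Tensor product operators.** $\pi_{\otimes n}^{k,l}$ is the linear operator on $L^2(\mathcal I^n)\otimes\mathrm{Alt}^{k,l}$ given by $$\pi_{\otimes n}^{k,l}(f\,dx^\sigma\otimes dx^\tau)=\Bigl(\bigl(\tilde\pi_1^{\chi_1(\sigma),\chi_1(\tau)}\otimes\cdots\otimes\tilde\pi_n^{\chi_n(\sigma),\chi_n(\tau)}\bigr)f\Bigr)\,dx^\sigma\otimes dx^\tau ,$$ where the tensor product of operators is the (Hilbert space) tensor product operator on $L^2(\mathcal I^n)=L^2(\mathcal I)^{\otimes n}$ determined by $f_1\otimes\cdots\otimes f_n\mapsto \tilde\pi_1f_1\otimes\cdots\otimes\tilde\pi_nf_n$. *)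

theory Defs
  imports "HOL-Analysis.Analysis"
begin

section \<open>Alternating forms\<close>

text \<open>
  A \<open>k\<close>-linear form is a function on lists of vectors, extended by 0 to lists of length
  different from \<open>k\<close>. Degrees are integers, so that \<^term>\<open>Alt k\<close> is the zero space for
  \<open>k < 0\<close>.
\<close>

definition Alt :: "int \<Rightarrow> ((real^'n::finite) list \<Rightarrow> real) set" where
  "Alt k = {\<alpha>. (\<forall>vs. int (length vs) \<noteq> k \<longrightarrow> \<alpha> vs = 0) \<and>
               (\<forall>vs i. i < length vs \<longrightarrow> linear (\<lambda>v. \<alpha> (vs[i := v]))) \<and>
               (\<forall>vs i j. i < j \<and> j < length vs \<and> vs ! i = vs ! j \<longrightarrow> \<alpha> vs = 0)}"

text \<open>
  The tensor product of \<^term>\<open>Alt k\<close> and \<^term>\<open>Alt l\<close>, realised as the forms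
  \<open>\<mu> vs ws\<close> that are alternating \<open>k\<close>-linear in \<open>vs\<close> and alternating \<open>l\<close>-linear in \<open>ws\<close>.
\<close>

type_synonym 'n biform = "(real^'n) list \<Rightarrow> (real^'n) list \<Rightarrow> real"

definition Alt2 :: "int \<Rightarrow> int \<Rightarrow> 'n::finite biform set" where
  "Alt2 k l = {\<mu>. (\<forall>ws. (\<lambda>vs. \<mu> vs ws) \<in> Alt k) \<and> (\<forall>vs. \<mu> vs \<in> Alt l)}"

definition del :: "nat \<Rightarrow> 'a list \<Rightarrow> 'a list" where
  "del i xs = take i xs @ drop (Suc i) xs"

text \<open>The form \<open>dx\<^sup>m \<and> \<alpha>\<close>, for \<open>\<alpha>\<close> alternating of any degree.\<close>

definition dx_wedge :: "'n::finite \<Rightarrow> ((real^'n) list \<Rightarrow> real) \<Rightarrow> (real^'n) list \<Rightarrow> real" where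
  "dx_wedge m \<alpha> vs = (\<Sum>i<length vs. (-1) ^ i * (vs ! i $ m) * \<alpha> (del i vs))"

primrec dx_list :: "'n::finite list \<Rightarrow> (real^'n) list \<Rightarrow> real" where
  "dx_list [] = (\<lambda>vs. if vs = [] then 1 else 0)"
| "dx_list (m # ms) = dx_wedge m (dx_list ms)"

definition dx :: "'n::{finite,linorder} set \<Rightarrow> (real^'n::_) list \<Rightarrow> real" where
  "dx \<sigma> = dx_list (sorted_list_of_set \<sigma>)"

definition basis_vecs :: "'n::{finite,linorder} set \<Rightarrow> (real^'n::_) list" where
  "basis_vecs \<sigma> = map (\<lambda>m. axis m 1) (sorted_list_of_set \<sigma>)"

text \<open>
  The coefficient of \<open>\<mu>\<close> at \<open>dx \<sigma> \<otimes> dx \<tau>\<close>; see \<open>coeff_dx\<close> below.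
\<close>

definition coeff :: "'n::{finite,linorder} biform \<Rightarrow> 'n set \<Rightarrow> 'n set \<Rightarrow> real" where
  "coeff \<mu> \<sigma> \<tau> = \<mu> (basis_vecs \<sigma>) (basis_vecs \<tau>)"

text \<open>
  Since forms vanish on lists of the wrong length, only \<open>\<sigma>\<close> and \<open>\<tau>\<close> whose cardinalities are
  the degrees of the form contribute to the inner product.
\<close>

definition form_inner :: "'n::{finite,linorder} biform \<Rightarrow> 'n biform \<Rightarrow> real" where
  "form_inner \<mu> \<nu> = (\<Sum>\<sigma>\<in>UNIV. \<Sum>\<tau>\<in>UNIV. coeff \<mu> \<sigma> \<tau> * coeff \<nu> \<sigma> \<tau>)"

lemma dx_list_axis:
  fixes ms ns :: "'n::{finite,linorder} list"
  assumes "sorted_wrt (<) ms" "sorted_wrt (<) ns"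
  shows "dx_list ms (map (\<lambda>m. axis m 1) ns) = (if ms = ns then 1 else 0)"
  using assms
proof (induction ms arbitrary: ns)
  case Nil
  then show ?case by auto
next
  case (Cons m ms)
  let ?e = "\<lambda>m::'n. axis m (1::real)"
  have e_nth: "?e a $ b = (if a = b then 1 else 0)" for a b
    by (simp add: axis_def)
  have del_map: "del i (map ?e ns) = map ?e (del i ns)" for i
    by (simp add: del_def take_map drop_map)
  have dist: "distinct ns"
    using Cons.prems(2) strict_sorted_iff by blast
  have sorted_del: "sorted_wrt (<) (del i ns)" for i
  proof (cases "i < length ns")
    case True
    then have "sorted_wrt (<) (take i ns @ ns ! i # drop (Suc i) ns)"
      using Cons.prems(2) by (simp add: id_take_nth_drop[symmetric])
    then show ?thesis
      by (auto simp: del_def sorted_wrt_append)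
  qed (use Cons.prems(2) in \<open>simp add: del_def\<close>)
  have summand: "(-1) ^ i * (map ?e ns ! i $ m) * dx_list ms (del i (map ?e ns))
      = (if i = 0 \<and> m # ms = ns then 1 else 0)" if i: "i < length ns" for i
  proof (cases "ns ! i = m \<and> ms = del i ns")
    case True
    have "i = 0"
    proof (rule ccontr)
      assume "i \<noteq> 0"
      with i True have "ns ! 0 \<in> set ms"
        by (cases ns; cases i) (auto simp: del_def)
      with Cons.prems(1) have "m < ns ! 0" by simp
      moreover have "ns ! 0 < ns ! i"
        using Cons.prems(2) i \<open>i \<noteq> 0\<close> by (simp add: sorted_wrt_nth_less)
      ultimately show False using True by simp
    qed
    with True i show ?thesis
      using Cons.IH[of ms] Cons.prems(1) by (cases ns) (auto simp: del_def e_nth)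
  next
    case False
    have "\<not> (i = 0 \<and> m # ms = ns)"
      using False by (auto simp: del_def)
    moreover have "map ?e ns ! i $ m = 0 \<or> dx_list ms (del i (map ?e ns)) = 0"
      using False i Cons.IH[of "del i ns"] Cons.prems(1) sorted_del
      by (auto simp: del_map e_nth)
    ultimately show ?thesis by auto
  qed
  have "dx_list (m # ms) (map ?e ns) =
      (\<Sum>i<length ns. if i = 0 \<and> m # ms = ns then 1 else 0)"
    unfolding dx_list.simps dx_wedge_def length_map
    by (rule sum.cong) (use summand in auto)
  also have "\<dots> = (if m # ms = ns then 1 else 0)"
    by (cases "m # ms = ns") (auto simp: sum.delta)
  finally show ?case .
qed

lemma coeff_dx:
  "coeff (\<lambda>vs ws. dx \<sigma> vs * dx \<tau> ws) \<sigma>' \<tau>' = (if \<sigma> = \<sigma>' \<and> \<tau> = \<tau>' then 1 else 0)"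
proof -
  have "dx \<rho> (basis_vecs \<rho>') = (if \<rho> = \<rho>' then 1 else 0)" for \<rho> \<rho>' :: "'a set"
    unfolding dx_def basis_vecs_def
    by (subst dx_list_axis) (auto simp: strict_sorted_iff sorted_list_of_set_inject)
  then show ?thesis by (simp add: coeff_def)
qed

text \<open>
  One function \<open>s_map\<close> serves for all \<open>s\<^sup>k\<^sup>,\<^sup>l\<close>, because a form carries its degrees.
\<close>

definition s_map :: "'n::finite biform \<Rightarrow> 'n biform" where
  "s_map \<mu> vs ws = (\<Sum>i<length vs. (-1) ^ i * \<mu> (del i vs) (vs ! i # ws))"

definition s_range_perp :: "int \<Rightarrow> int \<Rightarrow> 'n::{finite,linorder} biform set" where
  "s_range_perp J k =
     {\<mu> \<in> Alt2 (k + 1) (J - 1). \<forall>\<nu> \<in> s_map ` Alt2 k J. form_inner \<mu> \<nu> = 0}"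

definition orth_proj :: "'n::{finite,linorder} biform set \<Rightarrow> 'n biform \<Rightarrow> 'n biform" where
  "orth_proj V \<mu> = (THE \<nu>. \<nu> \<in> V \<and> (\<forall>\<omega>\<in>V. form_inner (\<mu> - \<nu>) \<omega> = 0))"

text \<open>
  For \<open>k = n + 1\<close> this is the zero space, because \<^term>\<open>Alt k\<close> is.
\<close>

definition EE :: "int \<Rightarrow> int \<Rightarrow> 'n::{finite,linorder} biform set" where
  "EE J k = (if k \<le> J - 1 then s_range_perp J (k - 1)
             else {\<mu> \<in> Alt2 k J. \<forall>vs ws. s_map \<mu> vs ws = 0})"

definition ldeg :: "int \<Rightarrow> int \<Rightarrow> int" where
  "ldeg J k = (if k \<le> J - 1 then J - 1 else J)"


section \<open>Square-integrable functions and operators on the unit cube\<close>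

text \<open>
  Elements of \<open>L\<^sup>2\<close> are represented by Borel functions and equality in \<open>L\<^sup>2\<close> is
  equality almost everywhere. The interval is the case \<^typ>\<open>real\<close>, the \<open>n\<close>-cube the case
  \<open>real^'n\<close>.
\<close>

abbreviation cube :: "'a::euclidean_space measure" where
  "cube \<equiv> restrict_space lborel (cbox 0 One)"

definition L2 :: "('a::euclidean_space \<Rightarrow> real) set" where
  "L2 = {f \<in> borel_measurable cube. integrable cube (\<lambda>x. (f x)\<^sup>2)}"

definition L2_norm :: "('a::euclidean_space \<Rightarrow> real) \<Rightarrow> real" where
  "L2_norm f = sqrt (\<integral>x. (f x)\<^sup>2 \<partial>cube)"

definition L2_eq :: "('a::euclidean_space \<Rightarrow> real) \<Rightarrow> ('a \<Rightarrow> real) \<Rightarrow> bool" where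
  "L2_eq f g \<longleftrightarrow> (AE x in cube. f x = g x)"

definition L2_fin_dim_subspace :: "('a::euclidean_space \<Rightarrow> real) set \<Rightarrow> bool" where
  "L2_fin_dim_subspace S \<longleftrightarrow>
     (\<exists>B. finite B \<and> B \<subseteq> L2 \<and> S = {f \<in> L2. \<exists>c. L2_eq f (\<lambda>x. \<Sum>b\<in>B. c b * b x)})"

text \<open>Linearity and boundedness imply that the operator respects equality almost everywhere.\<close>

definition L2_bounded_linear ::
    "(('a::euclidean_space \<Rightarrow> real) \<Rightarrow> ('a \<Rightarrow> real)) \<Rightarrow> bool" where
  "L2_bounded_linear T \<longleftrightarrow>
     (\<forall>f\<in>L2. T f \<in> L2) \<and>
     (\<forall>f\<in>L2. \<forall>g\<in>L2. L2_eq (T (\<lambda>x. f x + g x)) (\<lambda>x. T f x + T g x)) \<and>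
     (\<forall>c. \<forall>f\<in>L2. L2_eq (T (\<lambda>x. c * f x)) (\<lambda>x. c * T f x)) \<and>
     (\<exists>C. \<forall>f\<in>L2. L2_norm (T f) \<le> C * L2_norm f)"

definition is_tensor_op ::
    "('n::finite \<Rightarrow> (real \<Rightarrow> real) \<Rightarrow> (real \<Rightarrow> real)) \<Rightarrow>
     ((real^'n \<Rightarrow> real) \<Rightarrow> (real^'n \<Rightarrow> real)) \<Rightarrow> bool" where
  "is_tensor_op A T \<longleftrightarrow> L2_bounded_linear T \<and>
     (\<forall>f. (\<forall>m. f m \<in> L2) \<longrightarrow>
        L2_eq (T (\<lambda>x. \<Prod>m\<in>UNIV. f m (x $ m))) (\<lambda>x. \<Prod>m\<in>UNIV. A m (f m) (x $ m)))"

text \<open>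
  Two operators satisfying \<^const>\<open>is_tensor_op\<close> agree up to equality almost everywhere, as the
  product functions span a dense subspace; the choice only fixes representatives.
\<close>

definition tensor_op ::
    "('n::finite \<Rightarrow> (real \<Rightarrow> real) \<Rightarrow> (real \<Rightarrow> real)) \<Rightarrow>
     (real^'n \<Rightarrow> real) \<Rightarrow> (real^'n \<Rightarrow> real)" where
  "tensor_op A = (SOME T. is_tensor_op A T)"


section \<open>Test functions and weak derivatives\<close>

definition pd :: "'a::euclidean_space \<Rightarrow> ('a \<Rightarrow> real) \<Rightarrow> 'a \<Rightarrow> real" where
  "pd b \<phi> x = frechet_derivative \<phi> (at x) b"

text \<open>
  Smoothness: all iterated partial derivatives are (Frechet) differentiable everywhere.
\<close>

definition smooth :: "('a::euclidean_space \<Rightarrow> real) \<Rightarrow> bool" where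
  "smooth \<phi> \<longleftrightarrow> (\<forall>bs. set bs \<subseteq> Basis \<longrightarrow> foldr pd bs \<phi> differentiable_on UNIV)"

definition test_functions :: "('a::euclidean_space \<Rightarrow> real) set" where
  "test_functions = {\<phi>. smooth \<phi> \<and> closure {x. \<phi> x \<noteq> 0} \<subseteq> box 0 One}"

text \<open>In one dimension, \<open>u\<close> lies in \<open>H\<^sup>1\<close> iff \<open>weak_deriv u u'\<close> for some \<open>u'\<close>.\<close>

definition weak_deriv :: "(real \<Rightarrow> real) \<Rightarrow> (real \<Rightarrow> real) \<Rightarrow> bool" where
  "weak_deriv u u' \<longleftrightarrow> u \<in> L2 \<and> u' \<in> L2 \<and>
     (\<forall>\<phi>\<in>test_functions. (\<integral>x. u x * deriv \<phi> x \<partial>cube) = - (\<integral>x. u' x * \<phi> x \<partial>cube))"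


section \<open>The BGG operators\<close>

text \<open>
  A form-valued distribution is represented by its action on test functions. The operators
  below make sense for arbitrary functionals, and are only applied to distributions of the
  form \<^term>\<open>regular u\<close> and what results from these.
\<close>

type_synonym 'n form_distr = "(real^'n \<Rightarrow> real) \<Rightarrow> 'n biform"

definition regular :: "(real^'n::_ \<Rightarrow> 'n::{finite,linorder} biform) \<Rightarrow> 'n form_distr" where
  "regular u \<phi> vs ws = (\<integral>x. u x vs ws * \<phi> x \<partial>cube)"

definition pd_distr :: "'n::finite \<Rightarrow> 'n form_distr \<Rightarrow> 'n form_distr" where
  "pd_distr m T \<phi> vs ws = - T (pd (axis m 1) \<phi>) vs ws"

definition d_distr :: "'n::finite form_distr \<Rightarrow> 'n form_distr" where
  "d_distr T \<phi> vs ws = (\<Sum>m\<in>UNIV. dx_wedge m (\<lambda>vs'. pd_distr m T \<phi> vs' ws) vs)"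

definition app_distr :: "('n::finite biform \<Rightarrow> 'n biform) \<Rightarrow> 'n form_distr \<Rightarrow> 'n form_distr" where
  "app_distr A T \<phi> = A (T \<phi>)"

definition BGG :: "int \<Rightarrow> int \<Rightarrow> 'n::{finite,linorder} form_distr \<Rightarrow> 'n form_distr" where
  "BGG J k T =
     (if k < J - 1 then app_distr (orth_proj (s_range_perp J k)) (d_distr T)
      else if k = J - 1 then d_distr (app_distr (inv_into (Alt2 (J - 1) J) s_map) (d_distr T))
      else d_distr T)"

text \<open>\<open>L\<^sup>2\<close> functions with values in a subspace \<open>V\<close> of some \<^term>\<open>Alt2 k l\<close>.\<close>

definition L2_forms ::
    "'n::{finite,linorder} biform set \<Rightarrow> (real^'n::_ \<Rightarrow> 'n biform) set" where
  "L2_forms V = {u. (AE x in cube. u x \<in> V) \<and> (\<forall>vs ws. (\<lambda>x. u x vs ws) \<in> L2)}"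

definition form_norm :: "(real^'n::_ \<Rightarrow> 'n::{finite,linorder} biform) \<Rightarrow> real" where
  "form_norm u = sqrt (\<integral>x. form_inner (u x) (u x) \<partial>cube)"

definition is_BGG_L2 :: "int \<Rightarrow> int \<Rightarrow> (real^'n::_ \<Rightarrow> 'n::{finite,linorder} biform) \<Rightarrow>
    (real^'n::_ \<Rightarrow> 'n biform) \<Rightarrow> bool" where
  "is_BGG_L2 J k u v \<longleftrightarrow> v \<in> L2_forms (EE J (k + 1)) \<and>
     (\<forall>\<phi>\<in>test_functions. BGG J k (regular u) \<phi> = regular v \<phi>)"

definition H_BGG :: "int \<Rightarrow> int \<Rightarrow> (real^'n::_ \<Rightarrow> 'n::{finite,linorder} biform) set" where
  "H_BGG J k = {u \<in> L2_forms (EE J k). \<exists>v. is_BGG_L2 J k u v}"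

text \<open>The chosen \<open>v\<close> is unique almost everywhere, so the norm does not depend on the choice.\<close>

definition H_norm :: "int \<Rightarrow> int \<Rightarrow> (real^'n::_ \<Rightarrow> 'n::{finite,linorder} biform) \<Rightarrow> real" where
  "H_norm J k u = sqrt ((form_norm u)\<^sup>2 + (form_norm (SOME v. is_BGG_L2 J k u v))\<^sup>2)"


section \<open>The tensor product quasi-interpolation operators\<close>

text \<open>
  \<open>p m i j\<close> is the coefficient operator of the one-dimensional quasi-interpolation of
  \<open>(i,j)\<close>-forms in direction \<open>m\<close>, and \<^term>\<open>indicator \<sigma> m :: nat\<close> is \<open>\<chi>\<^sub>m(\<sigma>)\<close>.
\<close>

definition pi_tensor :: "('n::{finite,linorder} \<Rightarrow> nat \<Rightarrow> nat \<Rightarrow> (real \<Rightarrow> real) \<Rightarrow> (real \<Rightarrow> real)) \<Rightarrow>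
    int \<Rightarrow> int \<Rightarrow> (real^'n::_ \<Rightarrow> 'n biform) \<Rightarrow> (real^'n::_ \<Rightarrow> 'n biform)" where
  "pi_tensor p k l u x vs ws =
     (\<Sum>\<sigma> | int (card \<sigma>) = k. \<Sum>\<tau> | int (card \<tau>) = l.
        tensor_op (\<lambda>m. p m (indicator \<sigma> m) (indicator \<tau> m)) (\<lambda>y. coeff (u y) \<sigma> \<tau>) x
          * dx \<sigma> vs * dx \<tau> ws)"

definition quasi_interp_1d ::
    "(nat \<Rightarrow> (real \<Rightarrow> real) set) \<Rightarrow> (nat \<Rightarrow> nat \<Rightarrow> (real \<Rightarrow> real) \<Rightarrow> (real \<Rightarrow> real)) \<Rightarrow> bool" where
  "quasi_interp_1d S p \<longleftrightarrow>
     (\<forall>a\<in>{0,1,2}. L2_fin_dim_subspace (S a)) \<and>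
     (\<forall>a\<in>{0,1}. (\<forall>f\<in>S a. \<exists>g\<in>S (a + 1). weak_deriv f g) \<and>
                 (\<forall>g\<in>S (a + 1). \<exists>f\<in>S a. weak_deriv f g)) \<and>
     (\<forall>i\<in>{0,1}. \<forall>j\<in>{0,1}. L2_bounded_linear (p i j) \<and> (\<forall>f\<in>L2. p i j f \<in> S (i + j))) \<and>
     (\<forall>j\<in>{0,1}. \<forall>u u'. weak_deriv u u' \<longrightarrow> weak_deriv (p 0 j u) (p 1 j u')) \<and>
     (\<forall>f\<in>L2. L2_eq (p 0 1 f) (p 1 0 f))"

end

theory Submission
  imports Defs
begin

text \<open>
  The operator acting on the coefficient of \<open>dx\<^sup>\<sigma> \<otimes> dx\<^sup>\<tau>\<close> depends only on the weight
  \<open>\<chi>(\<sigma>) + \<chi>(\<tau>)\<close>, because \<open>\<pi>\<^sup>0\<^sup>,\<^sup>1 = \<pi>\<^sup>1\<^sup>,\<^sup>0\<close>. The map \<open>s\<close>, its inverse in degree \<open>J - 1\<close> and the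
  orthogonal projections preserve the weight, so the tensor product operators commute with them
  and preserve the spaces \<open>E\<^sup>k\<close>. Boundedness in the graph norm therefore follows from
  \<open>\<D>\<^sup>k \<pi> = \<pi> \<D>\<^sup>k\<close>. As \<open>\<D>\<^sup>k u \<in> L\<^sup>2\<close> does not imply that the individual derivatives of
  \<open>u\<close> lie in \<open>L\<^sup>2\<close>, this is proved by duality. Each one-dimensional operator has finite rank,
  \<open>f \<mapsto> \<Sum>a. \<langle>g\<^sub>a, f\<rangle> e\<^sub>a\<close>; the commutation with weak differentiation forces the \<open>g\<^sub>a\<close> of weight
  \<open>w\<close> to have \<open>w\<close> derivatives in \<open>L\<^sup>2\<close>, the derivatives below order \<open>w\<close> vanishing at the end
  points. Products of the \<open>g\<^sub>a\<close> are hence limits of test functions together with all the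
  derivatives that occur in \<open>\<D>\<^sup>k\<close>, and may be used to test the equation \<open>\<D>\<^sup>k u = v\<close>.
\<close>

section \<open>Alternating forms\<close>

text \<open>The duality closes up because of the weights. In row \<open>p\<close> of the matrix of
  \<open>BGG J k\<close>, the component \<open>q\<close> is differentiated along a list of
  directions whose multiplicities are exactly \<open>weight p - weight q\<close>. Moving these
  derivatives off the product functions \<open>E (weight q)\<close> therefore always lands in the
  single span of the functions \<open>E (weight p)\<close>, and the functionals that appear as
  coefficients are mixed derivatives of the same dual products. One scalar identity per index thus
  settles the whole row, and no \<open>g\<close> is ever differentiated more often than its weight
  allows. The \<open>g\<close> themselves are not smooth and cannot be inserted into a
  distributional equation. Their vanishing at the end points is expressed by testing against all of
  H1 without boundary conditions, and test functions approximating them are built by integrating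
  upwards from weight 0, where plain density is enough. Since \<open>tensor_op\<close> is an
  arbitrary choice of representative, the explicit finite rank operator may replace it only after
  uniqueness up to null sets has been shown.\<close>

lemma del_append_middle: "del (length xs) (xs @ a # ys) = xs @ ys"
  by (simp add: del_def)

lemma length_del: "i < length xs \<Longrightarrow> length (del i xs) = length xs - 1"
  by (simp add: del_def)

lemma del_0_Cons: "del 0 (x # xs) = xs"
  by (simp add: del_def)

lemma del_Suc_Cons: "del (Suc i) (x # xs) = x # del i xs"
  by (simp add: del_def)

lemma del_map: "del i (map f xs) = map f (del i xs)"
  by (simp add: del_def take_map drop_map)

section \<open>Elementary rules for alternating forms\<close>

lemma Alt_length: "\<alpha> \<in> Alt k \<Longrightarrow> int (length vs) \<noteq> k \<Longrightarrow> \<alpha> vs = 0"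
  by (simp add: Alt_def)

lemma Alt_linear: "\<alpha> \<in> Alt k \<Longrightarrow> linear (\<lambda>v. \<alpha> (xs @ v # ys))"
proof -
  assume a: "\<alpha> \<in> Alt k"
  have "linear (\<lambda>v. \<alpha> ((xs @ 0 # ys)[length xs := v]))"
    using a unfolding Alt_def by (simp del: list_update_length)
  then show ?thesis by simp
qed

lemma Alt_repeat: "\<alpha> \<in> Alt k \<Longrightarrow> \<alpha> (xs @ v # ys @ v # zs) = 0"
proof -
  assume a: "\<alpha> \<in> Alt k"
  let ?l = "xs @ v # ys @ v # zs"
  have "?l ! length xs = ?l ! (length xs + Suc (length ys))"
    by (simp add: nth_append)
  moreover have "length xs < length xs + Suc (length ys)" "length xs + Suc (length ys) < length ?l"
    by auto
  ultimately show ?thesis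
    using a unfolding Alt_def by blast
qed

lemma Alt_not_distinct: "\<alpha> \<in> Alt k \<Longrightarrow> \<not> distinct vs \<Longrightarrow> \<alpha> vs = 0"
  using not_distinct_decomp[of vs] Alt_repeat by fastforce

lemma AltI:
  assumes "\<And>vs. int (length vs) \<noteq> k \<Longrightarrow> \<alpha> vs = 0"
    and "\<And>xs ys. linear (\<lambda>v. \<alpha> (xs @ v # ys))"
    and "\<And>xs v ys zs. \<alpha> (xs @ v # ys @ v # zs) = 0"
  shows "\<alpha> \<in> Alt k"
  unfolding Alt_def
proof (intro CollectI conjI allI impI)
  fix vs :: "(real^'a) list" and i
  assume "i < length vs"
  then show "linear (\<lambda>v. \<alpha> (vs[i := v]))"
    using assms(2)[of "take i vs" "drop (Suc i) vs"] by (simp add: upd_conv_take_nth_drop)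
next
  fix vs :: "(real^'a) list" and i j
  assume "i < j \<and> j < length vs \<and> vs ! i = vs ! j"
  then have i: "i < j" "j < length vs" "vs ! i = vs ! j" by auto
  have "vs = take i vs @ vs ! i # drop (Suc i) vs"
    by (rule id_take_nth_drop) (use i in simp)
  moreover have "drop (Suc i) vs = take (j - Suc i) (drop (Suc i) vs) @ vs ! j # drop (Suc j) vs"
    using id_take_nth_drop[of "j - Suc i" "drop (Suc i) vs"] i by simp
  ultimately have "vs = take i vs @ vs ! j # take (j - Suc i) (drop (Suc i) vs) @ vs ! j # drop (Suc j) vs"
    using i by simp
  then show "\<alpha> vs = 0" using assms(3) by metis
qed (use assms(1) in auto)

text \<open>Polarisation: the form vanishes with \<open>a + b\<close> in both slots, and expanding
  leaves only the two mixed terms.\<close>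

lemma Alt_swap:
  assumes "\<alpha> \<in> Alt k"
  shows "\<alpha> (xs @ a # b # ys) = - \<alpha> (xs @ b # a # ys)"
proof -
  note lin = Alt_linear[OF assms]
  have l1: "\<alpha> (xs @ (u + v) # zs) = \<alpha> (xs @ u # zs) + \<alpha> (xs @ v # zs)" for u v zs
    using linear_add[OF lin[of xs zs]] .
  have l2: "\<alpha> (xs @ w # (u + v) # zs) = \<alpha> (xs @ w # u # zs) + \<alpha> (xs @ w # v # zs)" for u v w zs
    using linear_add[OF lin[of "xs @ [w]" zs]] by simp
  have z: "\<alpha> (xs @ c # c # ys) = 0" for c
    using Alt_repeat[OF assms, of xs c "[]" ys] by simp
  have "\<alpha> (xs @ (a + b) # (a + b) # ys) = 0" by (rule z)
  then have "\<alpha> (xs @ a # a # ys) + \<alpha> (xs @ a # b # ys) +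
      (\<alpha> (xs @ b # a # ys) + \<alpha> (xs @ b # b # ys)) = 0"
    by (simp only: l1 l2)
  then show ?thesis by (simp add: z)
qed

lemma Alt_move:
  assumes "\<alpha> \<in> Alt k"
  shows "\<alpha> (zs @ xs @ a # ys) = (-1) ^ length xs * \<alpha> (zs @ a # xs @ ys)"
proof (induction xs arbitrary: zs)
  case (Cons x xs)
  have "\<alpha> (zs @ (x # xs) @ a # ys) = \<alpha> ((zs @ [x]) @ xs @ a # ys)" by simp
  also have "\<dots> = (-1) ^ length xs * \<alpha> ((zs @ [x]) @ a # xs @ ys)" by (rule Cons.IH)
  also have "\<alpha> ((zs @ [x]) @ a # xs @ ys) = - \<alpha> (zs @ a # (x # xs) @ ys)"
    using Alt_swap[OF assms, of zs x a] by simp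
  finally show ?case by simp
qed simp

text \<open>Needed for the commutator of s and t, to recognise the terms in which a vector is taken
  out and put back in front.\<close>

lemma Alt_nth_del:
  assumes "\<alpha> \<in> Alt k" "i < length vs"
  shows "\<alpha> (vs ! i # del i vs) = (-1) ^ i * \<alpha> vs"
proof -
  have "\<alpha> vs = \<alpha> ([] @ take i vs @ vs ! i # drop (Suc i) vs)"
    using assms(2) by (simp add: id_take_nth_drop[symmetric])
  also have "\<dots> = (-1) ^ i * \<alpha> (vs ! i # del i vs)"
    unfolding Alt_move[OF assms(1)] using assms(2) by (simp add: del_def min_def)
  finally show ?thesis
    by (simp flip: power_add mult.assoc)
qed

subsection \<open>Alternating sums\<close>

text \<open>Common pattern of the wedge product with a coordinate form and of s: a vector is taken
  out with a sign and handed to \<open>F\<close>. Alternation is then proved once for both.\<close>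

definition alt_sum :: "('v \<Rightarrow> 'v list \<Rightarrow> real) \<Rightarrow> 'v list \<Rightarrow> real" where
  "alt_sum F vs = (\<Sum>i<length vs. (-1) ^ i * F (vs ! i) (del i vs))"

text \<open>Isolates the slot of \<open>a\<close>: the vector taken out stands before it, is
  \<open>a\<close> itself, or stands after it. Linearity in the slot and vanishing on repeated
  vectors are both read off from this form.\<close>

lemma alt_sum_split:
  "alt_sum F (xs @ a # ys) =
     (\<Sum>i<length xs. (-1) ^ i * F (xs ! i) (del i xs @ a # ys))
     + (-1) ^ length xs * F a (xs @ ys)
     + (\<Sum>i<length ys. (-1) ^ Suc (length xs + i) * F (ys ! i) (xs @ a # del i ys))"
proof -
  let ?t = "\<lambda>i. (-1) ^ i * F ((xs @ a # ys) ! i) (del i (xs @ a # ys))"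
  have 1: "(\<Sum>i<length xs + k. f i) = (\<Sum>i<length xs. f i) + (\<Sum>i<k. f (length xs + i))"
    for f :: "nat \<Rightarrow> real" and k
    by (induction k) auto
  have "alt_sum F (xs @ a # ys) = (\<Sum>i<length xs. ?t i) + (\<Sum>i<Suc (length ys). ?t (length xs + i))"
    using 1[of ?t "Suc (length ys)"]
    unfolding alt_sum_def length_append list.size(4) One_nat_def add_Suc_right add_0_right by simp
  also have "(\<Sum>i<Suc (length ys). ?t (length xs + i)) =
      ?t (length xs) + (\<Sum>i<length ys. ?t (length xs + Suc i))"
    by (subst sum.lessThan_Suc_shift) simp
  also have "(\<Sum>i<length xs. ?t i) = (\<Sum>i<length xs. (-1) ^ i * F (xs ! i) (del i xs @ a # ys))"
    by (rule sum.cong) (auto simp: nth_append del_def)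
  also have "(\<Sum>i<length ys. ?t (length xs + Suc i)) =
      (\<Sum>i<length ys. (-1) ^ Suc (length xs + i) * F (ys ! i) (xs @ a # del i ys))"
    by (rule sum.cong) (auto simp: nth_append del_def)
  also have "?t (length xs) = (-1) ^ length xs * F a (xs @ ys)"
    by (simp add: del_append_middle)
  finally show ?thesis by (simp add: add.assoc)
qed

lemma alt_sum_in_Alt:
  fixes F :: "real^'n::finite \<Rightarrow> (real^'n) list \<Rightarrow> real"
  assumes F: "\<And>v. F v \<in> Alt k" and lin: "\<And>vs. linear (\<lambda>v. F v vs)"
  shows "alt_sum F \<in> Alt (k + 1)"
proof (rule AltI)
  fix vs :: "(real^'n) list" assume "int (length vs) \<noteq> k + 1"
  then show "alt_sum F vs = 0"
    unfolding alt_sum_def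
    by (intro sum.neutral) (auto simp: Alt_length[OF F] length_del)
next
  fix xs ys :: "(real^'n) list"
  have "linear (\<lambda>v. F w (xs' @ v # ys'))" for w xs' ys' by (rule Alt_linear[OF F])
  then show "linear (\<lambda>v. alt_sum F (xs @ v # ys))"
    unfolding alt_sum_split
    by (intro linear_compose_add linear_compose_sum ballI linear_compose_scale_right lin
        | simp only: real_scaleR_def[symmetric])+
next
  fix xs ys zs :: "(real^'n) list" and v
  have z1: "F w (xs' @ v # ys' @ v # zs') = 0" for w xs' ys' zs'
    by (rule Alt_repeat[OF F])
  \<comment> \<open>Only the two terms that take out one of the equal vectors survive. They differ
    by moving \<open>v\<close> across \<open>ys\<close>, and with the sign of that move they
    cancel.\<close>
  let ?A = "\<lambda>i. (-1) ^ Suc (length xs + i) * F ((ys @ v # zs) ! i) (xs @ v # del i (ys @ v # zs))"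
  have "alt_sum F (xs @ v # ys @ v # zs) =
     (-1) ^ length xs * F v (xs @ ys @ v # zs) + (\<Sum>i<length (ys @ v # zs). ?A i)"
    unfolding alt_sum_split by (simp add: z1)
  also have "(\<Sum>i<length (ys @ v # zs). ?A i) = ?A (length ys)"
  proof -
    have "?A i = 0" if i: "i < length (ys @ v # zs)" "i \<noteq> length ys" for i
    proof (cases "i < length ys")
      case True
      then have "del i (ys @ v # zs) = del i ys @ v # zs" by (simp add: del_def)
      then show ?thesis by (simp add: z1)
    next
      case False
      then obtain j where j: "i = length ys + Suc j"
        using i by (metis add_Suc_right less_imp_Suc_add linorder_neqE_nat)
      have "del i (ys @ v # zs) = ys @ v # del j zs" by (simp add: del_def j)
      then show ?thesis by (simp add: z1)
    qed
    then have "(\<Sum>i<length (ys @ v # zs). ?A i) = (\<Sum>i\<in>{length ys}. ?A i)"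
      by (intro sum.mono_neutral_right) auto
    then show ?thesis by simp
  qed
  also have "?A (length ys) = (-1) ^ Suc (length xs + length ys) * F v (xs @ v # ys @ zs)"
    by (simp add: del_append_middle)
  also have "F v (xs @ ys @ v # zs) = (-1) ^ length ys * F v (xs @ v # ys @ zs)"
    by (rule Alt_move[OF F])
  finally show "alt_sum F (xs @ v # ys @ v # zs) = 0"
    by (simp add: power_add)
qed

lemma dx_wedge_alt_sum: "dx_wedge m \<alpha> = alt_sum (\<lambda>v vs. v $ m * \<alpha> vs)"
  by (auto simp: fun_eq_iff dx_wedge_def alt_sum_def mult.assoc)

lemma s_map_alt_sum: "s_map \<mu> vs ws = alt_sum (\<lambda>v vs. \<mu> vs (v # ws)) vs"
  by (simp add: s_map_def alt_sum_def)

lemma Alt_0 [simp]: "(\<lambda>_. 0) \<in> Alt k"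
  by (rule AltI) (auto intro: linear_zero)

lemma Alt_add: "\<alpha> \<in> Alt k \<Longrightarrow> \<beta> \<in> Alt k \<Longrightarrow> (\<lambda>vs. \<alpha> vs + \<beta> vs) \<in> Alt k"
  by (rule AltI) (auto intro: linear_compose_add Alt_linear simp: Alt_length Alt_repeat)

lemma Alt_scale: "\<alpha> \<in> Alt k \<Longrightarrow> (\<lambda>vs. c * \<alpha> vs) \<in> Alt k"
  by (rule AltI)
    (auto intro: linear_compose_scale_right[where 'b=real, simplified] Alt_linear
      simp: Alt_length Alt_repeat)

lemma dx_wedge_in_Alt: "\<alpha> \<in> Alt k \<Longrightarrow> dx_wedge m \<alpha> \<in> Alt (k + 1)"
  unfolding dx_wedge_alt_sum
  by (rule alt_sum_in_Alt)
    (auto intro!: Alt_scale linearI simp: distrib_right)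

lemma dx_list_in_Alt: "dx_list ms \<in> Alt (int (length ms))"
proof (induction ms)
  case Nil
  show ?case by (rule AltI) (auto intro: linear_zero)
next
  case (Cons m ms)
  then show ?case using dx_wedge_in_Alt[of "dx_list ms" "int (length ms)" m] by (simp add: add.commute)
qed

lemma dx_in_Alt: "dx \<sigma> \<in> Alt (int (card \<sigma>))"
  unfolding dx_def using dx_list_in_Alt[of "sorted_list_of_set \<sigma>"] by simp

text \<open>Insertion sort, each insertion being one \<open>Alt_move\<close>. The sign stays
  unspecified because only vanishing or non-vanishing is ever transferred.\<close>

lemma Alt_sort:
  fixes f :: "'b::linorder \<Rightarrow> real^'n::finite"
  assumes "\<alpha> \<in> Alt k"
  shows "\<exists>c\<in>{1,-1}. \<alpha> (ys @ map f xs) = c * \<alpha> (ys @ map f (sort xs))"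
proof (induction xs arbitrary: ys)
  case (Cons x xs)
  obtain c where c: "c \<in> {1,-1}"
    "\<alpha> ((ys @ [f x]) @ map f xs) = c * \<alpha> ((ys @ [f x]) @ map f (sort xs))"
    using Cons.IH by blast
  obtain as bs where ab: "sort xs = as @ bs" "insort x (sort xs) = as @ x # bs"
  proof -
    have "\<exists>as bs. zs = as @ bs \<and> insort x zs = as @ x # bs" for zs
    proof (induction zs)
      case (Cons z zs)
      then obtain as bs where h: "zs = as @ bs" "insort x zs = as @ x # bs" by blast
      show ?case
      proof (cases "x \<le> z")
        case True
        then have "z # zs = [] @ (z # zs) \<and> insort x (z # zs) = [] @ x # (z # zs)" by simp
        then show ?thesis by blast
      next
        case False
        with h have "z # zs = (z # as) @ bs \<and> insort x (z # zs) = (z # as) @ x # bs" by simp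
        then show ?thesis by blast
      qed
    qed simp
    then show ?thesis using that by blast
  qed
  have "\<alpha> (ys @ map f as @ f x # map f bs) = (-1) ^ length as * \<alpha> (ys @ f x # map f as @ map f bs)"
    using Alt_move[OF assms, of ys "map f as" "f x" "map f bs"] by simp
  then have "\<alpha> (ys @ f x # map f (sort xs)) = (-1) ^ length as * \<alpha> (ys @ map f (sort (x # xs)))"
    using ab by (simp flip: power_add mult.assoc)
  then have "\<alpha> (ys @ map f (x # xs)) = (c * (-1) ^ length as) * \<alpha> (ys @ map f (sort (x # xs)))"
    using c(2) by simp
  moreover have "c * (-1) ^ length as \<in> {1,-1}"
    using c(1) by (cases "even (length as)") auto
  ultimately show ?case by blast
qed simp

text \<open>Expand every argument in the standard basis: a list of basis vectors either repeats an
  entry or is, up to sign, one of the sorted lists \<open>basis_vecs\<close>.\<close>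

lemma Alt_eq_0:
  fixes \<alpha> :: "(real^'n::{finite,linorder}) list \<Rightarrow> real"
  assumes "\<alpha> \<in> Alt k" and 0: "\<And>\<sigma>. \<alpha> (basis_vecs \<sigma>) = 0"
  shows "\<alpha> vs = 0"
proof -
  let ?e = "\<lambda>m::'n. axis m (1::real)"
  have basis: "\<alpha> (map ?e ms) = 0" for ms
  proof (cases "distinct ms")
    case True
    then have "sort ms = sorted_list_of_set (set ms)"
      by (simp add: sorted_list_of_set_sort_remdups distinct_remdups_id)
    then have "\<alpha> (map ?e (sort ms)) = 0" using 0[of "set ms"] by (simp add: basis_vecs_def)
    then show ?thesis using Alt_sort[OF assms(1), of "[]" ?e ms] by auto
  next
    case False
    then show ?thesis by (intro Alt_not_distinct[OF assms(1)]) (auto simp: distinct_map)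
  qed
  \<comment> \<open>Induction on the arguments not yet expanded; \<open>ms\<close> records the basis
    vectors already substituted for the others.\<close>
  have "\<alpha> (map ?e ms @ vs) = 0" for ms
  proof (induction vs arbitrary: ms)
    case (Cons v vs)
    have lin: "linear (\<lambda>v. \<alpha> (map ?e ms @ v # vs))" by (rule Alt_linear[OF assms(1)])
    have v: "v = (\<Sum>m\<in>UNIV. v $ m *\<^sub>R ?e m)"
      using basis_expansion[of v] by (simp add: scalar_mult_eq_scaleR)
    have "\<alpha> (map ?e ms @ v # vs) = (\<Sum>m\<in>UNIV. v $ m *\<^sub>R \<alpha> (map ?e ms @ ?e m # vs))"
      by (subst v) (simp only: linear_sum[OF lin] linear_scale[OF lin])
    also have "\<dots> = 0"
    proof (rule sum.neutral, rule ballI)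
      fix m
      have "\<alpha> (map ?e (ms @ [m]) @ vs) = 0" by (rule Cons.IH)
      then show "v $ m *\<^sub>R \<alpha> (map ?e ms @ ?e m # vs) = 0" by simp
    qed
    finally show ?case .
  qed (simp add: basis)
  from this[of "[]"] show ?thesis by simp
qed

subsection \<open>Biforms and their coefficients\<close>

lemma Alt2_Alt: "\<mu> \<in> Alt2 k l \<Longrightarrow> \<mu> vs \<in> Alt l" "\<mu> \<in> Alt2 k l \<Longrightarrow> (\<lambda>vs. \<mu> vs ws) \<in> Alt k"
  by (auto simp: Alt2_def)

lemma Alt2_0 [simp]: "(\<lambda>_ _. 0) \<in> Alt2 k l"
  by (simp add: Alt2_def)

lemma Alt2_add: "\<mu> \<in> Alt2 k l \<Longrightarrow> \<nu> \<in> Alt2 k l \<Longrightarrow> (\<lambda>vs ws. \<mu> vs ws + \<nu> vs ws) \<in> Alt2 k l"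
  by (simp add: Alt2_def Alt_add)

lemma Alt2_scale: "\<mu> \<in> Alt2 k l \<Longrightarrow> (\<lambda>vs ws. c * \<mu> vs ws) \<in> Alt2 k l"
  by (simp add: Alt2_def Alt_scale)

lemma Alt2_lincomb:
  "\<mu> \<in> Alt2 k l \<Longrightarrow> \<nu> \<in> Alt2 k l \<Longrightarrow> (\<lambda>vs ws. a * \<mu> vs ws + b * \<nu> vs ws) \<in> Alt2 k l"
  by (intro Alt2_add Alt2_scale)

lemma Alt2_sum:
  "(\<And>i. i \<in> I \<Longrightarrow> \<mu> i \<in> Alt2 k l) \<Longrightarrow> (\<lambda>vs ws. \<Sum>i\<in>I. \<mu> i vs ws) \<in> Alt2 k l"
  by (induction I rule: infinite_finite_induct) (auto intro: Alt2_add)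

lemma Alt2_diff: "\<mu> \<in> Alt2 k l \<Longrightarrow> \<nu> \<in> Alt2 k l \<Longrightarrow> (\<lambda>vs ws. \<mu> vs ws - \<nu> vs ws) \<in> Alt2 k l"
  using Alt2_lincomb[of \<mu> k l \<nu> 1 "-1"] by simp

text \<open>Bundling the two index sets into one index turns maps between spaces of forms into
  ordinary matrices.\<close>

definition dx2 :: "'n::{finite,linorder} set \<times> 'n set \<Rightarrow> 'n biform" where
  "dx2 q vs ws = dx (fst q) vs * dx (snd q) ws"

definition cf :: "'n::{finite,linorder} biform \<Rightarrow> 'n set \<times> 'n set \<Rightarrow> real" where
  "cf \<mu> q = coeff \<mu> (fst q) (snd q)"

definition degs :: "int \<Rightarrow> int \<Rightarrow> ('n::finite set \<times> 'n set) set" where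
  "degs k l = {q. int (card (fst q)) = k \<and> int (card (snd q)) = l}"

definition weight :: "'n set \<times> 'n set \<Rightarrow> 'n \<Rightarrow> nat" where
  "weight q m = indicator (fst q) m + indicator (snd q) m"

lemma length_basis_vecs [simp]: "length (basis_vecs \<sigma>) = card \<sigma>"
  by (simp add: basis_vecs_def)

lemma cf_dx2: "cf (dx2 q) p = (if p = q then 1 else 0)"
proof -
  have "dx2 q = (\<lambda>vs ws. dx (fst q) vs * dx (snd q) ws)" by (simp add: fun_eq_iff dx2_def)
  then show ?thesis by (auto simp: cf_def coeff_dx prod_eq_iff)
qed

lemma dx2_in_Alt2:
  assumes "q \<in> degs k l"
  shows "dx2 q \<in> Alt2 k l"
proof -
  have "(\<lambda>vs. dx2 q vs ws) \<in> Alt k" for ws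
    using Alt_scale[OF dx_in_Alt[of "fst q"], of "dx (snd q) ws"] assms
    by (simp add: dx2_def degs_def mult.commute)
  moreover have "dx2 q vs \<in> Alt l" for vs
    using Alt_scale[OF dx_in_Alt[of "snd q"], of "dx (fst q) vs"] assms
    by (simp add: dx2_def[abs_def] degs_def)
  ultimately show ?thesis by (simp add: Alt2_def)
qed

lemma cf_lincomb: "cf (\<lambda>vs ws. a * \<mu> vs ws + b * \<nu> vs ws) q = a * cf \<mu> q + b * cf \<nu> q"
  by (simp add: cf_def coeff_def)

lemma cf_diff: "cf (\<lambda>vs ws. \<mu> vs ws - \<nu> vs ws) q = cf \<mu> q - cf \<nu> q"
  by (simp add: cf_def coeff_def)

lemma cf_sum: "cf (\<lambda>vs ws. \<Sum>i\<in>I. \<mu> i vs ws) q = (\<Sum>i\<in>I. cf (\<mu> i) q)"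
  by (simp add: cf_def coeff_def)

lemma cf_scale: "cf (\<lambda>vs ws. c * \<mu> vs ws) q = c * cf \<mu> q"
  by (simp add: cf_def coeff_def)

lemma cf_0 [simp]: "cf (\<lambda>_ _. 0) q = 0"
  by (simp add: cf_def coeff_def)

lemma form_inner_cf: "form_inner \<mu> \<nu> = (\<Sum>q\<in>UNIV. cf \<mu> q * cf \<nu> q)"
proof -
  have "form_inner \<mu> \<nu> = (\<Sum>q\<in>UNIV \<times> UNIV. cf \<mu> q * cf \<nu> q)"
    unfolding form_inner_def cf_def by (subst sum.cartesian_product) (simp add: case_prod_beta)
  then show ?thesis by simp
qed

lemma cf_outside: "\<mu> \<in> Alt2 k l \<Longrightarrow> q \<notin> degs k l \<Longrightarrow> cf \<mu> q = 0"
  unfolding cf_def coeff_def degs_def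
  by (auto simp: Alt_length[OF Alt2_Alt(1)] Alt_length[OF Alt2_Alt(2)])

lemma Alt2_eq_0:
  assumes "\<mu> \<in> Alt2 k l" "\<And>q. cf \<mu> q = 0"
  shows "\<mu> = (\<lambda>_ _. 0)"
proof -
  have "\<mu> (basis_vecs \<sigma>) (basis_vecs \<tau>) = 0" for \<sigma> \<tau>
    using assms(2)[of "(\<sigma>,\<tau>)"] by (simp add: cf_def coeff_def)
  then have "\<mu> vs (basis_vecs \<tau>) = 0" for vs \<tau>
    using Alt_eq_0[OF Alt2_Alt(2)[OF assms(1)]] by blast
  then show ?thesis
    using Alt_eq_0[OF Alt2_Alt(1)[OF assms(1)]] by blast
qed

lemma Alt2_eqI:
  assumes "\<mu> \<in> Alt2 k l" "\<nu> \<in> Alt2 k l" "\<And>q. cf \<mu> q = cf \<nu> q"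
  shows "\<mu> = \<nu>"
proof -
  have "(\<lambda>vs ws. \<mu> vs ws - \<nu> vs ws) = (\<lambda>_ _. 0)"
    by (rule Alt2_eq_0[OF Alt2_diff[OF assms(1,2)]]) (simp add: cf_diff assms(3))
  then show ?thesis by (simp add: fun_eq_iff)
qed

lemma form_inner_self_eq_0:
  assumes "\<mu> \<in> Alt2 k l" "form_inner \<mu> \<mu> = 0"
  shows "\<mu> = (\<lambda>_ _. 0)"
proof (rule Alt2_eq_0[OF assms(1)])
  have "\<forall>q\<in>UNIV. cf \<mu> q * cf \<mu> q = 0"
    using assms(2) unfolding form_inner_cf by (subst sum_nonneg_eq_0_iff[symmetric]) auto
  then show "cf \<mu> q = 0" for q using mult_eq_0_iff by blast
qed

text \<open>Both \<open>s\<close> and the projections respect this grading, and the tensor product operator acts on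
  each component through a single scalar operator.\<close>

definition weight_part :: "('n \<Rightarrow> nat) \<Rightarrow> 'n::{finite,linorder} biform \<Rightarrow> 'n biform" where
  "weight_part \<omega> \<mu> vs ws = (\<Sum>q | weight q = \<omega>. cf \<mu> q * dx2 q vs ws)"

lemma cf_weight_part: "cf (weight_part \<omega> \<mu>) p = (if weight p = \<omega> then cf \<mu> p else 0)"
proof -
  have "cf (weight_part \<omega> \<mu>) p = (\<Sum>q | weight q = \<omega>. cf \<mu> q * cf (dx2 q) p)"
    unfolding weight_part_def[abs_def] cf_sum cf_scale ..
  also have "\<dots> = (\<Sum>q | weight q = \<omega>. if p = q then cf \<mu> q else 0)"
    by (rule sum.cong) (auto simp: cf_dx2)
  also have "\<dots> = (if weight p = \<omega> then cf \<mu> p else 0)"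
    by (subst sum.delta') auto
  finally show ?thesis .
qed

lemma weight_part_in_Alt2: "\<mu> \<in> Alt2 k l \<Longrightarrow> weight_part \<omega> \<mu> \<in> Alt2 k l"
  unfolding weight_part_def[abs_def]
proof (rule Alt2_sum)
  fix q assume "\<mu> \<in> Alt2 k l"
  then show "(\<lambda>vs ws. cf \<mu> q * dx2 q vs ws) \<in> Alt2 k l"
    by (cases "q \<in> degs k l") (auto intro: Alt2_scale dx2_in_Alt2 simp: cf_outside)
qed

lemma Alt2_expand:
  assumes "\<mu> \<in> Alt2 k l"
  shows "\<mu> = (\<lambda>vs ws. \<Sum>q\<in>degs k l. cf \<mu> q * dx2 q vs ws)"
proof (rule Alt2_eqI[OF assms])
  show "(\<lambda>vs ws. \<Sum>q\<in>degs k l. cf \<mu> q * dx2 q vs ws) \<in> Alt2 k l"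
    by (intro Alt2_sum Alt2_scale dx2_in_Alt2)
  fix p
  have "cf (\<lambda>vs ws. \<Sum>q\<in>degs k l. cf \<mu> q * dx2 q vs ws) p =
      (\<Sum>q\<in>degs k l. if p = q then cf \<mu> q else 0)"
    unfolding cf_sum cf_scale by (rule sum.cong) (auto simp: cf_dx2)
  also have "\<dots> = cf \<mu> p"
    using cf_outside[OF assms, of p] by (subst sum.delta') auto
  finally show "cf \<mu> p = cf (\<lambda>vs ws. \<Sum>q\<in>degs k l. cf \<mu> q * dx2 q vs ws) p" by simp
qed

subsection \<open>Maps that shift weights\<close>

text \<open>The matrix \<open>K\<close> is part of the notion because matrices are what is
  multiplied when differential operators are composed later. It has to describe \<open>A\<close> on
  \<open>V\<close> only, since \<open>s_inv\<close> is meaningful only on forms of the right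
  degrees.\<close>

definition weight_shift :: "('n \<Rightarrow> nat) \<Rightarrow> 'n::{finite,linorder} biform set \<Rightarrow>
    ('n biform \<Rightarrow> 'n biform) \<Rightarrow> bool" where
  "weight_shift d V A \<longleftrightarrow> (\<exists>K. (\<forall>\<mu>\<in>V. \<forall>p. cf (A \<mu>) p = (\<Sum>q\<in>UNIV. K p q * cf \<mu> q)) \<and>
     (\<forall>p q. K p q \<noteq> 0 \<longrightarrow> weight p = (\<lambda>m. weight q m + d m)))"

definition lin_on :: "'n::finite biform set \<Rightarrow> ('n biform \<Rightarrow> 'n biform) \<Rightarrow> bool" where
  "lin_on V A \<longleftrightarrow> (\<forall>\<mu>\<in>V. \<forall>\<nu>\<in>V. \<forall>a b.
     A (\<lambda>vs ws. a * \<mu> vs ws + b * \<nu> vs ws) = (\<lambda>vs ws. a * A \<mu> vs ws + b * A \<nu> vs ws))"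

lemma lin_onD: "lin_on V A \<Longrightarrow> \<mu> \<in> V \<Longrightarrow> \<nu> \<in> V \<Longrightarrow>
    A (\<lambda>vs ws. a * \<mu> vs ws + b * \<nu> vs ws) = (\<lambda>vs ws. a * A \<mu> vs ws + b * A \<nu> vs ws)"
  unfolding lin_on_def by blast

lemma lin_on_0:
  assumes "lin_on (Alt2 k l) A"
  shows "A (\<lambda>_ _. 0) = (\<lambda>_ _. 0)"
  using lin_onD[OF assms Alt2_0 Alt2_0, of 0 0] by simp

lemma lin_on_sum:
  assumes A: "lin_on (Alt2 k l) A" and "finite I" "\<And>i. i \<in> I \<Longrightarrow> \<mu> i \<in> Alt2 k l"
  shows "A (\<lambda>vs ws. \<Sum>i\<in>I. c i * \<mu> i vs ws) = (\<lambda>vs ws. \<Sum>i\<in>I. c i * A (\<mu> i) vs ws)"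
  using assms(2,3)
proof (induction I rule: finite_induct)
  case (insert i I)
  have "A (\<lambda>vs ws. c i * \<mu> i vs ws + 1 * (\<Sum>i\<in>I. c i * \<mu> i vs ws)) =
      (\<lambda>vs ws. c i * A (\<mu> i) vs ws + 1 * A (\<lambda>vs ws. \<Sum>i\<in>I. c i * \<mu> i vs ws) vs ws)"
    by (rule lin_onD[OF A]) (auto intro!: Alt2_sum Alt2_scale insert.prems)
  then show ?case using insert by simp
qed (simp add: lin_on_0[OF A])

text \<open>The columns of the matrix are the images of the basis forms \<open>dx2 q\<close>;
  columns outside the degrees are set to 0, as those coefficients of the argument vanish
  anyway.\<close>

lemma weight_shiftI:
  assumes A: "lin_on (Alt2 k l) A"
    and K: "\<And>p q. q \<in> degs k l \<Longrightarrow> cf (A (dx2 q)) p \<noteq> 0 \<Longrightarrow> weight p = (\<lambda>m. weight q m + d m)"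
  shows "weight_shift d (Alt2 k l) A"
  unfolding weight_shift_def
proof (intro exI[of _ "\<lambda>p q. if q \<in> degs k l then cf (A (dx2 q)) p else 0"] conjI ballI allI impI)
  fix \<mu> :: "'a biform" and p assume \<mu>: "\<mu> \<in> Alt2 k l"
  have "cf (A \<mu>) p = cf (A (\<lambda>vs ws. \<Sum>q\<in>degs k l. cf \<mu> q * dx2 q vs ws)) p"
    using Alt2_expand[OF \<mu>] by simp
  also have "\<dots> = (\<Sum>q\<in>degs k l. cf \<mu> q * cf (A (dx2 q)) p)"
    by (subst lin_on_sum[OF A]) (auto simp: dx2_in_Alt2 cf_sum cf_scale)
  also have "\<dots> = (\<Sum>q\<in>UNIV. (if q \<in> degs k l then cf (A (dx2 q)) p else 0) * cf \<mu> q)"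
    by (rule sum.mono_neutral_cong_left) auto
  finally show "cf (A \<mu>) p = \<dots>" .
qed (use K in \<open>auto split: if_splits\<close>)

text \<open>The matrix joins only indices of equal weight, so masking by weight before or after it
  gives the same result.\<close>

lemma weight_shift_weight_part:
  assumes "weight_shift (\<lambda>_. 0) (Alt2 k l) A" "\<And>\<mu>. \<mu> \<in> Alt2 k l \<Longrightarrow> A \<mu> \<in> Alt2 k' l'"
    and \<mu>: "\<mu> \<in> Alt2 k l"
  shows "A (weight_part \<omega> \<mu>) = weight_part \<omega> (A \<mu>)"
proof (rule Alt2_eqI)
  show "A (weight_part \<omega> \<mu>) \<in> Alt2 k' l'" "weight_part \<omega> (A \<mu>) \<in> Alt2 k' l'"
    using assms(2) \<mu> by (auto intro: weight_part_in_Alt2)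
  obtain K where K: "\<And>\<mu> p. \<mu> \<in> Alt2 k l \<Longrightarrow> cf (A \<mu>) p = (\<Sum>q\<in>UNIV. K p q * cf \<mu> q)"
    "\<And>p q. K p q \<noteq> 0 \<Longrightarrow> weight p = weight q"
    using assms(1) unfolding weight_shift_def by auto
  fix p
  have "cf (A (weight_part \<omega> \<mu>)) p = (\<Sum>q\<in>UNIV. K p q * (if weight q = \<omega> then cf \<mu> q else 0))"
    by (simp add: K(1) weight_part_in_Alt2 \<mu> cf_weight_part)
  also have "\<dots> = (\<Sum>q\<in>UNIV. if weight p = \<omega> then K p q * cf \<mu> q else 0)"
    using K(2)[of p] by (intro sum.cong refl) (metis mult_zero_left mult_zero_right)
  also have "\<dots> = cf (weight_part \<omega> (A \<mu>)) p"
    by (simp add: K(1) \<mu> cf_weight_part)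
  finally show "cf (A (weight_part \<omega> \<mu>)) p = cf (weight_part \<omega> (A \<mu>)) p" .
qed

text \<open>A criterion for maps without an explicit formula, namely the inverse of s and the
  projections: it is enough that each basis form is sent into its own weight component.\<close>

lemma weight_shift_0I:
  assumes A: "lin_on (Alt2 k l) A"
    and Q: "\<And>q. q \<in> degs k l \<Longrightarrow> weight_part (weight q) (A (dx2 q)) = A (dx2 q)"
  shows "weight_shift (\<lambda>_. 0) (Alt2 k l) A"
proof (rule weight_shiftI[OF A])
  fix p q assume q: "q \<in> degs k l" "cf (A (dx2 q)) p \<noteq> 0"
  have "cf (A (dx2 q)) p = (if weight p = weight q then cf (A (dx2 q)) p else 0)"
    using arg_cong[OF Q[OF q(1)], of "\<lambda>\<mu>. cf \<mu> p"] by (simp add: cf_weight_part)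
  then have "weight p = weight q" using q(2) by (auto split: if_splits)
  then show "weight p = (\<lambda>m. weight q m + 0)" by simp
qed

lemma weight_part_dx2: "weight_part (weight q) (dx2 q) = dx2 q"
  by (rule Alt2_eqI[of _ "int (card (fst q))" "int (card (snd q))"])
    (auto intro!: weight_part_in_Alt2 dx2_in_Alt2 simp: degs_def cf_weight_part cf_dx2)

subsection \<open>The wedge product with a coordinate form and the map s\<close>

definition wedge1 :: "'n::finite \<Rightarrow> 'n biform \<Rightarrow> 'n biform" where
  "wedge1 m \<mu> vs ws = dx_wedge m (\<lambda>vs'. \<mu> vs' ws) vs"

lemma wedge1_in_Alt2: "\<mu> \<in> Alt2 k l \<Longrightarrow> wedge1 m \<mu> \<in> Alt2 (k + 1) l"
proof -
  assume \<mu>: "\<mu> \<in> Alt2 k l"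
  have "(\<lambda>ws. c * \<mu> vs ws) \<in> Alt l" for c vs by (rule Alt_scale[OF Alt2_Alt(1)[OF \<mu>]])
  then have "(\<lambda>ws. \<Sum>i\<in>I. (-1) ^ i * (vs ! i $ m) * \<mu> (del i vs) ws) \<in> Alt l"
    for vs and I :: "nat set"
    by (induction I rule: infinite_finite_induct) (auto intro: Alt_add)
  then have "wedge1 m \<mu> vs \<in> Alt l" for vs
    unfolding wedge1_def[abs_def] dx_wedge_def by blast
  moreover have "(\<lambda>vs. wedge1 m \<mu> vs ws) \<in> Alt (k + 1)" for ws
    unfolding wedge1_def using dx_wedge_in_Alt[OF Alt2_Alt(2)[OF \<mu>]] by simp
  ultimately show ?thesis by (auto simp: Alt2_def)
qed

lemma s_map_in_Alt2: "\<mu> \<in> Alt2 k l \<Longrightarrow> s_map \<mu> \<in> Alt2 (k + 1) (l - 1)"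
proof -
  assume \<mu>: "\<mu> \<in> Alt2 k l"
  have "(\<lambda>ws. \<mu> vs (v # ws)) \<in> Alt (l - 1)" for v vs
  proof (rule AltI)
    fix ws :: "(real^'a) list" assume "int (length ws) \<noteq> l - 1"
    then show "\<mu> vs (v # ws) = 0" by (auto intro!: Alt_length[OF Alt2_Alt(1)[OF \<mu>]])
  next
    fix xs ys show "linear (\<lambda>u. \<mu> vs (v # xs @ u # ys))"
      using Alt_linear[OF Alt2_Alt(1)[OF \<mu>, of vs], of "v # xs" ys] by simp
  next
    fix xs ys zs u show "\<mu> vs (v # xs @ u # ys @ u # zs) = 0"
      using Alt_repeat[OF Alt2_Alt(1)[OF \<mu>, of vs], of "v # xs" u ys zs] by simp
  qed
  then have *: "(\<lambda>ws. c * \<mu> vs (v # ws)) \<in> Alt (l - 1)" for c v vs by (rule Alt_scale)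
  have "(\<lambda>ws. \<Sum>i\<in>I. (-1) ^ i * \<mu> (del i vs) (vs ! i # ws)) \<in> Alt (l - 1)"
    for vs and I :: "nat set"
    by (induction I rule: infinite_finite_induct) (auto intro: Alt_add *)
  then have "s_map \<mu> vs \<in> Alt (l - 1)" for vs
    unfolding s_map_def[abs_def] by blast
  moreover have "(\<lambda>vs. s_map \<mu> vs ws) \<in> Alt (k + 1)" for ws
    unfolding s_map_alt_sum
  proof (rule alt_sum_in_Alt)
    show "(\<lambda>vs. \<mu> vs (v # ws)) \<in> Alt k" for v by (rule Alt2_Alt(2)[OF \<mu>])
    show "linear (\<lambda>v. \<mu> vs (v # ws))" for vs
      using Alt_linear[OF Alt2_Alt(1)[OF \<mu>, of vs], of "[]" ws] by simp
  qed
  ultimately show ?thesis by (auto simp: Alt2_def)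
qed

lemma lin_on_wedge1: "lin_on V (wedge1 m)"
  unfolding lin_on_def wedge1_def dx_wedge_def fun_eq_iff
  by (simp add: sum_distrib_left sum.distrib algebra_simps)

lemma lin_on_s_map: "lin_on V s_map"
  unfolding lin_on_def s_map_def fun_eq_iff
  by (simp add: sum_distrib_left sum.distrib algebra_simps)

lemma del_basis_vecs:
  fixes \<sigma> :: "'n::{finite,linorder} set"
  assumes "i < card \<sigma>"
  shows "del i (basis_vecs \<sigma>) = basis_vecs (\<sigma> - {sorted_list_of_set \<sigma> ! i})"
proof -
  let ?L = "sorted_list_of_set \<sigma>"
  have "del i ?L = sorted_list_of_set (\<sigma> - {?L ! i})"
  proof -
    have L: "?L = take i ?L @ ?L ! i # drop (Suc i) ?L"
      using assms by (intro id_take_nth_drop) simp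
    have d: "distinct (take i ?L @ ?L ! i # drop (Suc i) ?L)"
      using L by (metis distinct_sorted_list_of_set)
    have s: "sorted (take i ?L @ ?L ! i # drop (Suc i) ?L)"
      using L by (metis sorted_sorted_list_of_set)
    have "sorted (del i ?L)" using s by (auto simp: del_def sorted_append)
    moreover have "distinct (del i ?L)" using d by (auto simp: del_def)
    moreover have "set (del i ?L) = \<sigma> - {?L ! i}"
    proof -
      have "\<sigma> = set (take i ?L) \<union> {?L ! i} \<union> set (drop (Suc i) ?L)"
        using arg_cong[OF L, of set] by simp
      then show ?thesis using d by (auto simp: del_def)
    qed
    ultimately show ?thesis
      by (metis finite_code sorted_list_of_set.idem_if_sorted_distinct)
  qed
  then show ?thesis by (simp add: basis_vecs_def del_map)
qed

lemma nth_basis_vecs: "i < card \<sigma> \<Longrightarrow> basis_vecs \<sigma> ! i = axis (sorted_list_of_set \<sigma> ! i) 1"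
  by (simp add: basis_vecs_def)

lemma nth_sorted_list_in: "i < card \<sigma> \<Longrightarrow> sorted_list_of_set \<sigma> ! i \<in> (\<sigma> :: 'n::{finite,linorder} set)"
  by (metis finite_code nth_mem sorted_list_of_set.length_sorted_key_list_of_set set_sorted_list_of_set)

lemma dx_basis_vecs: "dx \<sigma> (basis_vecs \<rho>) = (if \<sigma> = \<rho> then 1 else 0)"
  unfolding dx_def basis_vecs_def
  by (subst dx_list_axis) (auto simp: strict_sorted_iff sorted_list_of_set_inject)

text \<open>A coefficient at \<open>p\<close> can be nonzero only through a term that removes
  \<open>m\<close> from \<open>fst p\<close> and leaves \<open>fst q\<close>, while the second index
  set is untouched.\<close>

lemma weight_shift_wedge1:
  fixes m :: "'n::{finite,linorder}"
  shows "weight_shift (\<lambda>m'. if m' = m then 1 else 0) (Alt2 k l) (wedge1 m)"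
proof (rule weight_shiftI[OF lin_on_wedge1])
  fix p q :: "'n set \<times> 'n set" assume "cf (wedge1 m (dx2 q)) p \<noteq> 0"
  then have "(\<Sum>i<card (fst p). (-1) ^ i * (basis_vecs (fst p) ! i $ m) *
      (dx (fst q) (del i (basis_vecs (fst p))) * dx (snd q) (basis_vecs (snd p)))) \<noteq> 0"
    by (simp add: cf_def coeff_def wedge1_def dx_wedge_def dx2_def)
  then obtain i where i: "i < card (fst p)" "basis_vecs (fst p) ! i $ m \<noteq> 0"
    "dx (fst q) (del i (basis_vecs (fst p))) \<noteq> 0" "dx (snd q) (basis_vecs (snd p)) \<noteq> 0"
    by (elim sum.not_neutral_contains_not_neutral) auto
  have m: "sorted_list_of_set (fst p) ! i = m"
    using i(1,2) by (auto simp: nth_basis_vecs axis_def split: if_splits)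
  then have "m \<in> fst p" using nth_sorted_list_in[OF i(1)] by simp
  moreover have "fst q = fst p - {m}" "snd q = snd p"
    using i(3,4) by (auto simp: del_basis_vecs[OF i(1)] m dx_basis_vecs split: if_splits)
  ultimately show "weight p = (\<lambda>m'. weight q m' + (if m' = m then 1 else 0))"
    by (auto simp: weight_def fun_eq_iff indicator_def)
qed

text \<open>The map s carries one index \<open>m\<close> from the second index set to the first, so
  the sum of the two indicators does not change.\<close>

lemma weight_shift_s_map:
  "weight_shift (\<lambda>_. 0) (Alt2 k l) (s_map :: 'n::{finite,linorder} biform \<Rightarrow> _)"
proof (rule weight_shiftI[OF lin_on_s_map])
  fix p q :: "'n set \<times> 'n set" assume "cf (s_map (dx2 q)) p \<noteq> 0"
  then have "(\<Sum>i<card (fst p). (-1) ^ i *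
      (dx (fst q) (del i (basis_vecs (fst p))) * dx (snd q) (basis_vecs (fst p) ! i # basis_vecs (snd p)))) \<noteq> 0"
    by (simp add: cf_def coeff_def s_map_def dx2_def)
  then obtain i where i: "i < card (fst p)" "dx (fst q) (del i (basis_vecs (fst p))) \<noteq> 0"
    "dx (snd q) (basis_vecs (fst p) ! i # basis_vecs (snd p)) \<noteq> 0"
    by (elim sum.not_neutral_contains_not_neutral) auto
  define m where "m = sorted_list_of_set (fst p) ! i"
  let ?e = "\<lambda>m::'n. axis m (1::real)"
  let ?ms = "m # sorted_list_of_set (snd p)"
  have m: "m \<in> fst p" using nth_sorted_list_in[OF i(1)] by (simp add: m_def)
  have q1: "fst q = fst p - {m}"
    using i(2) by (auto simp: del_basis_vecs[OF i(1)] dx_basis_vecs m_def split: if_splits)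
  have nz: "dx (snd q) (map ?e ?ms) \<noteq> 0"
    using i(1,3) by (simp add: nth_basis_vecs m_def basis_vecs_def)
  have "distinct (map ?e ?ms)"
    using Alt_not_distinct[OF dx_in_Alt] nz by blast
  then have dis: "distinct ?ms" by (auto simp: distinct_map)
  then have "m \<notin> snd p" by simp
  \<comment> \<open>The index \<open>m\<close> stands in front of an already sorted list; sorting
    the list costs at most a sign.\<close>
  have "sort ?ms = sorted_list_of_set (insert m (snd p))"
    using \<open>m \<notin> snd p\<close> by (simp add: sorted_list_of_set_insert sorted_sort_id)
  then have "dx (snd q) (basis_vecs (insert m (snd p))) \<noteq> 0"
    using Alt_sort[OF dx_in_Alt, of "snd q" "[]" ?e ?ms] nz by (auto simp: basis_vecs_def)
  then have q2: "snd q = insert m (snd p)" by (metis dx_basis_vecs)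
  show "weight p = (\<lambda>m'. weight q m' + 0)"
  proof
    show "weight p m' = weight q m' + 0" for m'
      using m \<open>m \<notin> snd p\<close> by (cases "m' = m") (simp_all add: weight_def indicator_def q1 q2)
  qed
qed

subsection \<open>Bijectivity of s\<close>

definition flip :: "('a \<Rightarrow> 'b \<Rightarrow> 'c) \<Rightarrow> 'b \<Rightarrow> 'a \<Rightarrow> 'c" where
  "flip \<mu> x y = \<mu> y x"

text \<open>The opposite of s: with the two factors exchanged, it carries a vector from the second
  factor to the first.\<close>

definition t_map :: "'n::finite biform \<Rightarrow> 'n biform" where
  "t_map \<mu> = flip (s_map (flip \<mu>))"

lemma flip_in_Alt2: "\<mu> \<in> Alt2 k l \<Longrightarrow> flip \<mu> \<in> Alt2 l k"
  by (simp add: Alt2_def flip_def[abs_def])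

lemma t_map_in_Alt2: "\<mu> \<in> Alt2 k l \<Longrightarrow> t_map \<mu> \<in> Alt2 (k - 1) (l + 1)"
  unfolding t_map_def by (intro flip_in_Alt2 s_map_in_Alt2)

lemma t_map_eq: "t_map \<mu> vs ws = (\<Sum>j<length ws. (-1) ^ j * \<mu> (ws ! j # vs) (del j ws))"
  by (simp add: t_map_def flip_def s_map_def)

lemma s_map_Cons:
  "s_map \<mu> (v # vs) ws = \<mu> vs (v # ws) - (\<Sum>i<length vs. (-1) ^ i * \<mu> (v # del i vs) (vs ! i # ws))"
  unfolding s_map_def list.size(4) One_nat_def add_Suc_right add_0_right
  by (subst sum.lessThan_Suc_shift) (simp add: del_0_Cons del_Suc_Cons sum_negf)

lemma t_map_Cons:
  "t_map \<mu> vs (w # ws) = \<mu> (w # vs) ws - (\<Sum>j<length ws. (-1) ^ j * \<mu> (ws ! j # vs) (w # del j ws))"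
  using s_map_Cons[of "flip \<mu>" w ws vs] by (simp add: t_map_def flip_def)

text \<open>The \<open>sl\<^sub>2\<close> relation: \<open>s\<close> raises and \<open>t\<close> lowers the difference of the two degrees.\<close>

lemma s_t_commutator:
  assumes \<mu>: "\<mu> \<in> Alt2 k l"
  shows "t_map (s_map \<mu>) vs ws = s_map (t_map \<mu>) vs ws + (real_of_int l - real_of_int k) * \<mu> vs ws"
proof (cases "int (length vs) = k \<and> int (length ws) = l")
  case True
  \<comment> \<open>In both compositions the terms with two distinct moves form the same double sum
    of \<open>?X\<close>. What remains are the terms that move a vector back; they contribute
    \<open>length ws\<close> and \<open>length vs\<close> copies of the form.\<close>
  let ?X = "\<lambda>i j. (-1) ^ i * (-1) ^ j * \<mu> (ws ! j # del i vs) (vs ! i # del j ws)"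
  have sq: "(-1) ^ i * ((-1) ^ i * x) = x" for i and x :: real
    by (simp flip: power_add mult.assoc)
  have "t_map (s_map \<mu>) vs ws = (\<Sum>j<length ws. (-1) ^ j * \<mu> vs (ws ! j # del j ws))
      - (\<Sum>j<length ws. \<Sum>i<length vs. ?X i j)"
    unfolding t_map_eq s_map_Cons
    by (simp add: right_diff_distrib sum_subtractf sum_distrib_left mult_ac)
  also have "(\<Sum>j<length ws. (-1) ^ j * \<mu> vs (ws ! j # del j ws)) = real (length ws) * \<mu> vs ws"
    by (simp add: Alt_nth_del[OF Alt2_Alt(1)[OF \<mu>]] sq)
  also have "(\<Sum>j<length ws. \<Sum>i<length vs. ?X i j) = (\<Sum>i<length vs. \<Sum>j<length ws. ?X i j)"
    by (rule sum.swap)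
  finally have ts: "t_map (s_map \<mu>) vs ws = real (length ws) * \<mu> vs ws
      - (\<Sum>i<length vs. \<Sum>j<length ws. ?X i j)" .
  have "s_map (t_map \<mu>) vs ws = (\<Sum>i<length vs. (-1) ^ i * \<mu> (vs ! i # del i vs) ws)
      - (\<Sum>i<length vs. \<Sum>j<length ws. ?X i j)"
    unfolding s_map_def t_map_Cons
    by (simp add: right_diff_distrib sum_subtractf sum_distrib_left mult_ac)
  also have "(\<Sum>i<length vs. (-1) ^ i * \<mu> (vs ! i # del i vs) ws) = real (length vs) * \<mu> vs ws"
    by (simp add: Alt_nth_del[OF Alt2_Alt(2)[OF \<mu>]] sq)
  finally have st: "s_map (t_map \<mu>) vs ws = real (length vs) * \<mu> vs ws
      - (\<Sum>i<length vs. \<Sum>j<length ws. ?X i j)" .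
  have "real_of_int k = real (length vs)" "real_of_int l = real (length ws)"
    using True by auto
  then show ?thesis unfolding ts st by (simp add: left_diff_distrib)
next
  case False
  have "t_map (s_map \<mu>) \<in> Alt2 (k + 1 - 1) (l - 1 + 1)" "s_map (t_map \<mu>) \<in> Alt2 (k - 1 + 1) (l + 1 - 1)"
    by (intro t_map_in_Alt2 s_map_in_Alt2 \<mu>)+
  then have m: "t_map (s_map \<mu>) \<in> Alt2 k l" "s_map (t_map \<mu>) \<in> Alt2 k l" by auto
  have 0: "\<nu> vs ws = 0" if "\<nu> \<in> Alt2 k l" for \<nu>
    using False Alt_length[OF Alt2_Alt(1)[OF that]] Alt_length[OF Alt2_Alt(2)[OF that]] by auto
  show ?thesis using 0[OF m(1)] 0[OF m(2)] 0[OF \<mu>] by simp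
qed

lemma t_map_scale: "t_map (\<lambda>vs ws. c * \<mu> vs ws) = (\<lambda>vs ws. c * t_map \<mu> vs ws)"
  by (auto simp: t_map_eq fun_eq_iff sum_distrib_left mult_ac)

lemma Alt2_negative: "\<mu> \<in> Alt2 k l \<Longrightarrow> k < 0 \<Longrightarrow> \<mu> = (\<lambda>_ _. 0)"
  by (auto simp: fun_eq_iff intro: Alt_length[OF Alt2_Alt(2)])

text \<open>By the commutator relation \<open>t_map\<close> sends an eigenvector of st with
  eigenvalue \<open>- c\<close> to one with eigenvalue \<open>- (c + (l + 1) - (k - 1))\<close>,
  which is again negative. Each application lowers \<open>k\<close>, and in negative degree there
  are no nonzero forms. Hence \<open>t_map \<mu>\<close> vanishes, and so does \<open>c\<close>
  times \<open>\<mu>\<close>.\<close>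

lemma s_t_negative_eigenvalue:
  assumes "\<mu> \<in> Alt2 k l" "s_map (t_map \<mu>) = (\<lambda>vs ws. - c * \<mu> vs ws)" "c > 0" "k \<le> l"
  shows "\<mu> = (\<lambda>_ _. 0)"
  using assms
proof (induction "nat (k + 1)" arbitrary: \<mu> k l c)
  case 0
  then show ?case using Alt2_negative[of \<mu> k l] by auto
next
  case (Suc n)
  let ?\<nu> = "t_map \<mu>" and ?c = "c + real_of_int ((l + 1) - (k - 1))"
  have \<nu>: "?\<nu> \<in> Alt2 (k - 1) (l + 1)" by (rule t_map_in_Alt2[OF Suc.prems(1)])
  have "s_map (t_map ?\<nu>) vs ws = - ?c * ?\<nu> vs ws" for vs ws
    using s_t_commutator[OF \<nu>, of vs ws] unfolding Suc.prems(2) t_map_scale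
    by (simp add: algebra_simps)
  then have "s_map (t_map ?\<nu>) = (\<lambda>vs ws. - ?c * ?\<nu> vs ws)" by (simp add: fun_eq_iff)
  moreover have "?c > 0" using Suc.prems(3,4) by simp
  ultimately have "?\<nu> = (\<lambda>_ _. 0)"
    using Suc.prems(4) Suc.hyps(2) by (intro Suc.hyps(1)[OF _ \<nu>]) auto
  then have "s_map (t_map \<mu>) = (\<lambda>_ _. 0)" by (simp add: s_map_def fun_eq_iff)
  then show ?case using Suc.prems(2,3) by (simp add: fun_eq_iff)
qed

text \<open>On the kernel of s the commutator relation reads st = - (l - k), a negative
  eigenvalue.\<close>

lemma s_map_kernel:
  assumes \<mu>: "\<mu> \<in> Alt2 k l" and "k < l" and 0: "s_map \<mu> = (\<lambda>_ _. 0)"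
  shows "\<mu> = (\<lambda>_ _. 0)"
proof (rule s_t_negative_eigenvalue[OF \<mu>])
  have "t_map (s_map \<mu>) = (\<lambda>_ _. 0)" by (simp add: 0 t_map_eq fun_eq_iff)
  then show "s_map (t_map \<mu>) = (\<lambda>vs ws. - real_of_int (l - k) * \<mu> vs ws)"
    using s_t_commutator[OF \<mu>] by (simp add: fun_eq_iff algebra_simps)
qed (use \<open>k < l\<close> in auto)

lemma s_map_inj_on: "k < l \<Longrightarrow> inj_on s_map (Alt2 k l)"
proof (rule inj_onI)
  fix \<mu> \<nu> :: "'a biform" assume *: "k < l" "\<mu> \<in> Alt2 k l" "\<nu> \<in> Alt2 k l" "s_map \<mu> = s_map \<nu>"
  have "s_map (\<lambda>vs ws. 1 * \<mu> vs ws + (-1) * \<nu> vs ws) = (\<lambda>_ _. 0)"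
    unfolding lin_onD[OF lin_on_s_map *(2,3)] using *(4) by simp
  then have "(\<lambda>vs ws. 1 * \<mu> vs ws + (-1) * \<nu> vs ws) = (\<lambda>_ _. 0)"
    by (rule s_map_kernel[OF Alt2_lincomb[OF *(2,3)] *(1)])
  then show "\<mu> = \<nu>" by (simp add: fun_eq_iff)
qed

text \<open>Places forms in a Euclidean space, where dimension counts and orthogonal decompositions
  are available.\<close>

definition coords :: "'n::{finite,linorder} biform \<Rightarrow> real ^ ('n set \<times> 'n set)" where
  "coords \<mu> = (\<chi> q. cf \<mu> q)"

lemma coords_lincomb:
  "coords (\<lambda>vs ws. a * \<mu> vs ws + b * \<nu> vs ws) = a *\<^sub>R coords \<mu> + b *\<^sub>R coords \<nu>"
  by (simp add: coords_def vec_eq_iff cf_lincomb)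

lemma coords_inj_on: "inj_on coords (Alt2 k l)"
  by (rule inj_onI, rule Alt2_eqI) (auto simp: coords_def vec_eq_iff)

lemma coords_inner: "coords \<mu> \<bullet> coords \<nu> = form_inner \<mu> \<nu>"
  by (simp add: coords_def inner_vec_def form_inner_cf)

lemma coords_subspace:
  assumes "(\<lambda>_ _. 0) \<in> V" "\<And>\<mu> \<nu> a b. \<mu> \<in> V \<Longrightarrow> \<nu> \<in> V \<Longrightarrow> (\<lambda>vs ws. a * \<mu> vs ws + b * \<nu> vs ws) \<in> V"
  shows "subspace (coords ` V)"
  unfolding subspace_def
proof (intro conjI ballI allI)
  show "0 \<in> coords ` V" using assms(1) by (intro image_eqI[of _ _ "\<lambda>_ _. 0"]) (simp_all add: coords_def vec_eq_iff)
  fix x y assume "x \<in> coords ` V" "y \<in> coords ` V"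
  then obtain \<mu> \<nu> where \<mu>\<nu>: "x = coords \<mu>" "y = coords \<nu>" "\<mu> \<in> V" "\<nu> \<in> V" by blast
  show "x + y \<in> coords ` V"
    using assms(2)[OF \<mu>\<nu>(3,4), of 1 1] coords_lincomb[of 1 \<mu> 1 \<nu>]
    by (intro image_eqI[where x = "\<lambda>vs ws. 1 * \<mu> vs ws + 1 * \<nu> vs ws"]) (simp_all add: \<mu>\<nu>)
next
  fix c x assume "x \<in> coords ` V"
  then obtain \<mu> where \<mu>: "x = coords \<mu>" "\<mu> \<in> V" by blast
  show "c *\<^sub>R x \<in> coords ` V"
    using assms(2)[OF \<mu>(2) \<mu>(2), of c 0] coords_lincomb[of c \<mu> 0 \<mu>]
    by (intro image_eqI[where x = "\<lambda>vs ws. c * \<mu> vs ws + 0 * \<mu> vs ws"]) (simp_all add: \<mu>)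
qed

text \<open>Exchanging the factors identifies \<open>Alt2 J (J - 1)\<close> with
  \<open>Alt2 (J - 1) J\<close>, so s composed with \<open>flip\<close> is an injective endomorphism
  of a finite-dimensional space and therefore surjective.\<close>

lemma s_map_bij_betw:
  "bij_betw s_map (Alt2 (J - 1) J) (Alt2 J (J - 1) :: 'n::{finite,linorder} biform set)"
proof -
  let ?V = "Alt2 J (J - 1) :: 'n biform set"
  \<comment> \<open>\<open>?B\<close> rebuilds a form from its coordinates, so that the endomorphism
    becomes a linear map \<open>f\<close> on the whole coordinate space.\<close>
  let ?B = "\<lambda>x::real ^ ('n set \<times> 'n set). (\<lambda>vs ws. \<Sum>q\<in>degs J (J - 1). (x $ q) * dx2 q vs ws)"
  define f where "f x = coords (s_map (flip (?B x)))" for x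
  have B: "?B (coords \<mu>) = \<mu>" if "\<mu> \<in> ?V" for \<mu>
    using Alt2_expand[OF that] by (simp add: coords_def)
  have flip_B: "flip (?B (a *\<^sub>R x + b *\<^sub>R y)) =
      (\<lambda>vs ws. a * flip (?B x) vs ws + b * flip (?B y) vs ws)" for a b x y
    by (auto simp: flip_def fun_eq_iff sum_distrib_left sum.distrib algebra_simps)
  have f_lin: "f (a *\<^sub>R x + b *\<^sub>R y) = a *\<^sub>R f x + b *\<^sub>R f y" for a b x y
    unfolding f_def flip_B lin_onD[OF lin_on_s_map UNIV_I UNIV_I] coords_lincomb ..
  have lin: "linear f"
  proof (rule linearI)
    show "f (x + y) = f x + f y" for x y using f_lin[of 1 x 1 y] by simp
    show "f (c *\<^sub>R x) = c *\<^sub>R f x" for c x using f_lin[of c x 0 x] by simp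
  qed
  have sub: "subspace (coords ` ?V)" by (rule coords_subspace[OF Alt2_0 Alt2_lincomb])
  have fc: "f (coords \<mu>) = coords (s_map (flip \<mu>))" if "\<mu> \<in> ?V" for \<mu>
    by (simp only: f_def B[OF that])
  have sf: "s_map (flip \<mu>) \<in> ?V" if "\<mu> \<in> ?V" for \<mu>
    using s_map_in_Alt2[OF flip_in_Alt2[OF that]] by simp
  have inj: "inj_on f (coords ` ?V)"
  proof (rule inj_onI)
    fix x y assume "x \<in> coords ` ?V" "y \<in> coords ` ?V" "f x = f y"
    then obtain \<mu> \<nu> where *: "x = coords \<mu>" "y = coords \<nu>" "\<mu> \<in> ?V" "\<nu> \<in> ?V"
      "f x = f y" by blast
    have "coords (s_map (flip \<mu>)) = coords (s_map (flip \<nu>))"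
      using *(5) unfolding *(1,2) fc[OF *(3)] fc[OF *(4)] .
    then have "s_map (flip \<mu>) = s_map (flip \<nu>)"
      by (rule inj_onD[OF coords_inj_on _ sf[OF *(3)] sf[OF *(4)]])
    then have "flip \<mu> = flip \<nu>"
      by (rule inj_onD[OF s_map_inj_on _ flip_in_Alt2[OF *(3)] flip_in_Alt2[OF *(4)], rotated]) simp
    then have "flip (flip \<mu>) = flip (flip \<nu>)" by simp
    then show "x = y" unfolding *(1,2) by (simp add: flip_def[abs_def])
  qed
  have "f ` coords ` ?V \<subseteq> coords ` ?V" using fc sf by auto
  moreover have "dim (f ` coords ` ?V) = dim (coords ` ?V)"
    by (rule dim_image_eq[OF lin]) (use inj sub in \<open>simp add: span_eq_iff[THEN iffD2]\<close>)
  ultimately have surj: "f ` coords ` ?V = coords ` ?V"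
    using sub by (intro subspace_dim_equal linear_subspace_image[OF lin]) auto
  have "?V \<subseteq> s_map ` Alt2 (J - 1) J"
  proof
    fix \<mu> assume \<mu>: "\<mu> \<in> ?V"
    then obtain \<nu> where \<nu>: "\<nu> \<in> ?V" "coords \<mu> = f (coords \<nu>)" using surj by blast
    have "\<mu> = s_map (flip \<nu>)"
      by (rule inj_onD[OF coords_inj_on _ \<mu> sf[OF \<nu>(1)]]) (simp only: \<nu>(2) fc[OF \<nu>(1)])
    then show "\<mu> \<in> s_map ` Alt2 (J - 1) J" using flip_in_Alt2[OF \<nu>(1)] by blast
  qed
  moreover have "s_map ` Alt2 (J - 1) J \<subseteq> ?V" using s_map_in_Alt2[of _ "J - 1" J] by auto
  ultimately show ?thesis using s_map_inj_on[of "J - 1" J] by (auto simp: bij_betw_def)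
qed

definition s_inv :: "int \<Rightarrow> 'n::finite biform \<Rightarrow> 'n biform" where
  "s_inv J = inv_into (Alt2 (J - 1) J) s_map"

lemma s_inv:
  fixes \<mu> :: "'n::{finite,linorder} biform"
  assumes "\<mu> \<in> Alt2 J (J - 1)"
  shows "s_inv J \<mu> \<in> Alt2 (J - 1) J" "s_map (s_inv J \<mu>) = \<mu>"
proof -
  have "\<mu> \<in> s_map ` Alt2 (J - 1) J"
    using assms bij_betw_imp_surj_on[OF s_map_bij_betw[of J, where 'n = 'n]] by simp
  then show "s_inv J \<mu> \<in> Alt2 (J - 1) J" "s_map (s_inv J \<mu>) = \<mu>"
    unfolding s_inv_def by (rule inv_into_into, rule f_inv_into_f)
qed

lemma s_map_eq_imp:
  "\<mu> \<in> Alt2 (J - 1) J \<Longrightarrow> \<nu> \<in> Alt2 (J - 1) J \<Longrightarrow> s_map \<mu> = s_map \<nu> \<Longrightarrow> \<mu> = \<nu>"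
  using inj_onD[OF s_map_inj_on[of "J - 1" J]] by auto

lemma lin_on_s_inv: "lin_on (Alt2 J (J - 1)) (s_inv J :: 'n::{finite,linorder} biform \<Rightarrow> _)"
  unfolding lin_on_def
proof (intro ballI allI)
  fix \<mu> \<nu> :: "'n biform" and a b :: real assume m: "\<mu> \<in> Alt2 J (J - 1)" "\<nu> \<in> Alt2 J (J - 1)"
  have lc: "(\<lambda>vs ws. a * \<mu> vs ws + b * \<nu> vs ws) \<in> Alt2 J (J - 1)" by (rule Alt2_lincomb[OF m])
  show "s_inv J (\<lambda>vs ws. a * \<mu> vs ws + b * \<nu> vs ws) =
      (\<lambda>vs ws. a * s_inv J \<mu> vs ws + b * s_inv J \<nu> vs ws)"
  proof (rule s_map_eq_imp[OF s_inv(1)[OF lc]])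
    show "(\<lambda>vs ws. a * s_inv J \<mu> vs ws + b * s_inv J \<nu> vs ws) \<in> Alt2 (J - 1) J"
      by (rule Alt2_lincomb[OF s_inv(1)[OF m(1)] s_inv(1)[OF m(2)]])
    show "s_map (s_inv J (\<lambda>vs ws. a * \<mu> vs ws + b * \<nu> vs ws)) =
        s_map (\<lambda>vs ws. a * s_inv J \<mu> vs ws + b * s_inv J \<nu> vs ws)"
      unfolding lin_onD[OF lin_on_s_map UNIV_I UNIV_I] s_inv(2)[OF lc] s_inv(2)[OF m(1)] s_inv(2)[OF m(2)] ..
  qed
qed

text \<open>The weight component of a preimage of \<open>dx2 q\<close> is again a preimage of
  \<open>dx2 q\<close>; injectivity of s identifies the two.\<close>

lemma weight_shift_s_inv: "weight_shift (\<lambda>_. 0) (Alt2 J (J - 1)) (s_inv J)"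
proof (rule weight_shift_0I[OF lin_on_s_inv])
  fix q :: "'a set \<times> 'a set" assume q: "q \<in> degs J (J - 1)"
  let ?\<nu> = "s_inv J (dx2 q)"
  note \<nu> = s_inv[OF dx2_in_Alt2[OF q]]
  have "s_map (weight_part (weight q) ?\<nu>) = weight_part (weight q) (s_map ?\<nu>)"
    by (rule weight_shift_weight_part[OF weight_shift_s_map s_map_in_Alt2 \<nu>(1)])
  also have "\<dots> = s_map ?\<nu>" by (simp add: \<nu>(2) weight_part_dx2)
  finally show "weight_part (weight q) ?\<nu> = ?\<nu>"
    by (rule s_map_eq_imp[OF weight_part_in_Alt2[OF \<nu>(1)] \<nu>(1)])
qed

subsection \<open>The orthogonal projection\<close>

lemma form_inner_lincomb_left:
  "form_inner (\<lambda>vs ws. a * \<mu> vs ws + b * \<nu> vs ws) \<omega> = a * form_inner \<mu> \<omega> + b * form_inner \<nu> \<omega>"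
  by (simp add: form_inner_cf cf_lincomb sum_distrib_left algebra_simps sum.distrib)

lemma form_inner_diff_left: "form_inner (\<mu> - \<nu>) \<omega> = form_inner \<mu> \<omega> - form_inner \<nu> \<omega>"
  using form_inner_lincomb_left[of 1 \<mu> "-1" \<nu> \<omega>] by (simp add: fun_diff_def)

lemma form_inner_weight_part: "form_inner (weight_part \<omega> \<mu>) \<nu> = form_inner \<mu> (weight_part \<omega> \<nu>)"
  unfolding form_inner_cf cf_weight_part by (rule sum.cong) auto

lemma s_range_perp_Alt2: "\<mu> \<in> s_range_perp J k \<Longrightarrow> \<mu> \<in> Alt2 (k + 1) (J - 1)"
  by (simp add: s_range_perp_def)

lemma s_range_perp_lincomb:
  "\<mu> \<in> s_range_perp J k \<Longrightarrow> \<nu> \<in> s_range_perp J k \<Longrightarrow>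
    (\<lambda>vs ws. a * \<mu> vs ws + b * \<nu> vs ws) \<in> s_range_perp J k"
  unfolding s_range_perp_def using Alt2_lincomb[of \<mu> "k + 1" "J - 1" \<nu> a b]
  by (simp add: form_inner_lincomb_left)

text \<open>\<open>weight_part\<close> is self-adjoint and commutes with s, so it moves to the other
  side of the inner product and into the argument of s.\<close>

lemma weight_part_s_range_perp:
  assumes "\<mu> \<in> s_range_perp J k"
  shows "weight_part \<omega> \<mu> \<in> s_range_perp J k"
proof -
  have \<mu>: "\<mu> \<in> Alt2 (k + 1) (J - 1)" "\<And>\<nu>. \<nu> \<in> Alt2 k J \<Longrightarrow> form_inner \<mu> (s_map \<nu>) = 0"
    using assms by (auto simp: s_range_perp_def)
  have "form_inner (weight_part \<omega> \<mu>) (s_map \<nu>) = 0" if "\<nu> \<in> Alt2 k J" for \<nu>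
  proof -
    have "form_inner (weight_part \<omega> \<mu>) (s_map \<nu>) = form_inner \<mu> (s_map (weight_part \<omega> \<nu>))"
      unfolding form_inner_weight_part
      by (subst weight_shift_weight_part[OF weight_shift_s_map s_map_in_Alt2 that]) simp_all
    then show ?thesis using \<mu>(2) weight_part_in_Alt2[OF that] by simp
  qed
  then show ?thesis using weight_part_in_Alt2[OF \<mu>(1)] by (auto simp: s_range_perp_def)
qed

text \<open>Existence is the orthogonal decomposition in coordinate space. For uniqueness, the
  difference of two solutions lies in the subspace and is orthogonal to itself; there
  \<open>form_inner\<close> is definite because the elements are alternating.\<close>

lemma orth_proj_ex1:
  fixes \<mu> :: "'n::{finite,linorder} biform"
  shows "\<exists>!\<nu>. \<nu> \<in> s_range_perp J k \<and> (\<forall>\<omega>\<in>s_range_perp J k. form_inner (\<mu> - \<nu>) \<omega> = 0)"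
proof -
  let ?V = "s_range_perp J k :: 'n biform set"
  have sub: "subspace (coords ` ?V)"
    by (rule coords_subspace[OF _ s_range_perp_lincomb]) (auto simp: s_range_perp_def form_inner_cf)
  obtain y z where yz: "y \<in> span (coords ` ?V)" "\<And>w. w \<in> span (coords ` ?V) \<Longrightarrow> orthogonal z w"
    "coords \<mu> = y + z"
    using orthogonal_subspace_decomp_exists[of "coords ` ?V" "coords \<mu>"] by blast
  have "span (coords ` ?V) = coords ` ?V" using sub by (simp add: span_eq_iff)
  with yz obtain \<nu> where \<nu>: "\<nu> \<in> ?V" "y = coords \<nu>" by auto
  have "form_inner (\<mu> - \<nu>) \<omega> = 0" if "\<omega> \<in> ?V" for \<omega>
  proof -
    have "form_inner (\<mu> - \<nu>) \<omega> = (coords \<mu> - coords \<nu>) \<bullet> coords \<omega>"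
      by (simp add: form_inner_diff_left inner_diff_left coords_inner)
    also have "\<dots> = z \<bullet> coords \<omega>" using yz(3) \<nu>(2) by simp
    also have "\<dots> = 0" using yz(2)[of "coords \<omega>"] that by (auto simp: orthogonal_def intro: span_base)
    finally show ?thesis .
  qed
  moreover have "\<nu>' = \<nu>''"
    if 1: "\<nu>' \<in> ?V" "\<forall>\<omega>\<in>?V. form_inner (\<mu> - \<nu>') \<omega> = 0"
      and 2: "\<nu>'' \<in> ?V" "\<forall>\<omega>\<in>?V. form_inner (\<mu> - \<nu>'') \<omega> = 0" for \<nu>' \<nu>''
  proof -
    let ?d = "\<lambda>vs ws. 1 * \<nu>' vs ws + (-1) * \<nu>'' vs ws"
    have d: "?d \<in> ?V" by (rule s_range_perp_lincomb[OF 1(1) 2(1)])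
    have "form_inner ?d ?d = 1 * form_inner \<nu>' ?d + (-1) * form_inner \<nu>'' ?d"
      by (rule form_inner_lincomb_left)
    also have "\<dots> = 0"
      using 1(2)[rule_format, OF d] 2(2)[rule_format, OF d] unfolding form_inner_diff_left by simp
    finally have "?d = (\<lambda>_ _. 0)" using form_inner_self_eq_0[OF s_range_perp_Alt2[OF d]] by blast
    then show ?thesis by (simp add: fun_eq_iff)
  qed
  ultimately show ?thesis using \<nu>(1) by blast
qed

abbreviation "perp_proj J k \<equiv> orth_proj (s_range_perp J k)"

lemma perp_proj:
  "perp_proj J k \<mu> \<in> s_range_perp J k"
  "\<omega> \<in> s_range_perp J k \<Longrightarrow> form_inner (\<mu> - perp_proj J k \<mu>) \<omega> = 0"
  using theI'[OF orth_proj_ex1[of J k \<mu>]] unfolding orth_proj_def by blast+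

lemma perp_projI:
  "\<nu> \<in> s_range_perp J k \<Longrightarrow> (\<And>\<omega>. \<omega> \<in> s_range_perp J k \<Longrightarrow> form_inner \<mu> \<omega> = form_inner \<nu> \<omega>) \<Longrightarrow>
    perp_proj J k \<mu> = \<nu>"
  unfolding orth_proj_def
  by (rule the1_equality[OF orth_proj_ex1]) (simp add: form_inner_diff_left)

lemma form_inner_perp_proj:
  "\<omega> \<in> s_range_perp J k \<Longrightarrow> form_inner (perp_proj J k \<mu>) \<omega> = form_inner \<mu> \<omega>"
  using perp_proj(2)[of \<omega> J k \<mu>] by (simp add: form_inner_diff_left)

lemma lin_on_perp_proj: "lin_on V (perp_proj J k)"
  unfolding lin_on_def
  by (intro ballI allI perp_projI s_range_perp_lincomb[OF perp_proj(1) perp_proj(1)])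
    (simp add: form_inner_lincomb_left form_inner_perp_proj)

text \<open>The weight component of the projection of \<open>dx2 q\<close> satisfies the
  characterisation of that projection, because \<open>weight_part\<close> is self-adjoint, preserves
  the subspace and fixes \<open>dx2 q\<close>.\<close>

lemma weight_shift_perp_proj: "weight_shift (\<lambda>_. 0) (Alt2 (k + 1) (J - 1)) (perp_proj J k)"
proof (rule weight_shift_0I[OF lin_on_perp_proj], rule perp_projI[symmetric])
  fix q :: "'a set \<times> 'a set" and \<omega> :: "'a biform"
  show "weight_part (weight q) (perp_proj J k (dx2 q)) \<in> s_range_perp J k"
    by (intro weight_part_s_range_perp perp_proj)
  assume \<omega>: "\<omega> \<in> s_range_perp J k"
  have "form_inner (weight_part (weight q) (perp_proj J k (dx2 q))) \<omega> =
      form_inner (dx2 q) (weight_part (weight q) \<omega>)"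
    unfolding form_inner_weight_part
    by (rule form_inner_perp_proj[OF weight_part_s_range_perp[OF \<omega>]])
  also have "\<dots> = form_inner (dx2 q) \<omega>"
    unfolding form_inner_weight_part[symmetric] weight_part_dx2 ..
  finally show "form_inner (dx2 q) \<omega> = form_inner (weight_part (weight q) (perp_proj J k (dx2 q))) \<omega>"
    by simp
qed

subsection \<open>Equations of the spaces E\<close>

lemma EE_subset_Alt2: "EE J k \<subseteq> Alt2 k (ldeg J k)"
  using s_range_perp_Alt2[of _ J "k - 1"] by (auto simp: EE_def ldeg_def)

text \<open>Linear equations, each involving a single weight, are exactly what an operator acting by
  one scalar operator per weight respects. For \<open>k \<le> J - 1\<close> the rows are the columns
  of the matrix of s, as orthogonality to the range of s is tested on the basis forms; for larger
  \<open>k\<close> they are its rows.\<close>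

lemma EE_equations:
  obtains L where "\<And>p q. L p q \<noteq> 0 \<Longrightarrow> weight p = weight q"
    and "\<And>\<mu>. \<mu> \<in> Alt2 k (ldeg J k) \<Longrightarrow>
      \<mu> \<in> (EE J k :: 'n::{finite,linorder} biform set) \<longleftrightarrow> (\<forall>p. (\<Sum>q\<in>UNIV. L p q * cf \<mu> q) = 0)"
proof (cases "k \<le> J - 1")
  case True
  obtain K where K: "\<And>\<mu> p. \<mu> \<in> Alt2 (k - 1) J \<Longrightarrow>
        cf (s_map \<mu> :: 'n biform) p = (\<Sum>q\<in>UNIV. K p q * cf \<mu> q)"
    "\<And>p q. K p q \<noteq> 0 \<Longrightarrow> weight p = weight q"
    using weight_shift_s_map[of "k - 1" J, where 'n = 'n] unfolding weight_shift_def by auto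
  \<comment> \<open>The transposed matrix; rows that do not index a form in the domain of s are
    cleared, since the matrix of s is not tested there.\<close>
  define L where "L p q = (if p \<in> degs (k - 1) J then K q p else 0)" for p q
  have inner: "form_inner \<mu> (s_map \<nu>) = (\<Sum>p\<in>UNIV. cf \<nu> p * (\<Sum>q\<in>UNIV. L p q * cf \<mu> q))"
    if "\<nu> \<in> Alt2 (k - 1) J" for \<mu> \<nu> :: "'n biform"
  proof -
    have "form_inner \<mu> (s_map \<nu>) = (\<Sum>q\<in>UNIV. \<Sum>p\<in>UNIV. cf \<mu> q * (K q p * cf \<nu> p))"
      by (simp add: form_inner_cf K(1)[OF that] sum_distrib_left)
    also have "\<dots> = (\<Sum>p\<in>UNIV. \<Sum>q\<in>UNIV. cf \<mu> q * (K q p * cf \<nu> p))" by (rule sum.swap)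
    also have "\<dots> = (\<Sum>p\<in>UNIV. cf \<nu> p * (\<Sum>q\<in>UNIV. L p q * cf \<mu> q))"
      by (auto intro!: sum.cong simp: L_def sum_distrib_left mult_ac cf_outside[OF that])
    finally show ?thesis .
  qed
  show ?thesis
  proof (rule that)
    show "L p q \<noteq> 0 \<Longrightarrow> weight p = weight q" for p q
      using K(2)[of q p] by (auto simp: L_def split: if_splits)
    fix \<mu> :: "'n biform" assume \<mu>: "\<mu> \<in> Alt2 k (ldeg J k)"
    have "\<mu> \<in> EE J k \<longleftrightarrow> (\<forall>\<nu>\<in>Alt2 (k - 1) J. form_inner \<mu> (s_map \<nu>) = 0)"
      using \<mu> True by (simp add: EE_def s_range_perp_def ldeg_def)
    also have "\<dots> \<longleftrightarrow> (\<forall>p. (\<Sum>q\<in>UNIV. L p q * cf \<mu> q) = 0)"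
    proof (intro iffI allI ballI)
      fix p assume *: "\<forall>\<nu>\<in>Alt2 (k - 1) J. form_inner \<mu> (s_map \<nu>) = 0"
      show "(\<Sum>q\<in>UNIV. L p q * cf \<mu> q) = 0"
      proof (cases "p \<in> degs (k - 1) J")
        case p: True
        then have "(\<Sum>p'\<in>UNIV. cf (dx2 p) p' * (\<Sum>q\<in>UNIV. L p' q * cf \<mu> q)) = 0"
          using * inner[OF dx2_in_Alt2[OF p]] dx2_in_Alt2[OF p] by auto
        then show ?thesis by (simp add: cf_dx2 if_distrib[of "\<lambda>x. x * _"] sum.delta cong: if_cong)
      qed (simp add: L_def)
    next
      fix \<nu> :: "'n biform" assume "\<forall>p. (\<Sum>q\<in>UNIV. L p q * cf \<mu> q) = 0" "\<nu> \<in> Alt2 (k - 1) J"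
      then show "form_inner \<mu> (s_map \<nu>) = 0"
        unfolding inner[OF \<open>\<nu> \<in> Alt2 (k - 1) J\<close>]
        by (intro sum.neutral ballI) (metis mult_zero_right)
    qed
    finally show "\<mu> \<in> EE J k \<longleftrightarrow> (\<forall>p. (\<Sum>q\<in>UNIV. L p q * cf \<mu> q) = 0)" .
  qed
next
  case False
  obtain K where K: "\<And>\<mu> p. \<mu> \<in> Alt2 k J \<Longrightarrow>
        cf (s_map \<mu> :: 'n biform) p = (\<Sum>q\<in>UNIV. K p q * cf \<mu> q)"
    "\<And>p q. K p q \<noteq> 0 \<Longrightarrow> weight p = weight q"
    using weight_shift_s_map[of k J, where 'n = 'n] unfolding weight_shift_def by auto
  show ?thesis
  proof (rule that[OF K(2)])
    fix \<mu> :: "'n biform" assume "\<mu> \<in> Alt2 k (ldeg J k)"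
    then have \<mu>: "\<mu> \<in> Alt2 k J" using False by (simp add: ldeg_def)
    have "\<mu> \<in> EE J k \<longleftrightarrow> s_map \<mu> = (\<lambda>_ _. 0)"
      using \<mu> False by (simp add: EE_def fun_eq_iff)
    also have "\<dots> \<longleftrightarrow> (\<forall>p. cf (s_map \<mu>) p = 0)"
      using Alt2_eq_0[OF s_map_in_Alt2[OF \<mu>]] by auto
    finally show "\<mu> \<in> EE J k \<longleftrightarrow> (\<forall>p. (\<Sum>q\<in>UNIV. K p q * cf \<mu> q) = 0)"
      by (simp add: K(1)[OF \<mu>])
  qed
qed

section \<open>Square-integrable functions\<close>

interpretation cube: finite_measure "cube :: 'a::euclidean_space measure"
  by (rule finite_measureI) (simp add: emeasure_restrict_space space_restrict_space)

lemma space_cube: "space (cube :: 'a::euclidean_space measure) = cbox 0 One"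
  by (simp add: space_restrict_space)

lemma borel_measurable_cube: "f \<in> borel_measurable borel \<Longrightarrow> f \<in> borel_measurable cube"
  by (rule measurable_restrict_space1) simp

lemma L2_measurable [measurable_dest]: "f \<in> L2 \<Longrightarrow> f \<in> borel_measurable cube"
  unfolding L2_def by blast

lemma L2_square: "f \<in> L2 \<Longrightarrow> integrable cube (\<lambda>x. (f x)\<^sup>2)"
  unfolding L2_def by blast

lemma L2I: "f \<in> borel_measurable cube \<Longrightarrow> integrable cube (\<lambda>x. (f x)\<^sup>2) \<Longrightarrow> f \<in> L2"
  unfolding L2_def by blast

lemma L2_mult:
  assumes "f \<in> L2" "g \<in> L2"
  shows "integrable cube (\<lambda>x. f x * g x)"
proof (rule Bochner_Integration.integrable_bound)
  show "integrable cube (\<lambda>x. (f x)\<^sup>2 + (g x)\<^sup>2)" using assms by (simp add: L2_square)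
  show "(\<lambda>x. f x * g x) \<in> borel_measurable cube" using assms by measurable
  have "\<bar>a * b\<bar> \<le> \<bar>a\<^sup>2 + b\<^sup>2\<bar>" for a b :: real
  proof -
    have "2 * (\<bar>a\<bar> * \<bar>b\<bar>) \<le> a\<^sup>2 + b\<^sup>2" using sum_squares_bound[of "\<bar>a\<bar>" "\<bar>b\<bar>"] by simp
    moreover have "0 \<le> \<bar>a\<bar> * \<bar>b\<bar>" by simp
    ultimately show ?thesis unfolding abs_mult by linarith
  qed
  then show "AE x in cube. norm (f x * g x) \<le> norm ((f x)\<^sup>2 + (g x)\<^sup>2)" by simp
qed

lemma L2_scale [simp, intro]: "f \<in> L2 \<Longrightarrow> (\<lambda>x. c * f x) \<in> L2"
  by (auto simp: L2_def power_mult_distrib)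

lemma L2_add [simp, intro]:
  assumes "f \<in> L2" "g \<in> L2"
  shows "(\<lambda>x. f x + g x) \<in> L2"
proof (rule L2I)
  show "(\<lambda>x. f x + g x) \<in> borel_measurable cube" using assms by measurable
  show "integrable cube (\<lambda>x. (f x + g x)\<^sup>2)"
    using L2_square[OF assms(1)] L2_square[OF assms(2)] L2_mult[OF assms]
    by (simp add: power2_sum mult.assoc)
qed

lemma L2_diff [simp, intro]: "f \<in> L2 \<Longrightarrow> g \<in> L2 \<Longrightarrow> (\<lambda>x. f x - g x) \<in> L2"
  using L2_add[of f "\<lambda>x. -1 * g x"] L2_scale[of g "-1"] by simp

lemma L2_0 [simp, intro]: "(\<lambda>_. 0) \<in> L2"
  by (simp add: L2_def)

lemma L2_const [simp, intro]: "(\<lambda>_. c) \<in> L2"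
  by (simp add: L2_def)

lemma L2_sum [simp, intro]: "(\<And>i. i \<in> I \<Longrightarrow> f i \<in> L2) \<Longrightarrow> (\<lambda>x. \<Sum>i\<in>I. f i x) \<in> L2"
  by (induction I rule: infinite_finite_induct) auto

lemma L2_integrable: "f \<in> L2 \<Longrightarrow> integrable cube f"
  using L2_mult[of f "\<lambda>_. 1"] by simp

lemma L2_bounded:
  assumes "f \<in> borel_measurable cube" "\<And>x. x \<in> cbox 0 One \<Longrightarrow> \<bar>f x\<bar> \<le> B"
  shows "f \<in> L2"
proof (rule L2I)
  show "integrable cube (\<lambda>x. (f x)\<^sup>2)"
  proof (rule Bochner_Integration.integrable_bound)
    show "integrable (cube :: 'a measure) (\<lambda>x. B\<^sup>2)" by simp
    show "AE x in cube. norm ((f x)\<^sup>2) \<le> norm (B\<^sup>2)"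
      using assms(2) by (intro AE_I2) (auto simp: space_cube abs_le_square_iff[symmetric] intro: order_trans[OF _ abs_ge_self])
  qed (use assms in measurable)
qed (use assms in simp)

lemma continuous_L2:
  assumes "continuous_on UNIV (f :: 'a::euclidean_space \<Rightarrow> real)"
  shows "f \<in> L2"
proof -
  have "compact (f ` cbox 0 One)"
    by (rule compact_continuous_image) (use assms continuous_on_subset in \<open>auto\<close>)
  then obtain B where "\<And>x. x \<in> cbox 0 One \<Longrightarrow> \<bar>f x\<bar> \<le> B"
    using compact_imp_bounded[of "f ` cbox 0 One"] unfolding bounded_iff by auto
  then show ?thesis
    using assms by (intro L2_bounded borel_measurable_cube borel_measurable_continuous_onI)
qed

definition ip :: "('a::euclidean_space \<Rightarrow> real) \<Rightarrow> ('a \<Rightarrow> real) \<Rightarrow> real" where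
  "ip f g = (\<integral>x. f x * g x \<partial>cube)"

lemma ip_commute: "ip f g = ip g f"
  by (simp add: ip_def mult.commute)

lemma ip_add_left: "f \<in> L2 \<Longrightarrow> g \<in> L2 \<Longrightarrow> h \<in> L2 \<Longrightarrow> ip (\<lambda>x. f x + g x) h = ip f h + ip g h"
  by (simp add: ip_def distrib_right L2_mult)

lemma ip_diff_left: "f \<in> L2 \<Longrightarrow> g \<in> L2 \<Longrightarrow> h \<in> L2 \<Longrightarrow> ip (\<lambda>x. f x - g x) h = ip f h - ip g h"
  by (simp add: ip_def left_diff_distrib L2_mult)

lemma ip_scale_left: "ip (\<lambda>x. c * f x) h = c * ip f h"
  by (simp add: ip_def mult.assoc)

lemma ip_sum_left: "(\<And>i. i \<in> I \<Longrightarrow> f i \<in> L2) \<Longrightarrow> h \<in> L2 \<Longrightarrow> ip (\<lambda>x. \<Sum>i\<in>I. f i x) h = (\<Sum>i\<in>I. ip (f i) h)"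
  by (simp add: ip_def sum_distrib_right L2_mult Bochner_Integration.integral_sum)

lemma ip_add_right: "f \<in> L2 \<Longrightarrow> g \<in> L2 \<Longrightarrow> h \<in> L2 \<Longrightarrow> ip h (\<lambda>x. f x + g x) = ip h f + ip h g"
  by (simp add: ip_add_left ip_commute[of h])

lemma ip_diff_right: "f \<in> L2 \<Longrightarrow> g \<in> L2 \<Longrightarrow> h \<in> L2 \<Longrightarrow> ip h (\<lambda>x. f x - g x) = ip h f - ip h g"
  by (simp add: ip_diff_left ip_commute[of h])

lemma ip_scale_right: "ip h (\<lambda>x. c * f x) = c * ip h f"
  by (simp add: ip_scale_left ip_commute[of h])

lemma ip_sum_right: "(\<And>i. i \<in> I \<Longrightarrow> f i \<in> L2) \<Longrightarrow> h \<in> L2 \<Longrightarrow> ip h (\<lambda>x. \<Sum>i\<in>I. f i x) = (\<Sum>i\<in>I. ip h (f i))"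
  by (simp add: ip_sum_left ip_commute[of h])

lemma ip_0 [simp]: "ip (\<lambda>_. 0) f = 0" "ip f (\<lambda>_. 0) = 0"
  by (simp_all add: ip_def)

lemma L2_norm_ip: "L2_norm f = sqrt (ip f f)"
  by (simp add: L2_norm_def ip_def power2_eq_square)

lemma ip_self_nonneg: "0 \<le> ip f f"
  by (simp add: ip_def)

lemma L2_norm_nonneg [simp]: "0 \<le> L2_norm f"
  by (simp add: L2_norm_ip ip_self_nonneg)

lemma L2_norm_square: "(L2_norm f)\<^sup>2 = ip f f"
  by (simp add: L2_norm_ip ip_self_nonneg)

lemma L2_norm_scale: "L2_norm (\<lambda>x. c * f x) = \<bar>c\<bar> * L2_norm f"
  by (simp add: L2_norm_ip ip_scale_left ip_scale_right real_sqrt_mult mult.assoc[symmetric])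

lemma L2_norm_eq_0:
  assumes "f \<in> L2"
  shows "L2_norm f = 0 \<longleftrightarrow> L2_eq f (\<lambda>_. 0)"
proof -
  have "L2_norm f = 0 \<longleftrightarrow> (AE x in cube. (f x)\<^sup>2 = 0)"
    using integral_nonneg_eq_0_iff_AE[OF L2_square[OF assms]] by (simp add: L2_norm_def)
  then show ?thesis by (simp add: L2_eq_def)
qed

lemma L2_eq_refl [simp]: "L2_eq f f"
  by (simp add: L2_eq_def)

lemma L2_eq_sym: "L2_eq f g \<Longrightarrow> L2_eq g f"
  unfolding L2_eq_def by (auto elim: eventually_mono)

lemma L2_eq_trans [trans]: "L2_eq f g \<Longrightarrow> L2_eq g h \<Longrightarrow> L2_eq f h"
  unfolding L2_eq_def by (elim AE_mp) (auto intro!: AE_I2)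

lemma L2_eq_scale: "L2_eq f g \<Longrightarrow> L2_eq (\<lambda>x. c * f x) (\<lambda>x. c * g x)"
  unfolding L2_eq_def by (elim AE_mp) (auto intro!: AE_I2)

lemma L2_eq_add: "L2_eq f f' \<Longrightarrow> L2_eq g g' \<Longrightarrow> L2_eq (\<lambda>x. f x + g x) (\<lambda>x. f' x + g' x)"
  unfolding L2_eq_def by (elim AE_mp) (auto intro!: AE_I2)

lemma L2_eq_sum:
  "(\<And>i. i \<in> I \<Longrightarrow> L2_eq (f i) (g i)) \<Longrightarrow> L2_eq (\<lambda>x. \<Sum>i\<in>I. f i x) (\<lambda>x. \<Sum>i\<in>I. g i x)"
  by (induction I rule: infinite_finite_induct) (auto intro: L2_eq_add)

lemma L2_eq_diff_0: "L2_eq (\<lambda>x. f x - g x) (\<lambda>_. 0) \<longleftrightarrow> L2_eq f g"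
  by (simp add: L2_eq_def)

lemma ip_cong:
  assumes "L2_eq f f'" "f \<in> L2" "f' \<in> L2" "g \<in> L2"
  shows "ip f g = ip f' g"
  unfolding ip_def
proof (rule integral_cong_AE)
  show "AE x in cube. f x * g x = f' x * g x"
    using assms(1) unfolding L2_eq_def by eventually_elim simp
qed (use assms in measurable)

lemma L2_norm_cong: "L2_eq f g \<Longrightarrow> f \<in> L2 \<Longrightarrow> g \<in> L2 \<Longrightarrow> L2_norm f = L2_norm g"
  unfolding L2_norm_ip using ip_cong[of f g f] ip_cong[of f g g] by (simp add: ip_commute)

lemma L2_Cauchy_Schwarz:
  assumes "f \<in> L2" "g \<in> L2"
  shows "\<bar>ip f g\<bar> \<le> L2_norm f * L2_norm g"
proof (cases "L2_norm g = 0")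
  case True
  then have "ip g f = 0"
    using ip_cong[of g "\<lambda>_. 0" f] assms by (simp add: L2_norm_eq_0)
  then show ?thesis by (simp add: ip_commute[of f] True)
next
  case False
  then have g: "ip g g > 0" using ip_self_nonneg[of g] by (simp add: L2_norm_ip)
  define t where "t = ip f g / ip g g"
  have "0 \<le> ip (\<lambda>x. f x - t * g x) (\<lambda>x. f x - t * g x)" by (rule ip_self_nonneg)
  also have "\<dots> = ip f f - 2 * t * ip f g + t * t * ip g g"
    using assms by (simp add: ip_diff_left ip_diff_right ip_scale_left ip_scale_right
        ip_commute[of g f] algebra_simps)
  also have "\<dots> = ip f f - (ip f g)\<^sup>2 / ip g g"
    using g by (simp add: t_def power2_eq_square field_simps)
  finally have "(ip f g)\<^sup>2 \<le> ip f f * ip g g" using g by (simp add: field_simps)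
  also have "\<dots> = (L2_norm f * L2_norm g)\<^sup>2" by (simp add: power_mult_distrib L2_norm_square)
  finally show ?thesis by (simp add: abs_le_square_iff[symmetric])
qed

lemma L2_triangle:
  assumes "f \<in> L2" "g \<in> L2"
  shows "L2_norm (\<lambda>x. f x + g x) \<le> L2_norm f + L2_norm g"
proof (rule power2_le_imp_le)
  have "(L2_norm (\<lambda>x. f x + g x))\<^sup>2 = ip f f + 2 * ip f g + ip g g"
    using assms by (simp add: L2_norm_square ip_add_left ip_add_right ip_commute[of g f])
  also have "\<dots> \<le> (L2_norm f)\<^sup>2 + 2 * (L2_norm f * L2_norm g) + (L2_norm g)\<^sup>2"
    using L2_Cauchy_Schwarz[OF assms] by (simp add: L2_norm_square)
  finally show "(L2_norm (\<lambda>x. f x + g x))\<^sup>2 \<le> (L2_norm f + L2_norm g)\<^sup>2"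
    by (simp add: power2_sum)
qed simp

lemma L2_norm_minus_commute: "L2_norm (\<lambda>x. f x - g x) = L2_norm (\<lambda>x. g x - f x)"
  by (simp add: L2_norm_def power2_commute)

lemma L2_triangle_diff:
  assumes "f \<in> L2" "g \<in> L2" "h \<in> L2"
  shows "L2_norm (\<lambda>x. f x - h x) \<le> L2_norm (\<lambda>x. f x - g x) + L2_norm (\<lambda>x. g x - h x)"
  using L2_triangle[of "\<lambda>x. f x - g x" "\<lambda>x. g x - h x"] assms by simp

lemma L2_norm_sum_le:
  assumes "\<And>i. i \<in> I \<Longrightarrow> f i \<in> L2"
  shows "L2_norm (\<lambda>x. \<Sum>i\<in>I. f i x) \<le> (\<Sum>i\<in>I. L2_norm (f i))"
  using assms
proof (induction I rule: infinite_finite_induct)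
  case (insert i I)
  then show ?case using L2_triangle[of "f i" "\<lambda>x. \<Sum>i\<in>I. f i x"] by force
qed (simp_all add: L2_norm_def)

definition L2_lim :: "(nat \<Rightarrow> 'a::euclidean_space \<Rightarrow> real) \<Rightarrow> ('a \<Rightarrow> real) \<Rightarrow> bool" where
  "L2_lim F f \<longleftrightarrow> (\<forall>n. F n \<in> L2) \<and> f \<in> L2 \<and> (\<lambda>n. L2_norm (\<lambda>x. F n x - f x)) \<longlonglongrightarrow> 0"

lemma L2_lim_L2: "L2_lim F f \<Longrightarrow> F n \<in> L2" "L2_lim F f \<Longrightarrow> f \<in> L2"
  by (simp_all add: L2_lim_def)

lemma L2_lim_const: "f \<in> L2 \<Longrightarrow> L2_lim (\<lambda>_. f) f"
  by (simp add: L2_lim_def L2_norm_def)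

lemma L2_lim_ip_left:
  assumes "L2_lim F f" "g \<in> L2"
  shows "(\<lambda>n. ip (F n) g) \<longlonglongrightarrow> ip f g"
proof (rule LIM_zero_cancel, rule Lim_null_comparison)
  show "\<forall>\<^sub>F n in sequentially. norm (ip (F n) g - ip f g) \<le> L2_norm (\<lambda>x. F n x - f x) * L2_norm g"
    using L2_Cauchy_Schwarz[of "\<lambda>x. F _ x - f x" g] assms
    by (intro always_eventually allI) (simp add: ip_diff_left L2_lim_def)
  show "(\<lambda>n. L2_norm (\<lambda>x. F n x - f x) * L2_norm g) \<longlonglongrightarrow> 0"
    using assms(1) by (intro tendsto_mult_left_zero) (simp add: L2_lim_def)
qed

lemma L2_lim_ip:
  assumes "L2_lim F f" "L2_lim G g"
  shows "(\<lambda>n. ip (F n) (G n)) \<longlonglongrightarrow> ip f g"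
proof -
  note [simp] = L2_lim_L2[OF assms(1)] L2_lim_L2[OF assms(2)]
  define e where "e n = ip (\<lambda>x. F n x - f x) (\<lambda>x. G n x - g x)" for n
  define b where "b n = L2_norm (\<lambda>x. F n x - f x) * L2_norm (\<lambda>x. G n x - g x)" for n
  have "b \<longlonglongrightarrow> 0 * 0"
    unfolding b_def[abs_def] using assms by (intro tendsto_mult) (simp_all add: L2_lim_def)
  moreover have "\<bar>e n\<bar> \<le> b n" for n
    unfolding e_def b_def by (rule L2_Cauchy_Schwarz) auto
  ultimately have "e \<longlonglongrightarrow> 0"
    by (intro Lim_null_comparison[of e b]) auto
  then have "(\<lambda>n. e n + ip (F n) g + ip (G n) f - ip f g) \<longlonglongrightarrow> 0 + ip f g + ip g f - ip f g"
    by (intro tendsto_add tendsto_diff tendsto_const L2_lim_ip_left assms) auto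
  moreover have "e n + ip (F n) g + ip (G n) f - ip f g = ip (F n) (G n)" for n
    by (simp add: e_def ip_diff_left ip_diff_right ip_commute[of f])
  ultimately show ?thesis by (simp add: ip_commute[of g])
qed

lemma L2_limI:
  assumes "\<And>n. F n \<in> L2" "f \<in> L2" "b \<longlonglongrightarrow> 0" "\<And>n. L2_norm (\<lambda>x. F n x - f x) \<le> b n"
  shows "L2_lim F f"
proof -
  have "(\<lambda>n. L2_norm (\<lambda>x. F n x - f x)) \<longlonglongrightarrow> 0"
    by (rule Lim_null_comparison[of _ b]) (simp_all add: assms)
  then show ?thesis using assms(1,2) by (simp add: L2_lim_def)
qed

lemma L2_lim_lincomb:
  assumes "L2_lim F f" "L2_lim G g"
  shows "L2_lim (\<lambda>n x. F n x + c * G n x) (\<lambda>x. f x + c * g x)"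
proof (rule L2_limI)
  note [simp] = L2_lim_L2[OF assms(1)] L2_lim_L2[OF assms(2)]
  show "(\<lambda>x. F n x + c * G n x) \<in> L2" "(\<lambda>x. f x + c * g x) \<in> L2" for n by auto
  have "(\<lambda>n. L2_norm (\<lambda>x. F n x - f x) + \<bar>c\<bar> * L2_norm (\<lambda>x. G n x - g x)) \<longlonglongrightarrow> 0 + \<bar>c\<bar> * 0"
    using assms by (intro tendsto_add tendsto_mult_left) (simp_all add: L2_lim_def)
  then show "(\<lambda>n. L2_norm (\<lambda>x. F n x - f x) + \<bar>c\<bar> * L2_norm (\<lambda>x. G n x - g x)) \<longlonglongrightarrow> 0"
    by simp
  show "L2_norm (\<lambda>x. F n x + c * G n x - (f x + c * g x))
      \<le> L2_norm (\<lambda>x. F n x - f x) + \<bar>c\<bar> * L2_norm (\<lambda>x. G n x - g x)" for n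
  proof -
    have "L2_norm (\<lambda>x. (F n x - f x) + c * (G n x - g x))
        \<le> L2_norm (\<lambda>x. F n x - f x) + L2_norm (\<lambda>x. c * (G n x - g x))"
      by (rule L2_triangle) auto
    then show ?thesis by (simp add: L2_norm_scale add_diff_add right_diff_distrib[symmetric])
  qed
qed

subsection \<open>Completeness, projections and the Riesz representation\<close>

text \<open>On a set of finite measure L2 bounds give L1 bounds, so the sum of the absolute values
  has finite integral and is finite almost everywhere.\<close>

lemma L2_norm_sum_bound_AE_summable:
  fixes d :: "nat \<Rightarrow> 'a::euclidean_space \<Rightarrow> real"
  assumes d: "\<And>n. d n \<in> L2" and le: "\<And>n. L2_norm (d n) \<le> (1/2) ^ n"
  shows "AE x in cube. summable (\<lambda>n. d n x)"
proof -
  have [measurable]: "d n \<in> borel_measurable cube" for n by (rule L2_measurable[OF d])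
  have int: "integrable cube (\<lambda>x. \<bar>d n x\<bar>)" for n
    using L2_integrable[OF d] by simp
  define c where "c = L2_norm (\<lambda>_::'a. 1)"
  have *: "(\<integral>x. \<bar>d n x\<bar> \<partial>cube) \<le> c * (1/2) ^ n" for n
  proof -
    have "(\<lambda>x. \<bar>d n x\<bar>) \<in> L2" using d[of n] by (auto simp: L2_def)
    then have "\<bar>ip (\<lambda>_. 1) (\<lambda>x. \<bar>d n x\<bar>)\<bar> \<le> c * L2_norm (\<lambda>x. \<bar>d n x\<bar>)"
      unfolding c_def by (intro L2_Cauchy_Schwarz) auto
    also have "L2_norm (\<lambda>x. \<bar>d n x\<bar>) = L2_norm (d n)" by (simp add: L2_norm_def)
    also have "c * L2_norm (d n) \<le> c * (1/2) ^ n" using le by (intro mult_left_mono) (simp_all add: c_def)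
    finally show ?thesis by (simp add: ip_def)
  qed
  have "AE x in cube. (\<Sum>n. ennreal \<bar>d n x\<bar>) \<noteq> \<infinity>"
  proof (rule nn_integral_noteq_infinite)
    have "(\<integral>\<^sup>+x. (\<Sum>n. ennreal \<bar>d n x\<bar>) \<partial>cube) = (\<Sum>n. \<integral>\<^sup>+x. ennreal \<bar>d n x\<bar> \<partial>cube)"
      by (intro nn_integral_suminf) measurable
    also have "\<dots> = (\<Sum>n. ennreal (\<integral>x. \<bar>d n x\<bar> \<partial>cube))"
      using int by (simp add: nn_integral_eq_integral)
    also have "\<dots> \<le> (\<Sum>n. ennreal (c * (1/2) ^ n))"
      using * by (intro suminf_le) (auto intro: ennreal_leI)
    also have "\<dots> < \<infinity>"
    proof -
      have "(\<Sum>n. ennreal (c * (1/2) ^ n)) = ennreal (\<Sum>n. c * (1/2) ^ n)"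
        by (intro suminf_ennreal2) (auto simp: c_def intro: summable_mult)
      then show ?thesis by simp
    qed
    finally show "(\<integral>\<^sup>+x. (\<Sum>n. ennreal \<bar>d n x\<bar>) \<partial>cube) \<noteq> \<infinity>" by simp
  qed measurable
  then show ?thesis
  proof (rule AE_mp, intro AE_I2 impI)
    fix x assume "(\<Sum>n. ennreal \<bar>d n x\<bar>) \<noteq> \<infinity>"
    then have "summable (\<lambda>n. \<bar>d n x\<bar>)" by (intro summable_suminf_not_top) auto
    then show "summable (\<lambda>n. d n x)" by (rule summable_rabs_cancel)
  qed
qed

lemma L2_Fatou:
  fixes f :: "nat \<Rightarrow> 'a::euclidean_space \<Rightarrow> real"
  assumes f: "\<And>n. f n \<in> L2" and g: "g \<in> borel_measurable cube"
    and lim: "AE x in cube. (\<lambda>n. f n x) \<longlonglongrightarrow> g x"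
    and bound: "\<And>n. L2_norm (f n) \<le> B"
  shows "g \<in> L2 \<and> L2_norm g \<le> B"
proof -
  have [measurable]: "f n \<in> borel_measurable cube" for n by (rule L2_measurable[OF f])
  have B: "0 \<le> B" using bound[of 0] L2_norm_nonneg[of "f 0"] by linarith
  have "(\<integral>\<^sup>+x. ennreal ((g x)\<^sup>2) \<partial>cube) = (\<integral>\<^sup>+x. liminf (\<lambda>n. ennreal ((f n x)\<^sup>2)) \<partial>cube)"
  proof (rule nn_integral_cong_AE, rule AE_mp[OF lim], intro AE_I2 impI)
    fix x assume "(\<lambda>n. f n x) \<longlonglongrightarrow> g x"
    then have "(\<lambda>n. ennreal ((f n x)\<^sup>2)) \<longlonglongrightarrow> ennreal ((g x)\<^sup>2)" by (intro tendsto_intros)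
    then show "ennreal ((g x)\<^sup>2) = liminf (\<lambda>n. ennreal ((f n x)\<^sup>2))"
      by (intro lim_imp_Liminf[symmetric]) auto
  qed
  also have "\<dots> \<le> liminf (\<lambda>n. \<integral>\<^sup>+x. ennreal ((f n x)\<^sup>2) \<partial>cube)"
    by (intro nn_integral_liminf) measurable
  also have "\<dots> = liminf (\<lambda>n. ennreal ((L2_norm (f n))\<^sup>2))"
    using L2_square[OF f] by (simp add: nn_integral_eq_integral L2_norm_def)
  also have "\<dots> \<le> ennreal (B\<^sup>2)"
    using bound by (intro Liminf_le always_eventually allI ennreal_leI power_mono) auto
  finally have le: "(\<integral>\<^sup>+x. ennreal ((g x)\<^sup>2) \<partial>cube) \<le> ennreal (B\<^sup>2)" .
  then have int: "integrable cube (\<lambda>x. (g x)\<^sup>2)"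
    using g by (intro integrableI_nonneg) (auto intro: le_less_trans)
  then have "ennreal (\<integral>x. (g x)\<^sup>2 \<partial>cube) \<le> ennreal (B\<^sup>2)"
    using le by (simp add: nn_integral_eq_integral)
  then have "(\<integral>x. (g x)\<^sup>2 \<partial>cube) \<le> B\<^sup>2" by simp
  then show ?thesis using int g B by (auto intro: L2I real_le_lsqrt simp: L2_norm_def)
qed

text \<open>Riesz-Fischer: a rapidly convergent subsequence has a limit almost everywhere, and
  Fatou's lemma turns this into norm convergence of the whole sequence.\<close>

lemma L2_complete:
  fixes f :: "nat \<Rightarrow> 'a::euclidean_space \<Rightarrow> real"
  assumes f: "\<And>n. f n \<in> L2"
    and Cauchy: "\<And>e. e > 0 \<Longrightarrow> \<exists>N. \<forall>m\<ge>N. \<forall>n\<ge>N. L2_norm (\<lambda>x. f m x - f n x) < e"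
  obtains g where "L2_lim f g"
proof -
  have "\<forall>k. \<exists>N. \<forall>m\<ge>N. \<forall>n\<ge>N. L2_norm (\<lambda>x. f m x - f n x) < (1/2) ^ k"
    using Cauchy by simp
  then obtain N where N: "\<And>k m n. m \<ge> N k \<Longrightarrow> n \<ge> N k \<Longrightarrow> L2_norm (\<lambda>x. f m x - f n x) < (1/2) ^ k"
    by metis
  \<comment> \<open>The maximum makes the indices strictly increasing and keeps \<open>r k\<close>
    beyond the threshold \<open>N k\<close>.\<close>
  define r where "r = rec_nat (N 0) (\<lambda>k rk. max (Suc rk) (N (Suc k)))"
  have r: "r k < r (Suc k)" "r k \<ge> N k" for k
    by (simp add: r_def, cases k) (simp_all add: r_def)
  let ?d = "\<lambda>k x. f (r (Suc k)) x - f (r k) x"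
  have "AE x in cube. summable (\<lambda>n. ?d n x)"
  proof (rule L2_norm_sum_bound_AE_summable)
    show "L2_norm (?d n) \<le> (1/2) ^ n" for n
      using r(1)[of n] r(2)[of n] by (intro less_imp_le[OF N]) auto
  qed (use f in auto)
  define g where "g x = lim (\<lambda>k. f (r k) x)" for x
  have lim: "AE x in cube. (\<lambda>k. f (r k) x) \<longlonglongrightarrow> g x"
    using \<open>AE x in cube. summable (\<lambda>n. ?d n x)\<close>
  proof (rule AE_mp, intro AE_I2 impI)
    fix x assume "summable (\<lambda>n. ?d n x)"
    then have "(\<lambda>n. (\<Sum>k<n. ?d k x) + f (r 0) x) \<longlonglongrightarrow> (\<Sum>k. ?d k x) + f (r 0) x"
      by (intro tendsto_add summable_LIMSEQ) auto
    then have "(\<lambda>n. f (r n) x) \<longlonglongrightarrow> (\<Sum>k. ?d k x) + f (r 0) x"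
      using sum_lessThan_telescope[of "\<lambda>k. f (r k) x"] by simp
    then show "(\<lambda>k. f (r k) x) \<longlonglongrightarrow> g x"
      unfolding g_def by (simp add: limI)
  qed
  have g_meas: "g \<in> borel_measurable cube"
    unfolding g_def[abs_def] using f by (intro borel_measurable_lim_metric) auto
  have *: "(\<lambda>x. f m x - g x) \<in> L2 \<and> L2_norm (\<lambda>x. f m x - g x) \<le> e"
    if m: "m \<ge> M" "\<forall>m\<ge>M. \<forall>n\<ge>M. L2_norm (\<lambda>x. f m x - f n x) < e" for m M e
  proof -
    have "strict_mono r" using r(1) by (simp add: strict_mono_Suc_iff)
    then have rk: "r (k + M) \<ge> M" for k using seq_suble[of r "k + M"] by linarith
    show ?thesis
    proof (rule L2_Fatou[of "\<lambda>k x. f m x - f (r (k + M)) x"])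
      show "AE x in cube. (\<lambda>k. f m x - f (r (k + M)) x) \<longlonglongrightarrow> f m x - g x"
        using lim by (rule AE_mp) (intro AE_I2 impI tendsto_intros LIMSEQ_ignore_initial_segment)
      show "L2_norm (\<lambda>x. f m x - f (r (k + M)) x) \<le> e" for k
        using m rk by (intro less_imp_le) auto
    qed (use f g_meas in \<open>auto intro: borel_measurable_diff\<close>)
  qed
  \<comment> \<open>Fatou's lemma puts only a difference with \<open>g\<close> into L2;
    \<open>g\<close> itself is recovered by subtracting from \<open>f M1\<close>.\<close>
  obtain M1 where "\<forall>m\<ge>M1. \<forall>n\<ge>M1. L2_norm (\<lambda>x. f m x - f n x) < 1" using Cauchy[of 1] by auto
  then have "(\<lambda>x. f M1 x - g x) \<in> L2" using * by blast
  then have "(\<lambda>x. f M1 x - (f M1 x - g x)) \<in> L2" by (rule L2_diff[OF f])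
  moreover have "(\<lambda>x. f M1 x - (f M1 x - g x)) = g" by auto
  ultimately have g: "g \<in> L2" by simp
  have "(\<lambda>n. L2_norm (\<lambda>x. f n x - g x)) \<longlonglongrightarrow> 0"
  proof (rule LIMSEQ_I)
    fix e :: real assume "e > 0"
    then obtain M where "\<forall>m\<ge>M. \<forall>n\<ge>M. L2_norm (\<lambda>x. f m x - f n x) < e / 2" using Cauchy[of "e/2"] by auto
    then have "L2_norm (\<lambda>x. f m x - g x) \<le> e / 2" if "m \<ge> M" for m using * that by blast
    then show "\<exists>no. \<forall>n\<ge>no. norm (L2_norm (\<lambda>x. f n x - g x) - 0) < e"
      using \<open>e > 0\<close> by (intro exI[of _ M]) force
  qed
  then show ?thesis using that f g by (simp add: L2_lim_def)
qed

text \<open>Closedness is not demanded, because the subspaces of interest (test functions, kernels,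
  sets where two operators agree) arise without it. Projections are therefore limits of
  elements.\<close>

definition L2_subspace :: "('a::euclidean_space \<Rightarrow> real) set \<Rightarrow> bool" where
  "L2_subspace W \<longleftrightarrow> W \<subseteq> L2 \<and> (\<lambda>_. 0) \<in> W \<and> (\<forall>f\<in>W. \<forall>g\<in>W. \<forall>c. (\<lambda>x. f x + c * g x) \<in> W)"

text \<open>The midpoint coefficient is kept symbolic as \<open>c\<close>, so that the bilinear
  expansion is finished before the value 1/2 is inserted.\<close>

lemma L2_parallelogram:
  assumes "h \<in> L2" "u \<in> L2" "v \<in> L2" "2 * c = (1 :: real)"
  shows "ip (\<lambda>x. u x - v x) (\<lambda>x. u x - v x) = 2 * ip (\<lambda>x. h x - u x) (\<lambda>x. h x - u x)
    + 2 * ip (\<lambda>x. h x - v x) (\<lambda>x. h x - v x)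
    - 4 * ip (\<lambda>x. h x - (c * u x + c * v x)) (\<lambda>x. h x - (c * u x + c * v x))"
proof -
  have c: "c = 1/2" using assms(4) by simp
  have "4 * ip (\<lambda>x. h x - (c * u x + c * v x)) (\<lambda>x. h x - (c * u x + c * v x)) =
      4 * (ip h h - 2 * c * ip h u - 2 * c * ip h v + c * c * ip u u + c * c * ip v v + 2 * c * c * ip u v)"
    using assms(1-3) by (simp add: ip_diff_left ip_diff_right ip_add_left ip_add_right ip_scale_left
      ip_scale_right ip_commute[of u h] ip_commute[of v h] ip_commute[of v u] algebra_simps)
  then show ?thesis
    using assms(1-3) unfolding c by (simp add: ip_diff_left ip_diff_right
      ip_commute[of u h] ip_commute[of v h] ip_commute[of v u] algebra_simps)
qed

text \<open>A minimising sequence for the distance from \<open>h\<close> is Cauchy by the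
  parallelogram identity; minimality along the lines \<open>g + c v\<close> gives the
  orthogonality.\<close>

lemma L2_projection:
  assumes W: "L2_subspace W" and h: "h \<in> L2"
  obtains w g where "\<And>n. w n \<in> W" "L2_lim w g" "\<And>v. v \<in> W \<Longrightarrow> ip (\<lambda>x. h x - g x) v = 0"
proof -
  have WL: "\<And>v. v \<in> W \<Longrightarrow> v \<in> L2" and lc: "\<And>u v c. u \<in> W \<Longrightarrow> v \<in> W \<Longrightarrow> (\<lambda>x. u x + c * v x) \<in> W"
    and W0: "(\<lambda>_. 0) \<in> W"
    using W by (auto simp: L2_subspace_def)
  define D where "D v = ip (\<lambda>x. h x - v x) (\<lambda>x. h x - v x)" for v
  define d where "d = Inf (D ` W)"
  have bdd: "bdd_below (D ` W)" by (rule bdd_belowI[of _ 0]) (auto simp: D_def ip_self_nonneg)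
  have d: "d \<le> D v" if "v \<in> W" for v
    unfolding d_def using that bdd by (intro cInf_lower) auto
  have "\<exists>w\<in>W. D w < d + 1 / real (Suc n)" for n
  proof -
    have "d < d + 1 / real (Suc n)" by simp
    then show ?thesis
      unfolding d_def using cInf_lessD[of "D ` W"] W0 by blast
  qed
  then obtain w where w: "\<And>n. w n \<in> W" "\<And>n. D (w n) < d + 1 / real (Suc n)" by metis
  have dist: "ip (\<lambda>x. w m x - w n x) (\<lambda>x. w m x - w n x) \<le> 2 / real (Suc m) + 2 / real (Suc n)" for m n
  proof -
    have "(\<lambda>x. (0 + 1/2 * w m x) + 1/2 * w n x) \<in> W" by (intro lc W0 w)
    from d[OF this] have "d \<le> D (\<lambda>x. 1/2 * w m x + 1/2 * w n x)" by simp
    moreover have "ip (\<lambda>x. w m x - w n x) (\<lambda>x. w m x - w n x) = 2 * D (w m) + 2 * D (w n)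
        - 4 * D (\<lambda>x. 1/2 * w m x + 1/2 * w n x)"
      unfolding D_def by (rule L2_parallelogram) (auto intro: h WL w)
    moreover have "2 / real (Suc k) = 2 * (1 / real (Suc k))" for k by simp
    ultimately show ?thesis using w(2)[of m] w(2)[of n] by linarith
  qed
  have "\<exists>N. \<forall>m\<ge>N. \<forall>n\<ge>N. L2_norm (\<lambda>x. w m x - w n x) < e" if "e > 0" for e
  proof -
    obtain N where N: "4 / real (Suc N) < e\<^sup>2"
    proof -
      obtain N where "inverse (real (Suc N)) < e\<^sup>2 / 4"
        using reals_Archimedean[of "e\<^sup>2 / 4"] \<open>e > 0\<close> by auto
      then show ?thesis using that[of N] by (simp add: field_simps)
    qed
    have "L2_norm (\<lambda>x. w m x - w n x) < e" if "m \<ge> N" "n \<ge> N" for m n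
    proof (rule power2_less_imp_less)
      have "2 / real (Suc m) \<le> 2 / real (Suc N)" "2 / real (Suc n) \<le> 2 / real (Suc N)"
        using that by (auto intro!: divide_left_mono)
      then show "(L2_norm (\<lambda>x. w m x - w n x))\<^sup>2 < e\<^sup>2"
        unfolding L2_norm_square using dist[of m n] N by simp
    qed (use \<open>e > 0\<close> in simp)
    then show ?thesis by blast
  qed
  then obtain g where g: "L2_lim w g" using L2_complete[of w] WL w(1) by blast
  have gL: "g \<in> L2" by (rule L2_lim_L2(2)[OF g])
  have D_lim: "(\<lambda>n. D (\<lambda>x. w n x + c * v x)) \<longlonglongrightarrow> D (\<lambda>x. g x + c * v x)" if v: "v \<in> L2" for v c
  proof -
    have "L2_lim (\<lambda>n x. h x + (-1) * (w n x + c * v x)) (\<lambda>x. h x + (-1) * (g x + c * v x))"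
      by (intro L2_lim_lincomb g L2_lim_const h v)
    from L2_lim_ip[OF this this] show ?thesis
      unfolding D_def by (simp only: mult_minus1 add_uminus_conv_diff)
  qed
  have ge: "d \<le> D (\<lambda>x. g x + c * v x)" if "v \<in> W" for v c
    by (rule tendsto_lowerbound[OF D_lim[OF WL[OF that]]])
      (auto intro!: always_eventually d lc w that)
  have "D g = d"
  proof (rule antisym)
    have "(\<lambda>n. D (w n)) \<longlonglongrightarrow> D g" using D_lim[OF L2_0, of 0] by simp
    moreover have "(\<lambda>n. d + 1 / real (Suc n)) \<longlonglongrightarrow> d + 0"
      by (intro tendsto_intros LIMSEQ_Suc[OF lim_1_over_n])
    ultimately show "D g \<le> d"
      using w(2) by (intro LIMSEQ_le[of "\<lambda>n. D (w n)" "D g" _ d]) (auto intro: less_imp_le)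
    show "d \<le> D g" using ge[OF W0, of 0] by simp
  qed
  have "ip (\<lambda>x. h x - g x) v = 0" if v: "v \<in> W" for v
  proof (rule ccontr)
    let ?a = "ip (\<lambda>x. h x - g x) v" and ?b = "ip v v"
    assume a: "?a \<noteq> 0"
    have vL: "v \<in> L2" using WL v .
    have quad: "D (\<lambda>x. g x + c * v x) = D g - 2 * c * ?a + c * c * ?b" for c
      unfolding D_def using h gL vL
      by (simp add: ip_diff_left ip_diff_right ip_add_left ip_add_right ip_scale_left
          ip_scale_right ip_commute[of v h] ip_commute[of v g] ip_commute[of g h] algebra_simps)
    have "2 * c * ?a \<le> c * c * ?b" for c using ge[OF v, of c] quad[of c] \<open>D g = d\<close> by simp
    \<comment> \<open>The minimiser of the quadratic would be \<open>?a / ?b\<close>; the added 1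
      avoids a case distinction for \<open>?b = 0\<close> and still gives a contradiction.\<close>
    from this[of "?a / (?b + 1)"] have "2 * (?a * ?a) / (?b + 1) \<le> (?a * ?a) / (?b + 1) * (?b / (?b + 1))"
      by (simp add: field_simps)
    moreover have "?b / (?b + 1) \<le> 1" using ip_self_nonneg[of v] by (simp add: field_simps)
    then have "(?a * ?a) / (?b + 1) * (?b / (?b + 1)) \<le> (?a * ?a) / (?b + 1) * 1"
      using ip_self_nonneg[of v] by (intro mult_left_mono) auto
    moreover have "(?a * ?a) / (?b + 1) > 0"
      using a ip_self_nonneg[of v] by (intro divide_pos_pos) (auto simp: zero_less_mult_iff)
    ultimately show False by simp
  qed
  then show ?thesis using that w(1) g by blast
qed

text \<open>The difference between \<open>h\<close> and its projection is orthogonal to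
  \<open>W\<close>, hence null. Applied below to test functions and to a subspace containing the
  bump functions.\<close>

lemma L2_dense:
  assumes W: "L2_subspace W" and h: "h \<in> L2"
    and 0: "\<And>f. f \<in> L2 \<Longrightarrow> (\<And>v. v \<in> W \<Longrightarrow> ip f v = 0) \<Longrightarrow> L2_eq f (\<lambda>_. 0)"
  obtains w where "\<And>n. w n \<in> W" "L2_lim w h"
proof -
  obtain w g where wg: "\<And>n. w n \<in> W" "L2_lim w g" "\<And>v. v \<in> W \<Longrightarrow> ip (\<lambda>x. h x - g x) v = 0"
    using L2_projection[OF W h] by metis
  have gL: "g \<in> L2" by (rule L2_lim_L2(2)[OF wg(2)])
  have "L2_eq h g" using 0[of "\<lambda>x. h x - g x"] wg(3) gL h by (simp add: L2_eq_diff_0)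
  then have "L2_norm (\<lambda>x. w n x - h x) = L2_norm (\<lambda>x. w n x - g x)" for n
    using L2_lim_L2(1)[OF wg(2)] gL h
    by (intro L2_norm_cong L2_diff) (auto simp: L2_eq_def)
  then have "L2_lim w h" using wg(2) h by (simp add: L2_lim_def)
  then show ?thesis using that wg(1) by blast
qed

text \<open>The representing function is a multiple of the normal \<open>z\<close> to the kernel.
  Boundedness of \<open>l\<close> enters to show that the projection \<open>g\<close>, a mere limit
  of kernel elements, is in the kernel too.\<close>

lemma L2_Riesz:
  fixes l :: "('a::euclidean_space \<Rightarrow> real) \<Rightarrow> real"
  assumes add: "\<And>f g. f \<in> L2 \<Longrightarrow> g \<in> L2 \<Longrightarrow> l (\<lambda>x. f x + g x) = l f + l g"
    and scale: "\<And>f c. f \<in> L2 \<Longrightarrow> l (\<lambda>x. c * f x) = c * l f"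
    and bound: "\<And>f. f \<in> L2 \<Longrightarrow> \<bar>l f\<bar> \<le> C * L2_norm f"
  obtains g where "g \<in> L2" "\<And>f. f \<in> L2 \<Longrightarrow> l f = ip g f"
proof (cases "\<forall>f\<in>L2. l f = 0")
  case True
  then show ?thesis using that[of "\<lambda>_. 0"] by simp
next
  case False
  then obtain h where h: "h \<in> L2" "l h \<noteq> 0" by blast
  let ?W = "{f \<in> L2. l f = 0}"
  have l0: "l (\<lambda>_. 0) = 0" using scale[of "\<lambda>_. 0" 0] by simp
  have sub: "L2_subspace ?W"
    unfolding L2_subspace_def by (auto simp: l0 add scale)
  obtain w g where wg: "\<And>n. w n \<in> ?W" "L2_lim w g" "\<And>v. v \<in> ?W \<Longrightarrow> ip (\<lambda>x. h x - g x) v = 0"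
    using L2_projection[OF sub h(1)] by blast
  have gL: "g \<in> L2" by (rule L2_lim_L2(2)[OF wg(2)])
  have diff: "l (\<lambda>x. u x - v x) = l u - l v" if "u \<in> L2" "v \<in> L2" for u v
  proof -
    have "l (\<lambda>x. u x + (-1) * v x) = l u + (-1) * l v"
      using add[OF that(1) L2_scale[OF that(2)], of "-1"] unfolding scale[OF that(2)] .
    then show ?thesis by simp
  qed
  have "l g = 0"
  proof -
    have "\<bar>l g\<bar> \<le> C * L2_norm (\<lambda>x. w n x - g x)" for n
      using bound[of "\<lambda>x. w n x - g x"] wg(1)[of n] gL diff[of "w n" g] by auto
    moreover have "(\<lambda>n. C * L2_norm (\<lambda>x. w n x - g x)) \<longlonglongrightarrow> C * 0"
      using wg(2) by (intro tendsto_intros) (simp add: L2_lim_def)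
    ultimately have "\<bar>l g\<bar> \<le> C * 0" by (intro LIMSEQ_le_const) auto
    then show ?thesis by simp
  qed
  define z where "z x = h x - g x" for x
  have z: "z \<in> L2" "l z = l h" using h gL diff[of h g] \<open>l g = 0\<close> by (auto simp: z_def[abs_def])
  have zz: "ip z z \<noteq> 0"
  proof
    assume "ip z z = 0"
    then have "L2_norm z = 0" by (simp add: L2_norm_ip)
    then show False using bound[OF z(1)] z(2) h(2) by simp
  qed
  have "l f = ip (\<lambda>x. l z / ip z z * z x) f" if f: "f \<in> L2" for f
  proof -
    define c where "c = l f / l z"
    have "l (\<lambda>x. f x - c * z x) = l f - c * l z" using z(1) f by (simp add: diff scale)
    also have "\<dots> = 0" using z h(2) by (simp add: c_def)
    finally have "l (\<lambda>x. f x - c * z x) = 0" .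
    then have "(\<lambda>x. f x - c * z x) \<in> ?W" using f z by auto
    then have "ip z (\<lambda>x. f x - c * z x) = 0" using wg(3) by (simp add: z_def[abs_def])
    then have "ip z f = c * ip z z" using f z by (simp add: ip_diff_right ip_scale_right)
    then show ?thesis unfolding ip_scale_left using zz z h(2) by (simp add: c_def)
  qed
  then show ?thesis using that[OF L2_scale[OF z(1)]] by blast
qed

section \<open>Smooth functions and test functions\<close>

lemma pd_eq: "(f has_derivative f') (at x) \<Longrightarrow> pd b f x = f' b"
  unfolding pd_def using frechet_derivative_at by metis

lemma has_derivative_pd:
  "f differentiable_on UNIV \<Longrightarrow> (f has_derivative (\<lambda>h. pd h f x)) (at x)"
  unfolding pd_def by (simp add: differentiable_on_def frechet_derivative_works[symmetric])

text \<open>A version of smoothness graded by the order, for which closure under products and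
  compositions goes by induction.\<close>

primrec smooth_n :: "nat \<Rightarrow> ('a::euclidean_space \<Rightarrow> real) \<Rightarrow> bool" where
  "smooth_n 0 f \<longleftrightarrow> True"
| "smooth_n (Suc n) f \<longleftrightarrow> f differentiable_on UNIV \<and> (\<forall>b\<in>Basis. smooth_n n (pd b f))"

lemma smooth_n_iff:
  "smooth_n n f \<longleftrightarrow> (\<forall>bs. set bs \<subseteq> Basis \<and> length bs < n \<longrightarrow> foldr pd bs f differentiable_on UNIV)"
proof (induction n arbitrary: f)
  case (Suc n)
  show ?case
  proof
    assume f: "smooth_n (Suc n) f"
    show "\<forall>bs. set bs \<subseteq> Basis \<and> length bs < Suc n \<longrightarrow> foldr pd bs f differentiable_on UNIV"
    proof (intro allI impI)
      fix bs :: "'a list" assume bs: "set bs \<subseteq> Basis \<and> length bs < Suc n"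
      \<comment> \<open>\<open>foldr\<close> applies the last direction of the list first, so the
        list is split at its end.\<close>
      show "foldr pd bs f differentiable_on UNIV"
        using f bs Suc.IH by (cases bs rule: rev_exhaust) auto
    qed
  next
    assume *: "\<forall>bs. set bs \<subseteq> Basis \<and> length bs < Suc n \<longrightarrow> foldr pd bs f differentiable_on UNIV"
    have "smooth_n n (pd b f)" if "b \<in> Basis" for b
      unfolding Suc.IH using *[rule_format, of "_ @ [b]"] that by auto
    then show "smooth_n (Suc n) f" using *[rule_format, of "[]"] by simp
  qed
qed simp

lemma smooth_iff: "smooth f \<longleftrightarrow> (\<forall>n. smooth_n n f)"
  unfolding smooth_def smooth_n_iff by blast

lemma smooth_differentiable: "smooth f \<Longrightarrow> f differentiable_on UNIV"
  unfolding smooth_def by (auto dest: spec[of _ "[]"])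

lemma smooth_pd: "smooth f \<Longrightarrow> b \<in> Basis \<Longrightarrow> smooth (pd b f)"
  unfolding smooth_iff by (metis smooth_n.simps(2))

lemma smooth_continuous: "smooth f \<Longrightarrow> continuous_on UNIV f"
  by (intro differentiable_imp_continuous_on smooth_differentiable)

lemma pd_add:
  "f differentiable_on UNIV \<Longrightarrow> g differentiable_on UNIV \<Longrightarrow>
    pd b (\<lambda>x. f x + g x) = (\<lambda>x. pd b f x + pd b g x)"
  by (intro ext pd_eq[where f' = "\<lambda>h. pd h f _ + pd h g _"] has_derivative_add has_derivative_pd)

lemma pd_mult:
  "f differentiable_on UNIV \<Longrightarrow> g differentiable_on UNIV \<Longrightarrow>
    pd b (\<lambda>x. f x * g x) = (\<lambda>x. f x * pd b g x + pd b f x * g x)"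
  by (intro ext pd_eq[where f' = "\<lambda>h. f _ * pd h g _ + pd h f _ * g _"] has_derivative_mult has_derivative_pd)

lemma pd_const: "pd b (\<lambda>x. c) = (\<lambda>x. 0)"
  by (simp add: pd_def fun_eq_iff)

lemma smooth_n_mono: "smooth_n (Suc n) f \<Longrightarrow> smooth_n n f"
  by (induction n arbitrary: f) auto

lemma smooth_n_add: "smooth_n n f \<Longrightarrow> smooth_n n g \<Longrightarrow> smooth_n n (\<lambda>x. f x + g x)"
  by (induction n arbitrary: f g) (auto simp: pd_add intro: differentiable_on_add)

lemma smooth_n_mult: "smooth_n n f \<Longrightarrow> smooth_n n g \<Longrightarrow> smooth_n n (\<lambda>x. f x * g x)"
proof (induction n arbitrary: f g)
  case (Suc n)
  then have "smooth_n n f" "smooth_n n g" by (blast intro: smooth_n_mono)+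
  with Suc show ?case
    by (auto simp: pd_mult intro!: differentiable_on_mult smooth_n_add)
qed simp

lemma smooth_n_const: "smooth_n n (\<lambda>_. c)"
  by (induction n arbitrary: c) (auto simp: pd_const)

lemma smooth_const [simp]: "smooth (\<lambda>_. c)"
  by (simp add: smooth_iff smooth_n_const)

lemma smooth_add: "smooth f \<Longrightarrow> smooth g \<Longrightarrow> smooth (\<lambda>x. f x + g x)"
  by (simp add: smooth_iff smooth_n_add)

lemma smooth_mult: "smooth f \<Longrightarrow> smooth g \<Longrightarrow> smooth (\<lambda>x. f x * g x)"
  by (simp add: smooth_iff smooth_n_mult)

lemma smooth_prod: "(\<And>i. i \<in> I \<Longrightarrow> smooth (f i)) \<Longrightarrow> smooth (\<lambda>x. \<Prod>i\<in>I. f i x)"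
  by (induction I rule: infinite_finite_induct) (auto intro: smooth_mult)

lemma pd_compose_inner:
  fixes g :: "real \<Rightarrow> real"
  assumes "g differentiable_on UNIV"
  shows "pd b (\<lambda>x. g (x \<bullet> c + d)) = (\<lambda>x. (b \<bullet> c) * pd 1 g (x \<bullet> c + d))"
proof
  fix x
  have "((\<lambda>x. g (x \<bullet> c + d)) has_derivative (\<lambda>h. pd (h \<bullet> c) g (x \<bullet> c + d))) (at x)"
    by (rule has_derivative_compose[OF _ has_derivative_pd[OF assms]]) (auto intro!: derivative_eq_intros)
  then have "pd b (\<lambda>x. g (x \<bullet> c + d)) x = pd (b \<bullet> c) g (x \<bullet> c + d)" by (rule pd_eq)
  also have "\<dots> = (b \<bullet> c) * pd 1 g (x \<bullet> c + d)"
    using linear_scale[OF has_derivative_linear[OF has_derivative_pd[OF assms]], of "b \<bullet> c" 1] by simp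
  finally show "pd b (\<lambda>x. g (x \<bullet> c + d)) x = (b \<bullet> c) * pd 1 g (x \<bullet> c + d)" .
qed

lemma smooth_n_compose_inner:
  fixes g :: "real \<Rightarrow> real"
  shows "smooth_n n g \<Longrightarrow> smooth_n n (\<lambda>x::'a::euclidean_space. g (x \<bullet> c + d))"
proof (induction n arbitrary: g)
  case (Suc n)
  then have g: "g differentiable_on UNIV" by simp
  have "(\<lambda>x. g (x \<bullet> c + d)) differentiable (at x)" for x :: 'a
  proof -
    have "((\<lambda>x. x \<bullet> c + d) has_derivative (\<lambda>h. h \<bullet> c)) (at x)" by (auto intro!: derivative_eq_intros)
    from has_derivative_compose[OF this has_derivative_pd[OF g]] show ?thesis
      by (auto simp: differentiable_def)
  qed
  then show ?case
    using Suc by (auto simp: pd_compose_inner[OF g] differentiable_on_def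
        intro!: smooth_n_mult smooth_n_const)
qed simp

lemma smooth_compose_inner:
  "smooth (g :: real \<Rightarrow> real) \<Longrightarrow> smooth (\<lambda>x::'a::euclidean_space. g (x \<bullet> c + d))"
  by (simp add: smooth_iff smooth_n_compose_inner)

lemma pd_1_deriv: "f differentiable_on UNIV \<Longrightarrow> pd 1 f = deriv f"
proof
  fix x :: real assume f: "f differentiable_on UNIV"
  have "pd h f x = pd 1 f x * h" for h
  proof -
    have "pd (h *\<^sub>R 1) f x = h *\<^sub>R pd 1 f x"
      by (rule linear_scale[OF has_derivative_linear[OF has_derivative_pd[OF f]]])
    then show ?thesis by (simp only: real_scaleR_def mult_1_right mult.commute[of h "pd 1 f x"])
  qed
  then have "(\<lambda>h. pd h f x) = (*) (pd 1 f x)" by (rule ext)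
  then have "(f has_field_derivative pd 1 f x) (at x)"
    using has_derivative_pd[OF f, of x] unfolding has_field_derivative_def by (simp only:)
  then show "pd 1 f x = deriv f x" by (simp add: DERIV_imp_deriv)
qed

text \<open>Any class of functions closed under taking derivatives consists of smooth functions; no
  formula for the higher derivatives is required.\<close>

lemma smooth_1_coinduct:
  fixes f :: "real \<Rightarrow> real"
  assumes "P f" and step: "\<And>f. P f \<Longrightarrow> \<exists>f'. P f' \<and> (\<forall>x. (f has_field_derivative f' x) (at x))"
  shows "smooth f"
proof -
  have "smooth_n n f" if "P f" for n f
    using that
  proof (induction n arbitrary: f)
    case (Suc n)
    obtain f' where f': "P f'" "\<And>x. (f has_field_derivative f' x) (at x)" using step[OF Suc.prems] by blast
    have d: "f differentiable_on UNIV"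
      using f'(2) by (auto simp: differentiable_on_def differentiable_def has_field_derivative_def)
    have "deriv f = f'" using f'(2) by (auto intro: DERIV_imp_deriv)
    then show ?case using Suc.IH[OF f'(1)] d by (simp add: pd_1_deriv)
  qed simp
  then show ?thesis using assms(1) by (simp add: smooth_iff)
qed

subsection \<open>A smooth step and bump functions\<close>

text \<open>Functions q(1/x) exp(-1/x), extended by 0. They are closed under differentiation: the
  chain rule turns \<open>q\<close> into y^2 (q - q') in the variable y = 1/x, which is the
  polynomial \<open>[:0, 0, 1:] * (q - pderiv q)\<close>.\<close>

definition flat :: "real poly \<Rightarrow> real \<Rightarrow> real" where
  "flat q x = (if x > 0 then poly q (1 / x) * exp (- (1 / x)) else 0)"

lemma poly_exp_tendsto_0: "((\<lambda>y. poly q y * exp (- y)) \<longlongrightarrow> (0::real)) at_top"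
proof -
  have "((\<lambda>y. \<Sum>i\<le>degree q. Polynomial.coeff q i * (y ^ i / exp y)) \<longlongrightarrow>
      (\<Sum>i\<le>degree q. Polynomial.coeff q i * 0)) at_top"
    by (intro tendsto_intros tendsto_power_div_exp_0)
  then show ?thesis
    by (simp add: poly_altdef exp_minus sum_distrib_right divide_inverse mult.assoc)
qed

lemma flat_has_derivative:
  "(flat q has_field_derivative flat ([:0, 0, 1:] * (q - pderiv q)) x) (at x)"
proof -
  consider "x > 0" | "x < 0" | "x = 0" by linarith
  then show ?thesis
  proof cases
    case 1
    have "((\<lambda>x. poly q (1 / x) * exp (- (1 / x))) has_field_derivative
        flat ([:0, 0, 1:] * (q - pderiv q)) x) (at x)"
      using 1 by (auto intro!: derivative_eq_intros poly_DERIV DERIV_chain2[where f = "poly q"]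
          simp: flat_def field_simps power2_eq_square)
    then show ?thesis
      by (rule has_field_derivative_transform_within_open[of _ _ _ "{0<..}"])
        (use 1 in \<open>auto simp: flat_def\<close>)
  next
    case 2
    have "((\<lambda>_. 0) has_field_derivative 0) (at x)" by simp
    then have "(flat q has_field_derivative 0) (at x)"
      by (rule has_field_derivative_transform_within_open[of _ _ _ "{..<0}"])
        (use 2 in \<open>auto simp: flat_def\<close>)
    then show ?thesis using 2 by (simp add: flat_def)
  next
    case 3
    \<comment> \<open>Substituting y = 1/h, the division by h becomes one more factor y in the
      polynomial, and the exponential still wins.\<close>
    have "((\<lambda>h. flat q h / h) \<longlongrightarrow> 0) (at_right 0)"
    proof -
      have "((\<lambda>y. poly ([:0, 1:] * q) y * exp (- y)) \<longlongrightarrow> 0) at_top" by (rule poly_exp_tendsto_0)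
      then have "((\<lambda>h. poly ([:0, 1:] * q) (inverse h) * exp (- inverse h)) \<longlongrightarrow> 0) (at_right 0)"
        by (rule filterlim_compose[OF _ filterlim_inverse_at_top_right])
      then show ?thesis
        by (rule Lim_transform_eventually)
          (auto simp: flat_def field_simps eventually_at_filter)
    qed
    moreover have "((\<lambda>h. flat q h / h) \<longlongrightarrow> 0) (at_left 0)"
      by (rule Lim_transform_eventually[OF tendsto_const])
        (auto simp: flat_def eventually_at_filter)
    ultimately have "((\<lambda>h. flat q h / h) \<longlongrightarrow> 0) (at 0)" by (intro filterlim_split_at)
    then show ?thesis using 3 by (simp add: has_field_derivative_iff flat_def)
  qed
qed

definition step :: "real \<Rightarrow> real" where
  "step x = (if x > 0 then exp (- (1 / x)) else 0)"

lemma smooth_step: "smooth step"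
proof (rule smooth_1_coinduct[where P = "\<lambda>f. \<exists>q. f = flat q"])
  show "\<exists>q. step = flat q" by (intro exI[of _ 1]) (auto simp: step_def flat_def)
qed (use flat_has_derivative in blast)

lemma step_bounds: "0 \<le> step x" "step x \<le> 1"
  by (auto simp: step_def)

lemma step_tendsto_1: "(step \<longlongrightarrow> 1) at_top"
proof -
  have "((\<lambda>x. exp (- (1 / x))) \<longlongrightarrow> exp (- 0)) (at_top :: real filter)"
    by (intro tendsto_intros tendsto_divide_0[OF tendsto_const] filterlim_at_top_imp_at_infinity filterlim_ident)
  then have "((\<lambda>x. exp (- (1 / x))) \<longlongrightarrow> (1::real)) at_top" by simp
  then show ?thesis
    by (rule Lim_transform_eventually)
      (use eventually_gt_at_top[of 0] in \<open>eventually_elim, simp add: step_def\<close>)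
qed

text \<open>A smooth approximation of the indicator of \<open>box a b\<close>, sharper as
  \<open>k\<close> grows. The shifts by 1 keep its support at distance 1/k inside the faces; the
  arguments are written as affine functions of \<open>x\<close> so that
  \<open>smooth_compose_inner\<close> applies to each factor.\<close>

definition bump :: "'a::euclidean_space \<Rightarrow> 'a \<Rightarrow> nat \<Rightarrow> 'a \<Rightarrow> real" where
  "bump a b k x = (\<Prod>i\<in>Basis. step (x \<bullet> (real k *\<^sub>R i) + (- real k * (a \<bullet> i) - 1)) *
     step (x \<bullet> (- real k *\<^sub>R i) + (real k * (b \<bullet> i) - 1)))"

lemma smooth_bump: "smooth (bump a b k)"
  unfolding bump_def[abs_def] by (intro smooth_prod smooth_mult smooth_compose_inner smooth_step)

lemma bump_bounds: "0 \<le> bump a b k x" "bump a b k x \<le> 1"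
  unfolding bump_def by (auto intro!: prod_nonneg prod_le_1 mult_nonneg_nonneg mult_le_one step_bounds)

lemma bump_in_test_functions:
  assumes a: "\<And>i. i \<in> Basis \<Longrightarrow> 0 \<le> a \<bullet> i" and b: "\<And>i. i \<in> Basis \<Longrightarrow> b \<bullet> i \<le> 1"
  shows "bump a b k \<in> test_functions"
\<comment> \<open>For \<open>k = 0\<close> every factor is \<open>step (-1)\<close>, so the bump is
  identically 0.\<close>
proof (cases "k = 0")
  case True
  then have "bump a b k = (\<lambda>_. 0)" by (auto simp: bump_def step_def fun_eq_iff intro!: prod_zero)
  then show ?thesis by (simp add: test_functions_def)
next
  case False
  let ?d = "(1 / real k) *\<^sub>R One"
  have "{x. bump a b k x \<noteq> 0} \<subseteq> cbox (a + ?d) (b - ?d)"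
  proof
    fix x assume "x \<in> {x. bump a b k x \<noteq> 0}"
    then have nz: "step (x \<bullet> (real k *\<^sub>R i) + (- real k * (a \<bullet> i) - 1)) \<noteq> 0"
      "step (x \<bullet> (- real k *\<^sub>R i) + (real k * (b \<bullet> i) - 1)) \<noteq> 0" if "i \<in> Basis" for i
      using that by (auto simp: bump_def)
    show "x \<in> cbox (a + ?d) (b - ?d)"
      unfolding mem_box
    proof (intro ballI)
      fix i :: 'a assume i: "i \<in> Basis"
      have "real k * (x \<bullet> i - a \<bullet> i) - 1 > 0" "real k * (b \<bullet> i - x \<bullet> i) - 1 > 0"
        using nz[OF i] by (auto simp: step_def algebra_simps split: if_splits)
      then show "(a + ?d) \<bullet> i \<le> x \<bullet> i \<and> x \<bullet> i \<le> (b - ?d) \<bullet> i"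
        using False i by (simp add: inner_add_left inner_diff_left field_simps)
    qed
  qed
  then have "closure {x. bump a b k x \<noteq> 0} \<subseteq> cbox (a + ?d) (b - ?d)"
    by (rule closure_minimal[OF _ closed_cbox])
  also have "\<dots> \<subseteq> box 0 One"
  proof
    fix x assume x: "x \<in> cbox (a + ?d) (b - ?d)"
    show "x \<in> box 0 One" unfolding mem_box
    proof (intro ballI)
      fix i :: 'a assume i: "i \<in> Basis"
      have "a \<bullet> i + 1 / real k \<le> x \<bullet> i" "x \<bullet> i \<le> b \<bullet> i - 1 / real k"
        using x i unfolding mem_box by (auto simp: inner_add_left inner_diff_left)
      moreover have "1 / real k > 0" using False by simp
      ultimately have "0 < x \<bullet> i" "x \<bullet> i < 1" using a[OF i] b[OF i] by linarith+
      then show "0 \<bullet> i < x \<bullet> i \<and> x \<bullet> i < One \<bullet> i" using i by simp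
    qed
  qed
  finally show ?thesis using smooth_bump by (simp add: test_functions_def)
qed

lemma bump_tendsto: "(\<lambda>k. bump a b k x) \<longlonglongrightarrow> indicator (box a b) x"
proof -
  have st: "(\<lambda>k. step (real k * t - 1)) \<longlonglongrightarrow> (if t > 0 then 1 else 0)" for t
  proof (cases "t > 0")
    case True
    have "filterlim (\<lambda>k. real k * t - 1) at_top sequentially"
      using filterlim_tendsto_add_at_top[OF tendsto_const[of "-1"]
          filterlim_at_top_mult_tendsto_pos[OF tendsto_const True filterlim_real_sequentially]]
      by simp
    then show ?thesis using filterlim_compose[OF step_tendsto_1] True by auto
  next
    case False
    then have "real k * t - 1 \<le> 0" for k using mult_nonneg_nonpos[of "real k" t] by simp
    then show ?thesis using False by (simp add: step_def not_less[symmetric])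
  qed
  have eq: "bump a b k x = (\<Prod>i\<in>Basis. step (real k * (x \<bullet> i - a \<bullet> i) - 1) * step (real k * (b \<bullet> i - x \<bullet> i) - 1))" for k
    unfolding bump_def by (intro prod.cong) (auto simp: algebra_simps)
  have "(\<lambda>k. bump a b k x) \<longlonglongrightarrow>
      (\<Prod>i\<in>Basis. (if x \<bullet> i - a \<bullet> i > 0 then 1 else 0) * (if b \<bullet> i - x \<bullet> i > 0 then 1 else 0))"
    unfolding eq by (intro tendsto_prod tendsto_mult st)
  also have "(\<Prod>i\<in>Basis. (if x \<bullet> i - a \<bullet> i > 0 then 1 else 0) * (if b \<bullet> i - x \<bullet> i > 0 then 1 else 0 :: real))
      = indicator (box a b) x"
  proof (cases "x \<in> box a b")
    case True
    then show ?thesis by (auto simp: mem_box intro!: prod.neutral)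
  next
    case False
    then obtain i where "i \<in> Basis" "\<not> (a \<bullet> i < x \<bullet> i \<and> x \<bullet> i < b \<bullet> i)" by (auto simp: mem_box)
    then show ?thesis using False by (intro trans[OF prod_zero]) (auto intro!: bexI[of _ i])
  qed
  finally show ?thesis .
qed

section \<open>Test functions: closure properties and density\<close>

lemma test_functions_smooth: "\<phi> \<in> test_functions \<Longrightarrow> smooth \<phi>"
  by (simp add: test_functions_def)

lemma test_functions_L2: "\<phi> \<in> test_functions \<Longrightarrow> \<phi> \<in> L2"
  by (intro continuous_L2 smooth_continuous test_functions_smooth)

lemma test_functions_differentiable: "\<phi> \<in> test_functions \<Longrightarrow> \<phi> differentiable_on UNIV"
  by (intro smooth_differentiable test_functions_smooth)

lemma test_functions_pd:
  assumes "\<phi> \<in> test_functions" "b \<in> Basis"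
  shows "pd b \<phi> \<in> test_functions"
proof -
  let ?S = "closure {x. \<phi> x \<noteq> 0}"
  have "pd b \<phi> x = 0" if "x \<notin> ?S" for x
  proof -
    have "((\<lambda>_. 0) has_derivative (\<lambda>_. 0)) (at x)" by simp
    then have "(\<phi> has_derivative (\<lambda>_. 0)) (at x)"
      by (rule has_derivative_transform_within_open[of _ _ _ _ "- ?S"])
        (use that closure_subset[of "{x. \<phi> x \<noteq> 0}"] in auto)
    then show ?thesis by (rule pd_eq)
  qed
  then have "closure {x. pd b \<phi> x \<noteq> 0} \<subseteq> ?S" by (intro closure_minimal) auto
  then show ?thesis using assms smooth_pd by (auto simp: test_functions_def)
qed

lemma test_functions_foldr:
  "\<phi> \<in> test_functions \<Longrightarrow> set bs \<subseteq> Basis \<Longrightarrow> foldr pd bs \<phi> \<in> test_functions"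
  by (induction bs) (auto intro: test_functions_pd)

lemma test_functions_lincomb:
  assumes "\<phi> \<in> test_functions" "\<psi> \<in> test_functions"
  shows "(\<lambda>x. \<phi> x + c * \<psi> x) \<in> test_functions"
proof -
  have "closure {x. \<phi> x + c * \<psi> x \<noteq> 0} \<subseteq> closure ({x. \<phi> x \<noteq> 0} \<union> {x. \<psi> x \<noteq> 0})"
    by (rule closure_mono) auto
  then show ?thesis
    using assms by (auto simp: test_functions_def intro!: smooth_add smooth_mult)
qed

lemma L2_subspace_test_functions: "L2_subspace test_functions"
  unfolding L2_subspace_def
  by (auto intro: test_functions_lincomb test_functions_L2) (simp add: test_functions_def)

text \<open>Bump functions approximate the indicators of boxes, and these determine the integral over
  all Borel sets.\<close>

lemma L2_eq_0_if_orthogonal_to_bumps: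
  fixes f :: "'a::euclidean_space \<Rightarrow> real"
  assumes f: "f \<in> L2"
    and 0: "\<And>a b k. (\<And>i. i \<in> Basis \<Longrightarrow> 0 \<le> a \<bullet> i) \<Longrightarrow> (\<And>i. i \<in> Basis \<Longrightarrow> b \<bullet> i \<le> 1) \<Longrightarrow>
      ip f (bump a b k) = 0"
  shows "L2_eq f (\<lambda>_. 0)"
proof -
  define F where "F x = indicator (cbox 0 One) x * f x" for x
  have fint: "integrable cube f" by (rule L2_integrable[OF f])
  then have F: "integrable lborel F"
    by (simp add: integrable_restrict_space F_def[abs_def])
  have box: "(LINT x:box a b|lborel. F x) = 0" if "box a b \<subseteq> box 0 One" for a b
  proof (cases "box a b = {}")
    case False
    then have *: "0 \<le> a \<bullet> i" "b \<bullet> i \<le> 1" if "i \<in> Basis" for i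
      using \<open>box a b \<subseteq> box 0 One\<close> that unfolding subset_box box_ne_empty by auto
    have "(\<lambda>k. \<integral>x. f x * bump a b k x \<partial>cube) \<longlonglongrightarrow> (\<integral>x. f x * indicator (box a b) x \<partial>cube)"
    proof (rule integral_dominated_convergence)
      show "integrable cube (\<lambda>x. \<bar>f x\<bar>)" using fint by simp
      show "AE x in cube. (\<lambda>k. f x * bump a b k x) \<longlonglongrightarrow> f x * indicator (box a b) x"
        by (intro AE_I2 tendsto_mult tendsto_const bump_tendsto)
      show "AE x in cube. norm (f x * bump a b k x) \<le> \<bar>f x\<bar>" for k
        using bump_bounds[of a b k] by (intro AE_I2) (simp add: abs_mult mult_left_le)
      show "(\<lambda>x. f x * indicator (box a b) x) \<in> borel_measurable cube"
        by (intro borel_measurable_times L2_measurable[OF f] borel_measurable_cube) measurable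
      show "(\<lambda>x. f x * bump a b k x) \<in> borel_measurable cube" for k
        by (intro borel_measurable_times L2_measurable[OF f] borel_measurable_cube
            borel_measurable_continuous_onI smooth_continuous smooth_bump)
    qed
    moreover have "(\<integral>x. f x * bump a b k x \<partial>cube) = 0" for k
      using 0[OF *] by (simp add: ip_def)
    ultimately have "(\<integral>x. f x * indicator (box a b) x \<partial>cube) = 0"
      using LIMSEQ_unique[OF tendsto_const] by fastforce
    then show ?thesis
      by (simp add: set_lebesgue_integral_def integral_restrict_space F_def mult_ac)
  qed (simp add: set_lebesgue_integral_def)
  \<comment> \<open>The faces of the cube are a null set, so integrals over any set reduce to the
    open cube, to which the result for open boxes applies.\<close>
  have AE_box: "AE x in lborel. F x = indicator (box 0 One) x * F x"
  proof (rule AE_I[where N = "cbox 0 One - box 0 (One :: 'a)"])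
    show "emeasure lborel (cbox 0 One - box 0 (One :: 'a)) = 0"
      by (subst emeasure_Diff) (auto simp: box_subset_cbox)
  qed (auto simp: F_def indicator_def)
  have set0: "(LINT x:A|lborel. F x) = (LINT x:A \<inter> box 0 One|lborel. F x)" if "A \<in> sets borel" for A
    unfolding set_lebesgue_integral_def
    using F that AE_box by (intro integral_cong_AE) (auto simp: indicator_def elim!: AE_mp)
  have "(LINT x:A|lborel. F x) = 0" if "A \<in> sets borel" for A
  proof -
    have "Int_stable (range (\<lambda>(a, b). box a b :: 'a set))"
      by (auto simp: Int_stable_def box_Int_box)
    moreover have "range (\<lambda>(a, b). box a b :: 'a set) \<subseteq> Pow UNIV" by simp
    moreover have sb: "sigma_sets UNIV (range (\<lambda>(a, b). box a b :: 'a set)) = sets borel"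
      by (simp add: borel_eq_box)
    then have "A \<in> sigma_sets UNIV (range (\<lambda>(a, b). box a b :: 'a set))" using that by simp
    ultimately show ?thesis
    proof (induction rule: sigma_sets_induct_disjoint)
      case (basic A)
      then obtain a b where A: "A = box a b" by auto
      obtain c d where cd: "box a b \<inter> box 0 One = box c d" unfolding box_Int_box by blast
      then have "box c d \<subseteq> box 0 One" by (metis Int_lower2)
      from box[OF this] show ?case unfolding A cd[symmetric] by (subst set0) simp_all
    next
      case empty
      show ?case by (simp add: set_lebesgue_integral_def)
    next
      case (compl A)
      then have A: "A \<in> sets borel" using sb by simp
      have int: "integrable lborel (\<lambda>x. indicator A x *\<^sub>R F x)"
        by (rule integrable_mult_indicator[OF _ F]) (use A in simp)
      have UNIV0: "(LINT x:UNIV|lborel. F x) = 0" using set0[of UNIV] box[of 0 One] by simp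
      have "(LINT x:UNIV - A|lborel. F x) = (\<integral>x. F x - indicator A x *\<^sub>R F x \<partial>lborel)"
        unfolding set_lebesgue_integral_def
        by (rule Bochner_Integration.integral_cong) (auto simp: indicator_def)
      also have "\<dots> = (LINT x:UNIV|lborel. F x) - (LINT x:A|lborel. F x)"
        unfolding set_lebesgue_integral_def using F int by simp
      finally show ?case using UNIV0 compl.IH by simp
    next
      case (union A)
      have A: "\<And>i. A i \<in> sets lborel" using union.hyps(2) sb by auto
      have "set_integrable lborel (\<Union>i. A i) F"
        unfolding set_integrable_def by (rule integrable_mult_indicator[OF _ F]) (use A in auto)
      with A have "(LINT x:(\<Union>i. A i)|lborel. F x) = (\<Sum>i. (LINT x:(A i)|lborel. F x))"
        using union.hyps(1)
        by (intro lebesgue_integral_countable_add) (auto simp: disjoint_family_on_def)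
      then show ?case using union.IH by simp
    qed
  qed
  then have "AE x in lborel. F x = 0" using sigma_finite_measure.density_zero[OF lborel.sigma_finite_measure_axioms F] by simp
  then have "AE x in cube. f x = 0"
    by (subst AE_restrict_space_iff) (auto simp: F_def elim!: AE_mp)
  then show ?thesis by (simp add: L2_eq_def)
qed

lemma L2_eq_0_if_orthogonal_to_tests:
  assumes "f \<in> L2" "\<And>\<phi>. \<phi> \<in> test_functions \<Longrightarrow> ip f \<phi> = 0"
  shows "L2_eq f (\<lambda>_. 0)"
  by (rule L2_eq_0_if_orthogonal_to_bumps[OF assms(1)]) (auto intro: assms(2) bump_in_test_functions)

lemma L2_eq_if_equal_on_tests:
  assumes "f \<in> L2" "g \<in> L2" "\<And>\<phi>. \<phi> \<in> test_functions \<Longrightarrow> ip f \<phi> = ip g \<phi>"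
  shows "L2_eq f g"
  using L2_eq_0_if_orthogonal_to_tests[of "\<lambda>x. f x - g x"] assms
  by (simp add: ip_diff_left test_functions_L2 L2_eq_diff_0)

lemma test_functions_dense:
  assumes "f \<in> L2"
  obtains \<phi> where "\<And>n. \<phi> n \<in> test_functions" "L2_lim \<phi> f"
  using L2_dense[OF L2_subspace_test_functions assms L2_eq_0_if_orthogonal_to_tests] by blast

section \<open>One-dimensional operators of finite rank\<close>

lemma weak_deriv_iff:
  "weak_deriv u u' \<longleftrightarrow> u \<in> L2 \<and> u' \<in> L2 \<and> (\<forall>\<phi>\<in>test_functions. ip u (pd 1 \<phi>) = - ip u' \<phi>)"
  unfolding weak_deriv_def ip_def
  by (auto simp: pd_1_deriv[OF test_functions_differentiable])

lemma weak_derivD: "weak_deriv u u' \<Longrightarrow> \<phi> \<in> test_functions \<Longrightarrow> ip u (pd 1 \<phi>) = - ip u' \<phi>"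
  by (simp add: weak_deriv_iff)

lemma weak_deriv_L2: "weak_deriv u u' \<Longrightarrow> u \<in> L2" "weak_deriv u u' \<Longrightarrow> u' \<in> L2"
  by (simp_all add: weak_deriv_iff)

lemma test_functions_pd_1: "\<phi> \<in> test_functions \<Longrightarrow> pd (1::real) \<phi> \<in> test_functions"
  by (rule test_functions_pd) (simp_all add: Basis_real_def)

lemma weak_deriv_unique: "weak_deriv u v \<Longrightarrow> weak_deriv u w \<Longrightarrow> L2_eq v w"
  by (rule L2_eq_if_equal_on_tests) (auto simp: weak_deriv_L2 dest!: weak_derivD)

lemma weak_deriv_cong:
  assumes u: "weak_deriv u u'" and eq: "L2_eq u v" "L2_eq u' v'" and L: "v \<in> L2" "v' \<in> L2"
  shows "weak_deriv v v'"
  unfolding weak_deriv_iff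
proof (intro conjI ballI L)
  fix \<phi> :: "real \<Rightarrow> real" assume \<phi>: "\<phi> \<in> test_functions"
  have "ip v (pd 1 \<phi>) = ip u (pd 1 \<phi>)"
    using ip_cong[OF eq(1) weak_deriv_L2(1)[OF u] L(1) test_functions_L2[OF test_functions_pd_1[OF \<phi>]]] by simp
  also have "\<dots> = - ip u' \<phi>" by (rule weak_derivD[OF u \<phi>])
  also have "ip u' \<phi> = ip v' \<phi>"
    by (rule ip_cong[OF eq(2) weak_deriv_L2(2)[OF u] L(2) test_functions_L2[OF \<phi>]])
  finally show "ip v (pd 1 \<phi>) = - ip v' \<phi>" .
qed

lemma weak_deriv_sum:
  assumes "\<And>i. i \<in> I \<Longrightarrow> weak_deriv (u i) (u' i)"
  shows "weak_deriv (\<lambda>x. \<Sum>i\<in>I. c i * u i x) (\<lambda>x. \<Sum>i\<in>I. c i * u' i x)"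
proof -
  have L: "u i \<in> L2" "u' i \<in> L2" if "i \<in> I" for i using weak_deriv_L2[OF assms[OF that]] by auto
  show ?thesis
    unfolding weak_deriv_iff
  proof (intro conjI ballI)
    fix \<phi> :: "real \<Rightarrow> real" assume \<phi>: "\<phi> \<in> test_functions"
    note \<phi>' = test_functions_L2[OF \<phi>] test_functions_L2[OF test_functions_pd_1[OF \<phi>]]
    have "ip (\<lambda>x. \<Sum>i\<in>I. c i * u i x) (pd 1 \<phi>) = (\<Sum>i\<in>I. c i * ip (u i) (pd 1 \<phi>))"
      using L \<phi>' by (simp add: ip_sum_left ip_scale_left)
    also have "\<dots> = (\<Sum>i\<in>I. - (c i * ip (u' i) \<phi>))"
      by (rule sum.cong) (simp_all add: weak_derivD[OF assms \<phi>])
    also have "\<dots> = - ip (\<lambda>x. \<Sum>i\<in>I. c i * u' i x) \<phi>"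
      using L \<phi>' by (simp add: ip_sum_left ip_scale_left sum_negf)
    finally show "ip (\<lambda>x. \<Sum>i\<in>I. c i * u i x) (pd 1 \<phi>) = - ip (\<lambda>x. \<Sum>i\<in>I. c i * u' i x) \<phi>" .
  qed (use L in auto)
qed

subsection \<open>Orthonormal bases\<close>

lemma L2_subspace_L2: "L2_subspace S \<Longrightarrow> f \<in> S \<Longrightarrow> f \<in> L2"
  by (auto simp: L2_subspace_def)

lemma L2_subspace_lincomb: "L2_subspace S \<Longrightarrow> f \<in> S \<Longrightarrow> g \<in> S \<Longrightarrow> (\<lambda>x. f x + c * g x) \<in> S"
  by (auto simp: L2_subspace_def)

lemma L2_subspace_sum:
  assumes S: "L2_subspace S" and "\<And>i. i \<in> I \<Longrightarrow> f i \<in> S"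
  shows "(\<lambda>x. \<Sum>i\<in>I. c i * f i x) \<in> S"
  using assms(2)
proof (induction I rule: infinite_finite_induct)
  case (insert i I)
  then have "(\<lambda>x. (\<Sum>i\<in>I. c i * f i x) + c i * f i x) \<in> S"
    by (intro L2_subspace_lincomb[OF S]) auto
  then show ?case using insert by (simp add: add.commute)
qed (use S in \<open>auto simp: L2_subspace_def\<close>)

definition orthonormal :: "nat \<Rightarrow> (nat \<Rightarrow> 'a::euclidean_space \<Rightarrow> real) \<Rightarrow> bool" where
  "orthonormal N e \<longleftrightarrow> (\<forall>i<N. e i \<in> L2) \<and> (\<forall>i<N. \<forall>j<N. ip (e i) (e j) = (if i = j then 1 else 0))"

lemma orthonormal_coefficients:
  assumes "orthonormal N e" "j < N"
  shows "ip (\<lambda>x. \<Sum>i<N. c i * e i x) (e j) = c j"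
proof -
  have "ip (\<lambda>x. \<Sum>i<N. c i * e i x) (e j) = (\<Sum>i<N. c i * ip (e i) (e j))"
    using assms by (subst ip_sum_left) (auto simp: orthonormal_def ip_scale_left)
  also have "\<dots> = (\<Sum>i<N. if j = i then c i else 0)"
    using assms by (intro sum.cong) (auto simp: orthonormal_def)
  also have "\<dots> = c j" using assms(2) by simp
  finally show ?thesis .
qed

text \<open>The spanning set may be linearly dependent modulo null sets, so the residual of a new
  element is either normalised and added or has norm 0 and is dropped.\<close>

lemma Gram_Schmidt:
  assumes S: "L2_subspace S" and "finite B" "B \<subseteq> S"
  shows "\<exists>N e. orthonormal N e \<and> (\<forall>i<N. e i \<in> S) \<and>
    (\<forall>b\<in>B. \<exists>c. L2_eq b (\<lambda>x. \<Sum>i<N. c i * e i x))"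
  using assms(2,3)
proof (induction B rule: finite_induct)
  case empty
  show ?case by (intro exI[of _ 0]) (simp add: orthonormal_def)
next
  case (insert b B)
  then obtain N e where e: "orthonormal N e" "\<And>i. i < N \<Longrightarrow> e i \<in> S"
    "\<And>b. b \<in> B \<Longrightarrow> \<exists>c. L2_eq b (\<lambda>x. \<Sum>i<N. c i * e i x)" by auto
  have b: "b \<in> S" "b \<in> L2" using insert.prems L2_subspace_L2[OF S] by auto
  have eL: "e i \<in> L2" if "i < N" for i using e(1) that by (simp add: orthonormal_def)
  define P where "P x = (\<Sum>i<N. ip b (e i) * e i x)" for x
  have PS: "P \<in> S" unfolding P_def[abs_def] by (rule L2_subspace_sum[OF S]) (use e(2) in auto)
  define r where "r x = b x + (-1) * P x" for x
  have rS: "r \<in> S" unfolding r_def[abs_def] by (rule L2_subspace_lincomb[OF S b(1) PS])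
  have rL: "r \<in> L2" and PL: "P \<in> L2" using L2_subspace_L2[OF S] rS PS by auto
  have r_orth: "ip r (e j) = 0" if "j < N" for j
  proof -
    have "ip r (e j) = ip b (e j) - ip P (e j)"
      unfolding r_def[abs_def] using b(2) PL eL[OF that] by (simp add: ip_diff_left)
    also have "ip P (e j) = ip b (e j)"
      unfolding P_def[abs_def] by (rule orthonormal_coefficients[OF e(1) that])
    finally show ?thesis by simp
  qed
  show ?case
  proof (cases "L2_norm r = 0")
    case True
    then have "L2_eq r (\<lambda>_. 0)" using rL by (simp add: L2_norm_eq_0)
    then have "L2_eq b P" unfolding L2_eq_def r_def by simp
    then have "\<exists>c. L2_eq b (\<lambda>x. \<Sum>i<N. c i * e i x)"
      unfolding P_def[abs_def] by (rule exI[of _ "\<lambda>i. ip b (e i)"])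
    then show ?thesis using e by blast
  next
    case False
    define e' where "e' = e(N := (\<lambda>x. 0 + 1 / L2_norm r * r x))"
    have e'_N: "e' N = (\<lambda>x. 1 / L2_norm r * r x)" and e'_less: "\<And>i. i < N \<Longrightarrow> e' i = e i"
      by (simp_all add: e'_def)
    have S': "e' i \<in> S" if "i < Suc N" for i
      using that e(2) L2_subspace_lincomb[OF S _ rS, of "\<lambda>_. 0" "1 / L2_norm r"] S
      by (cases "i = N") (auto simp: e'_def L2_subspace_def)
    have rr: "ip r r = L2_norm r * L2_norm r" using L2_norm_square[of r] by (simp add: power2_eq_square)
    have NN: "ip (e' N) (e' N) = 1"
      unfolding e'_N ip_scale_left ip_scale_right rr using False by simp
    have Nj: "ip (e' N) (e j) = 0" "ip (e j) (e' N) = 0" if "j < N" for j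
      using r_orth[OF that] unfolding e'_N by (simp_all only: ip_scale_left ip_scale_right ip_commute[of "e j"])
    have "orthonormal (Suc N) e'"
      unfolding orthonormal_def
    proof (intro conjI allI impI)
      show "e' i \<in> L2" if "i < Suc N" for i using S'[OF that] L2_subspace_L2[OF S] by auto
      show "ip (e' i) (e' j) = (if i = j then 1 else 0)" if "i < Suc N" "j < Suc N" for i j
        using that e(1) NN Nj by (cases "i = N"; cases "j = N") (auto simp: e'_less orthonormal_def)
    qed
    moreover have "\<exists>c. L2_eq b' (\<lambda>x. \<Sum>i<Suc N. c i * e' i x)" if "b' \<in> insert b B" for b'
    proof (cases "b' = b")
      case True
      have "b x = (\<Sum>i<Suc N. (if i = N then L2_norm r else ip b (e i)) * e' i x)" for x
        using False by (simp add: e'_N e'_less r_def P_def)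
      then have "L2_eq b (\<lambda>x. \<Sum>i<Suc N. (if i = N then L2_norm r else ip b (e i)) * e' i x)"
        by (simp add: L2_eq_def del: sum.lessThan_Suc)
      then show ?thesis
        unfolding True by (rule exI[of _ "\<lambda>i. if i = N then L2_norm r else ip b (e i)"])
    next
      case False
      then have "b' \<in> B" using that by simp
      from e(3)[OF this] obtain c where "L2_eq b' (\<lambda>x. \<Sum>i<N. c i * e i x)" by (rule exE)
      then have "L2_eq b' (\<lambda>x. \<Sum>i<Suc N. (if i = N then 0 else c i) * e' i x)"
        by (simp add: e'_less)
      then show ?thesis by (rule exI[of _ "\<lambda>i. if i = N then 0 else c i"])
    qed
    ultimately show ?thesis using S' by blast
  qed
qed

lemma L2_fin_dim_subspace_imp_subspace:
  assumes "L2_fin_dim_subspace S"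
  shows "L2_subspace S"
proof -
  obtain B where B: "finite B" "B \<subseteq> L2" "S = {f \<in> L2. \<exists>c. L2_eq f (\<lambda>x. \<Sum>b\<in>B. c b * b x)}"
    using assms unfolding L2_fin_dim_subspace_def by blast
  have "\<exists>c. L2_eq (\<lambda>_. 0) (\<lambda>x. \<Sum>b\<in>B. c b * b x)"
    by (intro exI[of _ "\<lambda>_. 0"]) simp
  moreover have "\<exists>d. L2_eq (\<lambda>x. f x + k * g x) (\<lambda>x. \<Sum>b\<in>B. d b * b x)"
    if "L2_eq f (\<lambda>x. \<Sum>b\<in>B. c b * b x)" "L2_eq g (\<lambda>x. \<Sum>b\<in>B. c' b * b x)" for f g k c c'
  proof -
    have "L2_eq (\<lambda>x. f x + k * g x) (\<lambda>x. (\<Sum>b\<in>B. c b * b x) + k * (\<Sum>b\<in>B. c' b * b x))"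
      by (intro L2_eq_add L2_eq_scale that)
    also have "(\<lambda>x. (\<Sum>b\<in>B. c b * b x) + k * (\<Sum>b\<in>B. c' b * b x)) = (\<lambda>x. \<Sum>b\<in>B. (c b + k * c' b) * b x)"
      by (simp add: sum_distrib_left sum.distrib algebra_simps)
    finally show ?thesis by (intro exI[of _ "\<lambda>b. c b + k * c' b"])
  qed
  ultimately show ?thesis unfolding L2_subspace_def B(3) by auto
qed

text \<open>The coefficients are made explicit as inner products, so that an operator with values in
  \<open>S\<close> decomposes into scalar functionals.\<close>

lemma fin_dim_orthonormal_basis:
  assumes "L2_fin_dim_subspace S"
  shows "\<exists>N e. orthonormal N e \<and> (\<forall>i<N. e i \<in> S) \<and> (\<forall>f\<in>S. L2_eq f (\<lambda>x. \<Sum>i<N. ip f (e i) * e i x))"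
proof -
  note S = L2_fin_dim_subspace_imp_subspace[OF assms]
  obtain B where B: "finite B" "B \<subseteq> L2" "S = {f \<in> L2. \<exists>c. L2_eq f (\<lambda>x. \<Sum>b\<in>B. c b * b x)}"
    using assms unfolding L2_fin_dim_subspace_def by blast
  have "L2_eq b (\<lambda>x. \<Sum>b'\<in>B. (if b' = b then 1 else 0) * b' x)" if "b \<in> B" for b
    using that B(1) by (simp add: if_distrib[of "\<lambda>y. y * _"] sum.delta cong: if_cong)
  then have "\<exists>c. L2_eq b (\<lambda>x. \<Sum>b'\<in>B. c b' * b' x)" if "b \<in> B" for b
    using that by (intro exI[of _ "\<lambda>b'. if b' = b then 1 else 0"])
  then have "B \<subseteq> S" using B(2) unfolding B(3) by auto
  then obtain N e where e: "orthonormal N e" "\<And>i. i < N \<Longrightarrow> e i \<in> S"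
    "\<And>b. b \<in> B \<Longrightarrow> \<exists>c. L2_eq b (\<lambda>x. \<Sum>i<N. c i * e i x)"
    using Gram_Schmidt[OF S B(1)] by blast
  then obtain C where C: "\<And>b. b \<in> B \<Longrightarrow> L2_eq b (\<lambda>x. \<Sum>i<N. C b i * e i x)" by metis
  have "L2_eq f (\<lambda>x. \<Sum>i<N. ip f (e i) * e i x)" if f: "f \<in> S" for f
  proof -
    obtain c where "L2_eq f (\<lambda>x. \<Sum>b\<in>B. c b * b x)" using f unfolding B(3) by blast
    also have "L2_eq \<dots> (\<lambda>x. \<Sum>b\<in>B. c b * (\<Sum>i<N. C b i * e i x))"
      by (intro L2_eq_sum L2_eq_scale C)
    also have "(\<lambda>x. \<Sum>b\<in>B. c b * (\<Sum>i<N. C b i * e i x)) = (\<lambda>x. \<Sum>i<N. (\<Sum>b\<in>B. c b * C b i) * e i x)"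
    proof
      fix x
      have "(\<Sum>b\<in>B. c b * (\<Sum>i<N. C b i * e i x)) = (\<Sum>b\<in>B. \<Sum>i<N. c b * C b i * e i x)"
        by (simp add: sum_distrib_left mult.assoc)
      also have "\<dots> = (\<Sum>i<N. \<Sum>b\<in>B. c b * C b i * e i x)" by (rule sum.swap)
      finally show "(\<Sum>b\<in>B. c b * (\<Sum>i<N. C b i * e i x)) = (\<Sum>i<N. (\<Sum>b\<in>B. c b * C b i) * e i x)"
        by (simp add: sum_distrib_right)
    qed
    finally have d': "L2_eq f (\<lambda>x. \<Sum>i<N. (\<Sum>b\<in>B. c b * C b i) * e i x)" .
    define d where "d i = (\<Sum>b\<in>B. c b * C b i)" for i
    have d: "L2_eq f (\<lambda>x. \<Sum>i<N. d i * e i x)" using d' by (simp only: d_def)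
    have eL: "e i \<in> L2" if "i < N" for i using e(1) that by (simp add: orthonormal_def)
    have "ip f (e j) = d j" if "j < N" for j
    proof -
      have "ip f (e j) = ip (\<lambda>x. \<Sum>i<N. d i * e i x) (e j)"
        by (rule ip_cong[OF d]) (use that eL f B(3) in auto)
      then show ?thesis using orthonormal_coefficients[OF e(1) that] by simp
    qed
    then show ?thesis using d by simp
  qed
  then show ?thesis using e by blast
qed

subsection \<open>Approximation by test functions together with derivatives\<close>

lemma cube_integral_real:
  fixes f :: "real \<Rightarrow> real"
  assumes "continuous_on UNIV f"
  shows "(\<integral>x. f x \<partial>cube) = integral {0..1} f"
proof -
  have "set_integrable lborel {0..1} f"
    by (rule borel_integrable_atLeastAtMost') (use assms continuous_on_subset in blast)
  then show ?thesis
    using set_borel_integral_eq_integral(2)[of "{0..1}" f]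
    by (simp add: integral_restrict_space set_lebesgue_integral_def)
qed

lemma test_function_support:
  assumes "h \<in> (test_functions :: (real \<Rightarrow> real) set)"
  obtains a b where "0 < a" "a < 1" "b < 1" "\<And>x. x < a \<or> x > b \<Longrightarrow> h x = 0"
proof (cases "{x. h x \<noteq> 0} = {}")
  case True
  \<comment> \<open>For the zero function the crossed bounds 1/2 and 0 make the condition on
    \<open>x\<close> cover the whole line.\<close>
  then show ?thesis using that[of "1/2" 0] by auto
next
  case False
  let ?K = "closure {x. h x \<noteq> 0}"
  have K: "?K \<subseteq> {0<..<1}" using assms by (auto simp: test_functions_def)
  have "bounded ?K" by (rule bounded_subset[OF _ K]) simp
  then have c: "compact ?K" by (simp add: compact_eq_bounded_closed)
  have ne: "?K \<noteq> {}" using False by simp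
  obtain a where a: "a \<in> ?K" "\<forall>x\<in>?K. a \<le> x" using compact_attains_inf[OF c ne] by blast
  obtain b where b: "b \<in> ?K" "\<forall>x\<in>?K. x \<le> b" using compact_attains_sup[OF c ne] by blast
  have "h x = 0" if "x < a \<or> x > b" for x
  proof (rule ccontr)
    assume "h x \<noteq> 0"
    then have "x \<in> ?K" using closure_subset[of "{x. h x \<noteq> 0}"] by blast
    then show False using a(2) b(2) that by (meson linorder_not_le)
  qed
  moreover have "a \<in> {0<..<1}" "b \<in> {0<..<1}" using a(1) b(1) K by blast+
  ultimately show ?thesis using that[of a b] by auto
qed

text \<open>The lower limit \<open>-1\<close> lies outside the support, so that the primitive of a test function
  is differentiable on the whole line.\<close>

definition primitive :: "(real \<Rightarrow> real) \<Rightarrow> real \<Rightarrow> real" where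
  "primitive h x = integral {-1..x} h"

lemma primitive_zero:
  assumes "\<And>y. y \<le> x \<Longrightarrow> h y = 0"
  shows "primitive h x = 0"
proof -
  have "integral {-1..x} h = integral {-1..x} (\<lambda>_. 0)" by (rule integral_cong) (use assms in auto)
  then show ?thesis by (simp add: primitive_def)
qed

lemma primitive_has_derivative:
  assumes h: "h \<in> test_functions"
  shows "(primitive h has_field_derivative h x) (at x)"
proof -
  obtain a b where ab: "0 < a" "\<And>x. x < a \<or> x > b \<Longrightarrow> h x = 0"
    using test_function_support[OF h] by metis
  have cont: "continuous_on S h" for S
    using smooth_continuous[OF test_functions_smooth[OF h]] continuous_on_subset by blast
  \<comment> \<open>To the left of 0 the primitive is locally constant, also below -1 where the
    interval of integration is empty; from 0 on, the point is interior to
    \<open>{-1..x+1}\<close>.\<close>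
  show ?thesis
  proof (cases "x < 0")
    case True
    have z: "primitive h y = 0" if "y < 0" for y by (rule primitive_zero) (use that ab in auto)
    have "((\<lambda>_. 0) has_field_derivative 0) (at x)" by simp
    then have "(primitive h has_field_derivative 0) (at x)"
      by (rule has_field_derivative_transform_within_open[of _ _ _ "{..<0}"])
        (use True z in auto)
    then show ?thesis using True ab by auto
  next
    case False
    have "((\<lambda>y. integral {-1..y} h) has_real_derivative h x) (at x within {-1..x+1})"
      by (rule integral_has_real_derivative[OF cont]) (use False in auto)
    moreover have "at x within {-1..x+1} = at x" by (rule at_within_Icc_at) (use False in auto)
    ultimately show ?thesis by (simp add: primitive_def[abs_def])
  qed
qed

lemma primitive_continuous: "h \<in> test_functions \<Longrightarrow> continuous_on UNIV (primitive h)"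
  using primitive_has_derivative by (meson DERIV_continuous_on has_field_derivative_at_within)

text \<open>Supplies members of H1 with prescribed derivative and no condition at the right end
  point; these are the functions against which a dual pair is tested. The boundary terms vanish
  because of the test function \<open>\<phi>\<close>.\<close>

lemma weak_deriv_primitive:
  assumes h: "h \<in> test_functions"
  shows "weak_deriv (primitive h) h"
  unfolding weak_deriv_iff
proof (intro conjI ballI)
  fix \<phi> :: "real \<Rightarrow> real" assume \<phi>: "\<phi> \<in> test_functions"
  have d: "(\<phi> has_field_derivative pd 1 \<phi> x) (at x)" for x
    using test_functions_differentiable[OF \<phi>] pd_1_deriv[OF test_functions_differentiable[OF \<phi>]]
    by (simp add: DERIV_deriv_iff_real_differentiable differentiable_on_def)
  have c: "continuous_on UNIV h" "continuous_on UNIV \<phi>" "continuous_on UNIV (pd 1 \<phi>)" "continuous_on UNIV (primitive h)"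
    using smooth_continuous test_functions_smooth h \<phi> test_functions_pd_1 primitive_continuous by blast+
  have "((\<lambda>x. primitive h x * pd 1 \<phi> x + h x * \<phi> x) has_integral
      primitive h 1 * \<phi> 1 - primitive h 0 * \<phi> 0) {0..1}"
  proof (rule fundamental_theorem_of_calculus)
    fix x :: real
    have "((\<lambda>x. primitive h x * \<phi> x) has_field_derivative primitive h x * pd 1 \<phi> x + h x * \<phi> x) (at x)"
      by (rule DERIV_cong[OF DERIV_mult[OF primitive_has_derivative[OF h] d]]) simp
    then show "((\<lambda>x. primitive h x * \<phi> x) has_vector_derivative primitive h x * pd 1 \<phi> x + h x * \<phi> x)
        (at x within {0..1})"
      unfolding has_real_derivative_iff_has_vector_derivative by (rule has_vector_derivative_at_within)
  qed simp
  moreover obtain a b where "0 < a" "b < 1" "\<And>x. x < a \<or> x > b \<Longrightarrow> \<phi> x = 0"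
    using test_function_support[OF \<phi>] by metis
  then have "\<phi> 0 = 0" "\<phi> 1 = 0" by auto
  ultimately have "integral {0..1} (\<lambda>x. primitive h x * pd 1 \<phi> x + h x * \<phi> x) = 0"
    by (simp add: integral_unique)
  then have "(\<integral>x. primitive h x * pd 1 \<phi> x + h x * \<phi> x \<partial>cube) = 0"
    by (subst cube_integral_real) (auto intro!: continuous_intros c)
  then have "ip (primitive h) (pd 1 \<phi>) + ip h \<phi> = 0"
    unfolding ip_def
    using Bochner_Integration.integral_add[OF L2_mult[OF continuous_L2[OF c(4)] continuous_L2[OF c(3)]]
        L2_mult[OF continuous_L2[OF c(1)] continuous_L2[OF c(2)]]] by argo
  then show "ip (primitive h) (pd 1 \<phi>) = - ip h \<phi>" by simp
qed (use h in \<open>auto intro: continuous_L2 primitive_continuous test_functions_L2\<close>)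

lemma primitive_1:
  assumes h: "h \<in> test_functions"
  shows "primitive h 1 = ip h (\<lambda>_. 1)"
proof -
  obtain a b where ab: "0 < a" "\<And>x. x < a \<or> x > b \<Longrightarrow> h x = 0"
    using test_function_support[OF h] by metis
  have c: "continuous_on S h" for S
    using smooth_continuous[OF test_functions_smooth[OF h]] continuous_on_subset by blast
  have "integral {-1..0} h + integral {0..1} h = integral {-1..1} h"
    by (rule Henstock_Kurzweil_Integration.integral_combine) (auto intro: integrable_continuous_interval c)
  moreover have "integral {-1..0} h = 0"
    using primitive_zero[of 0 h] ab by (simp add: primitive_def)
  ultimately show ?thesis
    using cube_integral_real[OF c] by (simp add: primitive_def ip_def)
qed

lemma primitive_bound:
  assumes h: "h \<in> test_functions" and x: "x \<in> {0..1}"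
  shows "\<bar>primitive h x\<bar> \<le> L2_norm h"
proof -
  obtain a b where ab: "0 < a" "\<And>x. x < a \<or> x > b \<Longrightarrow> h x = 0"
    using test_function_support[OF h] by metis
  have c: "continuous_on S h" for S
    using smooth_continuous[OF test_functions_smooth[OF h]] continuous_on_subset by blast
  have ca: "continuous_on S (\<lambda>x. \<bar>h x\<bar>)" for S by (intro continuous_intros c)
  have "integral {-1..0} h + integral {0..x} h = integral {-1..x} h"
    by (rule Henstock_Kurzweil_Integration.integral_combine) (use x in \<open>auto intro: integrable_continuous_interval c\<close>)
  moreover have "integral {-1..0} h = 0"
    using primitive_zero[of 0 h] ab by (simp add: primitive_def)
  ultimately have "\<bar>primitive h x\<bar> = norm (integral {0..x} h)" by (simp add: primitive_def)
  also have "\<dots> \<le> integral {0..x} (\<lambda>x. \<bar>h x\<bar>)"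
    by (rule integral_norm_bound_integral) (auto intro: integrable_continuous_interval c ca)
  also have "\<dots> \<le> integral {0..1} (\<lambda>x. \<bar>h x\<bar>)"
    by (rule integral_subset_le) (use x in \<open>auto intro: integrable_continuous_interval ca\<close>)
  also have "\<dots> = ip (\<lambda>x. \<bar>h x\<bar>) (\<lambda>_. 1)"
    using cube_integral_real[OF ca] by (simp add: ip_def)
  also have "\<dots> \<le> L2_norm (\<lambda>x. \<bar>h x\<bar>) * L2_norm (\<lambda>_::real. 1)"
    using L2_Cauchy_Schwarz[of "\<lambda>x. \<bar>h x\<bar>" "\<lambda>_. 1"] continuous_L2[OF ca] by simp
  also have "L2_norm (\<lambda>_::real. 1) = 1"
    using cube_integral_real[of "\<lambda>_. 1"] by (simp add: L2_norm_def)
  also have "L2_norm (\<lambda>x. \<bar>h x\<bar>) = L2_norm h" by (simp add: L2_norm_def)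
  finally show ?thesis by simp
qed

text \<open>To the right of the support the primitive is constant, and the constant is the mean of
  \<open>h\<close>; so mean 0 gives compact support.\<close>

lemma primitive_in_test_functions:
  assumes h: "h \<in> test_functions" and 0: "ip h (\<lambda>_. 1) = 0"
  shows "primitive h \<in> test_functions" "pd 1 (primitive h) = h"
proof -
  obtain a b where ab: "0 < a" "a < 1" "b < 1" "\<And>x. x < a \<or> x > b \<Longrightarrow> h x = 0"
    using test_function_support[OF h] by metis
  have diff: "primitive h differentiable_on UNIV"
    using primitive_has_derivative[OF h]
    by (auto simp: differentiable_on_def differentiable_def has_field_derivative_def)
  show pd: "pd 1 (primitive h) = h"
    unfolding pd_1_deriv[OF diff] using primitive_has_derivative[OF h] by (auto intro: DERIV_imp_deriv)
  have "smooth_n n (primitive h)" for n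
    using smooth_n_mono[of n] test_functions_smooth[OF h] diff
    by (cases n) (auto simp: smooth_iff pd)
  then have "smooth (primitive h)" by (simp add: smooth_iff)
  moreover have "{x. primitive h x \<noteq> 0} \<subseteq> {a..max b 0}"
  proof
    fix x assume x: "x \<in> {x. primitive h x \<noteq> 0}"
    have "a \<le> x" using x primitive_zero[of x h] ab(4) by force
    moreover have "x \<le> max b 0"
    proof (rule ccontr)
      assume nx: "\<not> x \<le> max b 0"
      \<comment> \<open>The constant is identified at the point 1, which lies beyond
        \<open>max b 0\<close>, by \<open>primitive_1\<close>.\<close>
      have "\<exists>c. \<forall>y\<in>{max b 0<..}. primitive h y = c"
      proof (rule has_field_derivative_zero_constant)
        show "(primitive h has_field_derivative 0) (at y within {max b 0<..})" if "y \<in> {max b 0<..}" for y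
          using primitive_has_derivative[OF h, of y] ab(4)[of y] that
          by (auto intro: has_field_derivative_at_within)
      qed simp
      moreover have "primitive h 1 = 0" using primitive_1[OF h] 0 by simp
      ultimately have "primitive h x = 0" using nx ab(3) by (metis greaterThan_iff less_max_iff_disj linorder_not_le max_less_iff_conj zero_less_one)
      then show False using x by simp
    qed
    ultimately show "x \<in> {a..max b 0}" by simp
  qed
  then have "closure {x. primitive h x \<noteq> 0} \<subseteq> {a..max b 0}" by (rule closure_minimal) simp
  then have "closure {x. primitive h x \<noteq> 0} \<subseteq> box 0 One" using ab by force
  ultimately show "primitive h \<in> test_functions" by (simp add: test_functions_def)
qed

text \<open>A pair \<open>(g, g')\<close> is dual to weak differentiation if \<open>g\<close> has weak derivative \<open>g'\<close> and
  vanishes at the end points; the definition avoids traces.\<close>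

definition dual_pair :: "(real \<Rightarrow> real) \<Rightarrow> (real \<Rightarrow> real) \<Rightarrow> bool" where
  "dual_pair g g' \<longleftrightarrow> g \<in> L2 \<and> g' \<in> L2 \<and> (\<forall>u u'. weak_deriv u u' \<longrightarrow> ip g u' = - ip g' u)"

text \<open>Testing the residual \<open>r\<close> with \<open>f\<close> and writing \<open>f\<close>
  as the derivative of its primitive transfers the derivative to \<open>r'\<close>; the primitive is
  bounded by the norm of \<open>f\<close>, hence the constant 1. Thus convergence of the derivatives
  of approximants forces convergence of the approximants themselves.\<close>

lemma dual_pair_Poincare:
  assumes g: "dual_pair g g'" and \<phi>: "\<phi> \<in> test_functions"
  shows "L2_norm (\<lambda>x. g x - \<phi> x) \<le> L2_norm (\<lambda>x. g' x - pd 1 \<phi> x)"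
proof -
  have gL: "g \<in> L2" "g' \<in> L2" using g by (auto simp: dual_pair_def)
  note \<phi>L = test_functions_L2[OF \<phi>] test_functions_L2[OF test_functions_pd_1[OF \<phi>]]
  define r where "r x = g x - \<phi> x" for x
  define r' where "r' x = g' x - pd 1 \<phi> x" for x
  have rL: "r \<in> L2" "r' \<in> L2" unfolding r_def[abs_def] r'_def[abs_def] using gL \<phi>L by auto
  have bound: "\<bar>ip r f\<bar> \<le> L2_norm r' * L2_norm f" if f: "f \<in> test_functions" for f
  proof -
    note wd = weak_deriv_primitive[OF f] and fL = test_functions_L2[OF f]
    have U: "primitive f \<in> L2" by (rule weak_deriv_L2[OF wd])
    have "ip r f = ip g f - ip \<phi> f" unfolding r_def[abs_def] using gL \<phi>L fL by (simp add: ip_diff_left)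
    also have "\<dots> = - ip g' (primitive f) + ip (primitive f) (pd 1 \<phi>)"
      using g wd weak_derivD[OF wd \<phi>] by (simp add: dual_pair_def ip_commute[of \<phi>])
    also have "\<dots> = - ip r' (primitive f)"
      unfolding r'_def[abs_def] using gL \<phi>L U by (simp add: ip_diff_left ip_commute[of "pd 1 \<phi>"])
    finally have "\<bar>ip r f\<bar> \<le> L2_norm r' * L2_norm (primitive f)"
      using L2_Cauchy_Schwarz[OF rL(2) U] by simp
    also have "L2_norm (primitive f) \<le> L2_norm f"
    proof -
      have "(\<integral>x. (primitive f x)\<^sup>2 \<partial>cube) \<le> (\<integral>x. (L2_norm f)\<^sup>2 \<partial>(cube :: real measure))"
        using primitive_bound[OF f]
        by (intro integral_mono L2_square[OF U] cube.integrable_const)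
          (auto simp: space_cube abs_le_square_iff[symmetric])
      also have "\<dots> = (L2_norm f)\<^sup>2" using cube_integral_real[of "\<lambda>_. (L2_norm f)\<^sup>2"] by simp
      finally show ?thesis unfolding L2_norm_def[of "primitive f"] by (simp add: real_le_lsqrt)
    qed
    finally show ?thesis by (simp add: mult_left_mono)
  qed
  \<comment> \<open>The bound holds for test functions only; letting them tend to \<open>r\<close>
    itself gives the estimate of its norm.\<close>
  obtain f where f: "\<And>n. f n \<in> test_functions" "L2_lim f r" using test_functions_dense[OF rL(1)] by metis
  have "(\<lambda>n. ip (f n) r) \<longlonglongrightarrow> ip r r" by (rule L2_lim_ip_left[OF f(2) rL(1)])
  moreover have "(\<lambda>n. L2_norm r' * L2_norm (f n)) \<longlonglongrightarrow> L2_norm r' * L2_norm r"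
    unfolding L2_norm_ip[of "f _"] L2_norm_ip[of r]
    by (intro tendsto_intros L2_lim_ip f(2))
  moreover have "ip (f n) r \<le> L2_norm r' * L2_norm (f n)" for n
    using abs_le_D1[OF bound[OF f(1)[of n]]] by (subst ip_commute)
  ultimately have "ip r r \<le> L2_norm r' * L2_norm r"
    by (intro LIMSEQ_le[of "\<lambda>n. ip (f n) r" _ "\<lambda>n. L2_norm r' * L2_norm (f n)"]) auto
  then have "L2_norm r * L2_norm r \<le> L2_norm r' * L2_norm r"
    using L2_norm_square[of r] by (simp add: power2_eq_square)
  then have "L2_norm r \<le> L2_norm r'"
    using L2_norm_nonneg[of r'] L2_norm_nonneg[of r]
    by (cases "L2_norm r = 0") (simp_all add: mult_le_cancel_right)
  then show ?thesis unfolding r_def[abs_def] r'_def[abs_def] .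
qed

text \<open>The function used below to correct means. The constant 1 is not null, hence not
  orthogonal to all test functions, and one with nonzero mean can be rescaled.\<close>

lemma test_function_integral_1: "\<exists>\<eta>\<in>test_functions. ip \<eta> (\<lambda>_::real. 1) = 1"
proof -
  have "L2_norm (\<lambda>_::real. 1) = 1"
    using cube_integral_real[of "\<lambda>_. 1"] by (simp add: L2_norm_def)
  then have "\<not> L2_eq (\<lambda>_::real. 1) (\<lambda>_. 0)" using L2_norm_eq_0[of "\<lambda>_::real. 1"] by simp
  then obtain \<phi> where \<phi>: "\<phi> \<in> test_functions" "ip (\<lambda>_::real. 1) \<phi> \<noteq> 0"
    using L2_eq_0_if_orthogonal_to_tests[of "\<lambda>_::real. 1"] by auto
  have "(\<lambda>x. 0 + (1 / ip (\<lambda>_. 1) \<phi>) * \<phi> x) \<in> test_functions"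
    by (rule L2_subspace_lincomb[OF L2_subspace_test_functions])
      (use \<phi> L2_subspace_test_functions in \<open>auto simp: L2_subspace_def\<close>)
  moreover have "ip (\<lambda>x. 0 + (1 / ip (\<lambda>_. 1) \<phi>) * \<phi> x) (\<lambda>_. 1) = 1"
    unfolding add_0 ip_scale_left using \<phi>(2) by (simp add: ip_commute[of \<phi>])
  ultimately show ?thesis by blast
qed

lemma test_functions_funpow: "\<phi> \<in> test_functions \<Longrightarrow> (pd (1::real) ^^ c) \<phi> \<in> test_functions"
  by (induction c) (simp_all add: test_functions_pd_1)

lemma funpow_pd_lincomb:
  assumes "\<phi> \<in> test_functions" "\<psi> \<in> test_functions"
  shows "(pd 1 ^^ c) (\<lambda>x::real. \<phi> x + t * \<psi> x) = (\<lambda>x. (pd 1 ^^ c) \<phi> x + t * (pd 1 ^^ c) \<psi> x)"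
proof (induction c)
  case (Suc c)
  note d = assms[THEN test_functions_funpow[of _ c], THEN test_functions_differentiable]
  have "pd 1 (\<lambda>x. t * (pd 1 ^^ c) \<psi> x) = (\<lambda>x. t * pd 1 ((pd 1 ^^ c) \<psi>) x)"
    using pd_mult[OF _ d(2), of "\<lambda>_. t"] by (simp add: pd_const)
  moreover have "(\<lambda>x. t * (pd 1 ^^ c) \<psi> x) differentiable_on UNIV"
    by (intro differentiable_on_mult differentiable_on_const d(2))
  ultimately show ?case by (simp add: Suc.IH pd_add[OF d(1)])
qed simp

lemma L2_lim_add_const:
  assumes F: "L2_lim F f" and c: "c \<longlonglongrightarrow> 0" and h: "h \<in> L2"
  shows "L2_lim (\<lambda>n x. F n x + c n * h x) f"
proof (rule L2_limI)
  note FL = L2_lim_L2[OF F]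
  show "(\<lambda>x. F n x + c n * h x) \<in> L2" for n using FL h by auto
  have "(\<lambda>n. L2_norm (\<lambda>x. F n x - f x) + \<bar>c n\<bar> * L2_norm h) \<longlonglongrightarrow> 0 + \<bar>0\<bar> * L2_norm h"
    using F c by (intro tendsto_intros) (auto simp: L2_lim_def)
  then show "(\<lambda>n. L2_norm (\<lambda>x. F n x - f x) + \<bar>c n\<bar> * L2_norm h) \<longlonglongrightarrow> 0" by simp
  show "L2_norm (\<lambda>x. F n x + c n * h x - f x) \<le> L2_norm (\<lambda>x. F n x - f x) + \<bar>c n\<bar> * L2_norm h" for n
    using L2_triangle[of "\<lambda>x. F n x - f x" "\<lambda>x. c n * h x"] FL h
    by (simp add: L2_norm_scale algebra_simps)
qed (use L2_lim_L2[OF F] in auto)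

text \<open>Test with the constant 1, whose weak derivative is 0. This is the compatibility
  condition for integrating back to a function vanishing at both ends.\<close>

lemma dual_pair_mean_0:
  assumes "dual_pair g g'"
  shows "ip g' (\<lambda>_. 1) = 0"
proof -
  have "weak_deriv (\<lambda>_. 1) (\<lambda>_. 0)"
    unfolding weak_deriv_iff
  proof (intro conjI ballI)
    fix \<phi> :: "real \<Rightarrow> real" assume \<phi>: "\<phi> \<in> test_functions"
    note p = test_functions_pd_1[OF \<phi>]
    obtain a b where ab: "0 < a" "b < 1" "\<And>x. x < a \<or> x > b \<Longrightarrow> \<phi> x = 0"
      using test_function_support[OF \<phi>] by metis
    have d: "(\<phi> has_field_derivative pd 1 \<phi> x) (at x)" for x
      using test_functions_differentiable[OF \<phi>] pd_1_deriv[OF test_functions_differentiable[OF \<phi>]]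
      by (simp add: DERIV_deriv_iff_real_differentiable differentiable_on_def)
    have "(pd 1 \<phi> has_integral \<phi> 1 - \<phi> 0) {0..1}"
      by (rule fundamental_theorem_of_calculus)
        (auto intro: has_field_derivative_at_within[OF d]
          simp: has_real_derivative_iff_has_vector_derivative[symmetric])
    then have "integral {0..1} (pd 1 \<phi>) = 0" using ab by (simp add: integral_unique)
    then show "ip (\<lambda>_. 1) (pd 1 \<phi>) = - ip (\<lambda>_. 0) \<phi>"
      using cube_integral_real[OF smooth_continuous[OF test_functions_smooth[OF p]]] by (simp add: ip_def)
  qed auto
  then have "ip g (\<lambda>_. 0) = - ip g' (\<lambda>_. 1)" using assms unfolding dual_pair_def by blast
  then show ?thesis by simp
qed

text \<open>Subtracting from \<open>h n\<close> a multiple of a fixed test function makes its mean vanish, so that its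
  primitive is again a test function.\<close>

lemma dual_pair_approx:
  assumes g: "dual_pair g g'" and h: "\<And>n. h n \<in> test_functions"
    and lim: "\<And>c. c \<le> w \<Longrightarrow> L2_lim (\<lambda>n. (pd 1 ^^ c) (h n)) (G c)" and G0: "G 0 = g'"
  obtains \<phi> where "\<And>n. \<phi> n \<in> test_functions" "L2_lim \<phi> g"
    "\<And>c. c \<le> w \<Longrightarrow> L2_lim (\<lambda>n. (pd 1 ^^ Suc c) (\<phi> n)) (G c)"
proof -
  obtain \<eta> :: "real \<Rightarrow> real" where \<eta>: "\<eta> \<in> test_functions" "ip \<eta> (\<lambda>_. 1) = 1"
    using test_function_integral_1 by blast
  have gL: "g \<in> L2" "g' \<in> L2" using g by (auto simp: dual_pair_def)
  define t where "t n = - ip (h n) (\<lambda>_. 1)" for n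
  define k where "k n x = h n x + t n * \<eta> x" for n x
  have kT: "k n \<in> test_functions" for n
    unfolding k_def[abs_def] by (rule test_functions_lincomb[OF h \<eta>(1)])
  have k0: "ip (k n) (\<lambda>_. 1) = 0" for n
  proof -
    have "ip (k n) (\<lambda>_. 1) = ip (h n) (\<lambda>_. 1) + t n * ip \<eta> (\<lambda>_. 1)"
      unfolding k_def[abs_def] using test_functions_L2[OF h] test_functions_L2[OF \<eta>(1)]
      by (subst ip_add_left) (auto simp: ip_scale_left)
    then show ?thesis by (simp add: \<eta>(2) t_def)
  qed
  \<comment> \<open>As \<open>g'\<close> has mean 0, the correction factors tend to 0, so they
    disturb none of the limits, whatever the order of the derivative.\<close>
  have "(\<lambda>n. - ip (h n) (\<lambda>_. 1)) \<longlonglongrightarrow> - ip g' (\<lambda>_. 1)"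
    using lim[of 0] G0 by (intro tendsto_minus L2_lim_ip_left) auto
  then have t: "t \<longlonglongrightarrow> 0" unfolding t_def[abs_def] dual_pair_mean_0[OF g] by simp
  have klim: "L2_lim (\<lambda>n. (pd 1 ^^ c) (k n)) (G c)" if "c \<le> w" for c
    unfolding k_def[abs_def] funpow_pd_lincomb[OF h \<eta>(1)]
    by (rule L2_lim_add_const[OF lim[OF that] t test_functions_L2[OF test_functions_funpow[OF \<eta>(1)]]])
  note prim = primitive_in_test_functions[OF kT k0]
  show ?thesis
  proof (rule that[of "\<lambda>n. primitive (k n)"])
    show "primitive (k n) \<in> test_functions" for n by (rule prim(1))
    show "L2_lim (\<lambda>n. (pd 1 ^^ Suc c) (primitive (k n))) (G c)" if "c \<le> w" for c
      using klim[OF that] by (simp add: funpow_Suc_right prim(2) del: funpow.simps)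
    have "L2_norm (\<lambda>x. primitive (k n) x - g x) \<le> L2_norm (\<lambda>x. k n x - g' x)" for n
      using dual_pair_Poincare[OF g prim(1)[of n]]
      by (simp add: prim(2) L2_norm_minus_commute[of g] L2_norm_minus_commute[of g'])
    then show "L2_lim (\<lambda>n. primitive (k n)) g"
      using klim[of 0] G0 by (intro L2_limI[OF test_functions_L2[OF prim(1)] gL(1)]) (auto simp: L2_lim_def)
  qed
qed

subsection \<open>Dual systems\<close>

text \<open>Finite rank representation of the three operators \<open>\<pi>\<close> of weight \<open>w = i + j\<close>: the operator
  of weight \<open>w\<close> is \<open>f \<mapsto> \<Sum>a. \<langle>g w a, f\<rangle> e w a\<close>. Weak differentiation acts on the \<open>e w a\<close> through
  the matrix \<open>M w\<close>, and the commutation with the operators dualises this to the \<open>g w a\<close>.\<close>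

definition dual_system ::
    "(nat \<Rightarrow> nat) \<Rightarrow> (nat \<Rightarrow> nat \<Rightarrow> real \<Rightarrow> real) \<Rightarrow> (nat \<Rightarrow> nat \<Rightarrow> real \<Rightarrow> real) \<Rightarrow>
     (nat \<Rightarrow> nat \<Rightarrow> nat \<Rightarrow> real) \<Rightarrow> bool" where
  "dual_system N e g M \<longleftrightarrow>
     (\<forall>w\<le>2. \<forall>a<N w. e w a \<in> L2 \<and> g w a \<in> L2) \<and>
     (\<forall>w<2. \<forall>a<N w. weak_deriv (e w a) (\<lambda>x. \<Sum>b<N (Suc w). M w b a * e (Suc w) b x)) \<and>
     (\<forall>w<2. \<forall>b<N (Suc w). dual_pair (g (Suc w) b) (\<lambda>x. - (\<Sum>a<N w. M w b a * g w a x)))"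

definition fin_rank :: "nat \<Rightarrow> (nat \<Rightarrow> real \<Rightarrow> real) \<Rightarrow> (nat \<Rightarrow> real \<Rightarrow> real) \<Rightarrow> (real \<Rightarrow> real) \<Rightarrow> real \<Rightarrow> real" where
  "fin_rank N e g f x = (\<Sum>a<N. ip (g a) f * e a x)"

text \<open>Each coefficient of \<open>p f\<close> in the orthonormal basis is a bounded functional
  of \<open>f\<close>, represented by \<open>g a\<close> through the Riesz theorem.\<close>

lemma bounded_linear_fin_rank:
  assumes p: "L2_bounded_linear p" "\<And>f. f \<in> L2 \<Longrightarrow> p f \<in> S"
    and e: "orthonormal N e" "\<And>f. f \<in> S \<Longrightarrow> L2_eq f (\<lambda>x. \<Sum>i<N. ip f (e i) * e i x)"
  obtains g where "\<And>a. a < N \<Longrightarrow> g a \<in> L2" "\<And>a f. a < N \<Longrightarrow> f \<in> L2 \<Longrightarrow> ip (p f) (e a) = ip (g a) f"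
    "\<And>f. f \<in> L2 \<Longrightarrow> L2_eq (p f) (fin_rank N e g f)"
proof -
  have pL: "f \<in> L2 \<Longrightarrow> p f \<in> L2" for f using p(1) by (simp add: L2_bounded_linear_def)
  have eL: "e i \<in> L2" if "i < N" for i using e(1) that by (simp add: orthonormal_def)
  have "\<exists>g\<in>L2. \<forall>f\<in>L2. ip (p f) (e a) = ip g f" if a: "a < N" for a
  proof -
    obtain C where C: "\<And>f. f \<in> L2 \<Longrightarrow> L2_norm (p f) \<le> C * L2_norm f"
      using p(1) unfolding L2_bounded_linear_def by blast
    obtain g where "g \<in> L2" "\<And>f. f \<in> L2 \<Longrightarrow> ip (p f) (e a) = ip g f"
    proof (rule L2_Riesz[of "\<lambda>f. ip (p f) (e a)" "C * L2_norm (e a)"])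
      fix f g :: "real \<Rightarrow> real" assume fg: "f \<in> L2" "g \<in> L2"
      have "L2_eq (p (\<lambda>x. f x + g x)) (\<lambda>x. p f x + p g x)"
        using p(1) fg by (simp add: L2_bounded_linear_def)
      then have "ip (p (\<lambda>x. f x + g x)) (e a) = ip (\<lambda>x. p f x + p g x) (e a)"
        by (rule ip_cong) (auto intro: pL fg eL a)
      then show "ip (p (\<lambda>x. f x + g x)) (e a) = ip (p f) (e a) + ip (p g) (e a)"
        by (simp add: ip_add_left pL fg eL a)
    next
      fix f :: "real \<Rightarrow> real" and c assume f: "f \<in> L2"
      have "L2_eq (p (\<lambda>x. c * f x)) (\<lambda>x. c * p f x)"
        using p(1) f by (simp add: L2_bounded_linear_def)
      then have "ip (p (\<lambda>x. c * f x)) (e a) = ip (\<lambda>x. c * p f x) (e a)"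
        by (rule ip_cong) (auto intro: pL f eL a)
      then show "ip (p (\<lambda>x. c * f x)) (e a) = c * ip (p f) (e a)"
        by (simp add: ip_scale_left)
    next
      fix f :: "real \<Rightarrow> real" assume f: "f \<in> L2"
      have "\<bar>ip (p f) (e a)\<bar> \<le> L2_norm (p f) * L2_norm (e a)"
        by (rule L2_Cauchy_Schwarz[OF pL[OF f] eL[OF a]])
      also have "\<dots> \<le> C * L2_norm f * L2_norm (e a)" by (rule mult_right_mono[OF C[OF f]]) simp
      finally show "\<bar>ip (p f) (e a)\<bar> \<le> C * L2_norm (e a) * L2_norm f" by (simp add: mult_ac)
    qed blast
    then show ?thesis by blast
  qed
  then obtain g where g: "\<And>a. a < N \<Longrightarrow> g a \<in> L2" "\<And>a f. a < N \<Longrightarrow> f \<in> L2 \<Longrightarrow> ip (p f) (e a) = ip (g a) f"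
    by metis
  have "L2_eq (p f) (fin_rank N e g f)" if f: "f \<in> L2" for f
    using e(2)[OF p(2)[OF f]] g(2) f by (simp add: fin_rank_def[abs_def])
  then show ?thesis using that g by blast
qed

text \<open>The relation between operators and differentiation is read off coefficientwise: the
  \<open>b\<close>-th coefficient of the operator of weight \<open>Suc w\<close> at
  \<open>u'\<close> equals a combination, with matrix \<open>M w\<close>, of the coefficients of the
  operator of weight \<open>w\<close> at \<open>u\<close>. That is an integration by parts formula
  for \<open>g (Suc w) b\<close>.\<close>

lemma quasi_interp_dual_system:
  assumes qi: "quasi_interp_1d S p"
  shows "\<exists>N e g M. dual_system N e g M \<and> (\<forall>i\<in>{0,1}. \<forall>j\<in>{0,1}. \<forall>f\<in>L2.
    L2_eq (p i j f) (fin_rank (N (i + j)) (e (i + j)) (g (i + j)) f))"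
proof -
  \<comment> \<open>One operator per weight; for weight 1 the representative \<open>p 0 1\<close> is
    taken, which agrees with \<open>p 1 0\<close> almost everywhere.\<close>
  define q where "q w = (if w = 0 then p 0 0 else if w = 1 then p 0 1 else p 1 1)" for w :: nat
  have fd: "L2_fin_dim_subspace (S w)" if "w \<le> 2" for w
    using qi that unfolding quasi_interp_1d_def by (cases w; cases "w - 1") (auto simp: numeral_2_eq_2)
  have sd: "\<exists>h\<in>S (Suc w). weak_deriv f h" if "w < 2" "f \<in> S w" for w f
  proof -
    have "w \<in> {0,1}" using that by auto
    then show ?thesis using qi that unfolding quasi_interp_1d_def by (metis Suc_eq_plus1)
  qed
  have pb: "L2_bounded_linear (p i j)" "\<And>f. f \<in> L2 \<Longrightarrow> p i j f \<in> S (i + j)" if "i \<in> {0,1}" "j \<in> {0,1}" for i j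
    using qi that unfolding quasi_interp_1d_def by blast+
  have pd: "weak_deriv (p 0 j u) (p 1 j u')" if "j \<in> {0,1}" "weak_deriv u u'" for j u u'
    using qi that unfolding quasi_interp_1d_def by blast
  have p01: "L2_eq (p 0 1 f) (p 1 0 f)" if "f \<in> L2" for f
    using qi that unfolding quasi_interp_1d_def by blast
  have pq: "L2_eq (p i j f) (q (i + j) f)" if "i \<in> {0,1}" "j \<in> {0,1}" "f \<in> L2" for i j f
    using that L2_eq_sym[OF p01] by (auto simp: q_def)
  have pL: "p i j f \<in> L2" if "i \<in> {0,1}" "j \<in> {0,1}" "f \<in> L2" for i j f
    using pb(1)[OF that(1,2)] that(3) by (simp add: L2_bounded_linear_def)
  have qb: "L2_bounded_linear (q w)" "\<And>f. f \<in> L2 \<Longrightarrow> q w f \<in> S w" if "w \<le> 2" for w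
  proof -
    have "w = 0 \<or> w = 1 \<or> w = 2" using that by arith
    then consider "w = 0" | "w = 1" | "w = 2" by blast
    then show "L2_bounded_linear (q w)" "\<And>f. f \<in> L2 \<Longrightarrow> q w f \<in> S w"
      using pb[of 0 0] pb[of 0 1] pb[of 1 1] by (cases; simp add: q_def numeral_2_eq_2)+
  qed
  have qd: "weak_deriv (q w u) (q (Suc w) u')" if "w < 2" and u: "weak_deriv u u'" for w u u'
  proof -
    note uL = weak_deriv_L2[OF u]
    have "w = 0 \<or> w = 1" using that by arith
    then consider "w = 0" | "w = 1" by blast
    then show ?thesis
    proof cases
      case 1
      have "weak_deriv (p 0 0 u) (p 0 1 u')"
        by (rule weak_deriv_cong[OF pd[of 0, OF _ u] L2_eq_refl L2_eq_sym[OF p01[OF uL(2)]]])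
          (auto intro!: pL uL)
      then show ?thesis using 1 by (simp add: q_def)
    next
      case 2
      then show ?thesis using pd[OF _ u, of 1] by (simp add: q_def)
    qed
  qed
  define B where "B w N e \<longleftrightarrow> orthonormal N e \<and> (\<forall>i<N. e i \<in> S w) \<and>
      (\<forall>f\<in>S w. L2_eq f (\<lambda>x. \<Sum>i<N. ip f (e i) * e i x))" for w N e
  have "\<forall>w. \<exists>N e. w \<le> 2 \<longrightarrow> B w N e"
    unfolding B_def using fin_dim_orthonormal_basis[OF fd] by blast
  then obtain N e where "\<And>w. w \<le> 2 \<Longrightarrow> B w (N w) (e w)" by metis
  then have e: "\<And>w. w \<le> 2 \<Longrightarrow> orthonormal (N w) (e w)"
    "\<And>w i. w \<le> 2 \<Longrightarrow> i < N w \<Longrightarrow> e w i \<in> S w"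
    "\<And>w f. w \<le> 2 \<Longrightarrow> f \<in> S w \<Longrightarrow> L2_eq f (\<lambda>x. \<Sum>i<N w. ip f (e w i) * e w i x)"
    unfolding B_def by blast+
  define R where "R w g \<longleftrightarrow> (\<forall>a<N w. g a \<in> L2) \<and> (\<forall>a<N w. \<forall>f\<in>L2. ip (q w f) (e w a) = ip (g a) f) \<and>
      (\<forall>f\<in>L2. L2_eq (q w f) (fin_rank (N w) (e w) g f))" for w g
  have "\<exists>g. R w g" if w: "w \<le> 2" for w
  proof -
    from bounded_linear_fin_rank[OF qb(1)[OF w] qb(2)[OF w] e(1)[OF w] e(3)[OF w]]
    obtain g where "\<And>a. a < N w \<Longrightarrow> g a \<in> L2" "\<And>a f. a < N w \<Longrightarrow> f \<in> L2 \<Longrightarrow> ip (q w f) (e w a) = ip (g a) f"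
      "\<And>f. f \<in> L2 \<Longrightarrow> L2_eq (q w f) (fin_rank (N w) (e w) g f)" by blast
    then have "R w g" unfolding R_def by blast
    then show ?thesis by blast
  qed
  then obtain g where "\<And>w. w \<le> 2 \<Longrightarrow> R w (g w)" by metis
  then have g: "\<And>w a. w \<le> 2 \<Longrightarrow> a < N w \<Longrightarrow> g w a \<in> L2"
    "\<And>w a f. w \<le> 2 \<Longrightarrow> a < N w \<Longrightarrow> f \<in> L2 \<Longrightarrow> ip (q w f) (e w a) = ip (g w a) f"
    "\<And>w f. w \<le> 2 \<Longrightarrow> f \<in> L2 \<Longrightarrow> L2_eq (q w f) (fin_rank (N w) (e w) (g w) f)"
    unfolding R_def by blast+
  have "\<exists>h. h \<in> S (Suc w) \<and> weak_deriv (e w a) h" if "w < 2" "a < N w" for w a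
    using sd[OF that(1) e(2)[OF less_imp_le[OF that(1)] that(2)]] by blast
  then obtain d where d: "\<And>w a. w < 2 \<Longrightarrow> a < N w \<Longrightarrow> d w a \<in> S (Suc w)"
    "\<And>w a. w < 2 \<Longrightarrow> a < N w \<Longrightarrow> weak_deriv (e w a) (d w a)" by metis
  \<comment> \<open>The matrix of weak differentiation from the basis of \<open>S w\<close> to that
    of \<open>S (Suc w)\<close>.\<close>
  define M where "M w b a = ip (d w a) (e (Suc w) b)" for w b a
  have eL: "e w a \<in> L2" if "w \<le> 2" "a < N w" for w a
    using e(1)[OF that(1)] that(2) by (simp add: orthonormal_def)
  have e': "weak_deriv (e w a) (\<lambda>x. \<Sum>b<N (Suc w). M w b a * e (Suc w) b x)" if w: "w < 2" "a < N w" for w a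
    by (rule weak_deriv_cong[OF d(2)[OF w] L2_eq_refl])
      (use w d e(3)[of "Suc w" "d w a"] in \<open>auto simp: M_def intro!: eL L2_sum L2_scale\<close>)
  have g': "dual_pair (g (Suc w) b) (\<lambda>x. - (\<Sum>a<N w. M w b a * g w a x))"
    if w: "w < 2" "b < N (Suc w)" for w b
    unfolding dual_pair_def
  proof (intro conjI allI impI)
    show "g (Suc w) b \<in> L2" using g(1) w by simp
    have "(\<lambda>x. -1 * (\<Sum>a<N w. M w b a * g w a x)) \<in> L2"
      by (intro L2_scale L2_sum) (use g(1) w in auto)
    then show "(\<lambda>x. - (\<Sum>a<N w. M w b a * g w a x)) \<in> L2" by simp
    fix u u' :: "real \<Rightarrow> real" assume u: "weak_deriv u u'"
    note uL = weak_deriv_L2[OF u]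
    have eq: "L2_eq (q w u) (\<lambda>x. \<Sum>a<N w. ip (g w a) u * e w a x)"
      using g(3)[of w u] w uL by (simp add: fin_rank_def[abs_def])
    have qL: "q w f \<in> L2" if "f \<in> L2" "w \<le> 2" for f w
      using qb(1)[OF that(2)] that(1) by (simp add: L2_bounded_linear_def)
    define D where "D a x = (\<Sum>b<N (Suc w). M w b a * e (Suc w) b x)" for a x
    have DL: "D a \<in> L2" for a unfolding D_def[abs_def] by (intro L2_sum L2_scale eL) (use w in auto)
    have "weak_deriv (\<lambda>x. \<Sum>a<N w. ip (g w a) u * e w a x) (\<lambda>x. \<Sum>a<N w. ip (g w a) u * D a x)"
      by (rule weak_deriv_sum) (use e'[OF w(1)] in \<open>auto simp: D_def[abs_def]\<close>)
    \<comment> \<open>The image of \<open>u\<close> now has two weak derivatives, this one and the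
      operator of weight \<open>Suc w\<close> at \<open>u'\<close>; uniqueness equates them.\<close>
    then have "weak_deriv (q w u) (\<lambda>x. \<Sum>a<N w. ip (g w a) u * D a x)"
      by (rule weak_deriv_cong[OF _ L2_eq_sym[OF eq] L2_eq_refl])
        (use w uL qL DL in auto)
    with qd[OF w(1) u] have eq': "L2_eq (q (Suc w) u') (\<lambda>x. \<Sum>a<N w. ip (g w a) u * D a x)"
      by (rule weak_deriv_unique)
    have eb: "e (Suc w) b \<in> L2" using eL w by simp
    have Db: "ip (D a) (e (Suc w) b) = M w b a" for a
      unfolding D_def[abs_def] by (rule orthonormal_coefficients[OF e(1)]) (use w in auto)
    have "ip (g (Suc w) b) u' = ip (q (Suc w) u') (e (Suc w) b)" using g(2) w uL by simp
    also have "\<dots> = ip (\<lambda>x. \<Sum>a<N w. ip (g w a) u * D a x) (e (Suc w) b)"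
      by (rule ip_cong[OF eq']) (use w uL qL DL eb in auto)
    also have "\<dots> = (\<Sum>a<N w. ip (g w a) u * M w b a)"
      using DL eb by (subst ip_sum_left) (auto simp: ip_scale_left Db)
    also have "\<dots> = ip (\<lambda>x. \<Sum>a<N w. M w b a * g w a x) u"
      using g(1) w uL by (subst ip_sum_left) (auto simp: ip_scale_left mult.commute)
    also have "\<dots> = - ip (\<lambda>x. -1 * (\<Sum>a<N w. M w b a * g w a x)) u"
      unfolding ip_scale_left by simp
    finally show "ip (g (Suc w) b) u' = - ip (\<lambda>x. - (\<Sum>a<N w. M w b a * g w a x)) u" by simp
  qed
  have "dual_system N e g M"
    unfolding dual_system_def using eL g(1) e' g' by blast
  moreover have "L2_eq (p i j f) (fin_rank (N (i + j)) (e (i + j)) (g (i + j)) f)"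
    if "i \<in> {0,1}" "j \<in> {0,1}" "f \<in> L2" for i j f
    using L2_eq_trans[OF pq[OF that] g(3)] that by auto
  ultimately show ?thesis by blast
qed

text \<open>The \<open>c\<close>-th derivative of \<open>g w b\<close>, for \<open>c \<le> w\<close>.\<close>

fun gder :: "(nat \<Rightarrow> nat) \<Rightarrow> (nat \<Rightarrow> nat \<Rightarrow> nat \<Rightarrow> real) \<Rightarrow> (nat \<Rightarrow> nat \<Rightarrow> real \<Rightarrow> real) \<Rightarrow>
    nat \<Rightarrow> nat \<Rightarrow> nat \<Rightarrow> real \<Rightarrow> real" where
  "gder N M g w 0 b = g w b"
| "gder N M g 0 (Suc c) b = (\<lambda>_. 0)"
| "gder N M g (Suc w) (Suc c) b = (\<lambda>x. - (\<Sum>a<N w. M w b a * gder N M g w c a x))"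

lemma L2_lim_sum:
  assumes "finite I" "\<And>i. i \<in> I \<Longrightarrow> L2_lim (F i) (f i)"
  shows "L2_lim (\<lambda>n x. \<Sum>i\<in>I. c i * F i n x) (\<lambda>x. \<Sum>i\<in>I. c i * f i x)"
  using assms
proof (induction I rule: finite_induct)
  case empty
  show ?case by (simp add: L2_lim_const)
next
  case (insert i I)
  have "L2_lim (\<lambda>n x. (\<Sum>i\<in>I. c i * F i n x) + c i * F i n x) (\<lambda>x. (\<Sum>i\<in>I. c i * f i x) + c i * f i x)"
    by (rule L2_lim_lincomb) (use insert in auto)
  then show ?case using insert(1,2) by (simp add: add.commute)
qed

lemma funpow_pd_sum:
  assumes "finite I" "\<And>i. i \<in> I \<Longrightarrow> \<phi> i \<in> test_functions"
  shows "(pd 1 ^^ c) (\<lambda>x::real. \<Sum>i\<in>I. t i * \<phi> i x) = (\<lambda>x. \<Sum>i\<in>I. t i * (pd 1 ^^ c) (\<phi> i) x)"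
    and "(\<lambda>x. \<Sum>i\<in>I. t i * \<phi> i x) \<in> test_functions"
proof -
  have "(pd 1 ^^ c) (\<lambda>x::real. \<Sum>i\<in>I. t i * \<phi> i x) = (\<lambda>x. \<Sum>i\<in>I. t i * (pd 1 ^^ c) (\<phi> i) x) \<and>
     (\<lambda>x. \<Sum>i\<in>I. t i * \<phi> i x) \<in> test_functions"
    using assms
  proof (induction I rule: finite_induct)
    case empty
    have "(pd 1 ^^ c) (\<lambda>x::real. 0) = (\<lambda>_. 0)" by (induction c) (simp_all add: pd_const)
    then show ?case using L2_subspace_test_functions[where 'a = real] by (simp add: L2_subspace_def)
  next
    case (insert i I)
    then have "(\<lambda>x. \<Sum>i\<in>I. t i * \<phi> i x) \<in> test_functions" "\<phi> i \<in> test_functions" by auto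
    note lc = funpow_pd_lincomb[OF this, of c "t i"] test_functions_lincomb[OF this, of "t i"]
    then show ?case using insert by (simp add: add.commute[of "t i * _"])
  qed
  then show "(pd 1 ^^ c) (\<lambda>x::real. \<Sum>i\<in>I. t i * \<phi> i x) = (\<lambda>x. \<Sum>i\<in>I. t i * (pd 1 ^^ c) (\<phi> i) x)"
    "(\<lambda>x. \<Sum>i\<in>I. t i * \<phi> i x) \<in> test_functions" by auto
qed

text \<open>Induction on the weight. At weight 0 density suffices; at weight \<open>Suc w\<close>
  the approximants are primitives, with corrected mean, of the combination of approximants of weight
  \<open>w\<close> prescribed by \<open>M\<close>, so one sequence converges in all orders up to the
  weight.\<close>

lemma dual_system_approx:
  assumes ds: "dual_system N e g M" and "w \<le> 2" "b < N w"
  shows "\<exists>\<eta>. (\<forall>n. \<eta> n \<in> test_functions) \<and> (\<forall>c\<le>w. L2_lim (\<lambda>n. (pd 1 ^^ c) (\<eta> n)) (gder N M g w c b))"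
  using assms(2,3)
proof (induction w arbitrary: b)
  case 0
  then have "g 0 b \<in> L2" using ds by (simp add: dual_system_def)
  then obtain \<phi> where "\<And>n. \<phi> n \<in> test_functions" "L2_lim \<phi> (g 0 b)" using test_functions_dense by metis
  then show ?case by (intro exI[of _ \<phi>]) simp
next
  case (Suc w)
  then have "\<forall>a. \<exists>\<eta>. a < N w \<longrightarrow> (\<forall>n. \<eta> n \<in> test_functions) \<and>
      (\<forall>c\<le>w. L2_lim (\<lambda>n. (pd 1 ^^ c) (\<eta> n)) (gder N M g w c a))" by auto
  then obtain \<eta> where \<eta>: "\<And>a n. a < N w \<Longrightarrow> \<eta> a n \<in> test_functions"
    "\<And>a c. a < N w \<Longrightarrow> c \<le> w \<Longrightarrow> L2_lim (\<lambda>n. (pd 1 ^^ c) (\<eta> a n)) (gder N M g w c a)" by metis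
  define h where "h n x = (\<Sum>a<N w. (- M w b a) * \<eta> a n x)" for n x
  have hT: "h n \<in> test_functions" for n
    unfolding h_def[abs_def] by (rule funpow_pd_sum(2)) (use \<eta>(1) in auto)
  have neg: "gder N M g (Suc w) (Suc c) b = (\<lambda>x. \<Sum>a<N w. (- M w b a) * gder N M g w c a x)" for c
    by (simp add: sum_negf)
  have hlim: "L2_lim (\<lambda>n. (pd 1 ^^ c) (h n)) (gder N M g (Suc w) (Suc c) b)" if "c \<le> w" for c
  proof -
    have "(pd 1 ^^ c) (h n) = (\<lambda>x. \<Sum>a<N w. (- M w b a) * (pd 1 ^^ c) (\<eta> a n) x)" for n
      unfolding h_def[abs_def] by (rule funpow_pd_sum(1)) (use \<eta>(1) in auto)
    then show ?thesis unfolding neg by (simp only:) (rule L2_lim_sum, use \<eta>(2) that in auto)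
  qed
  have dp: "dual_pair (gder N M g (Suc w) 0 b) (gder N M g (Suc w) (Suc 0) b)"
    using ds Suc.prems by (simp add: dual_system_def)
  obtain \<phi> where \<phi>: "\<And>n. \<phi> n \<in> test_functions" "L2_lim \<phi> (gder N M g (Suc w) 0 b)"
    "\<And>c. c \<le> w \<Longrightarrow> L2_lim (\<lambda>n. (pd 1 ^^ Suc c) (\<phi> n)) (gder N M g (Suc w) (Suc c) b)"
    using dual_pair_approx[OF dp hT hlim, of w] by blast
  have "L2_lim (\<lambda>n. (pd 1 ^^ c) (\<phi> n)) (gder N M g (Suc w) c b)" if "c \<le> Suc w" for c
    using \<phi>(2,3) that by (cases c) auto
  then show ?case using \<phi>(1) by blast
qed

section \<open>Products of one-dimensional functions\<close>

definition prodf :: "('n::finite \<Rightarrow> real \<Rightarrow> real) \<Rightarrow> real^'n \<Rightarrow> real" where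
  "prodf f x = (\<Prod>m\<in>UNIV. f m (x $ m))"

abbreviation "PiR \<equiv> Pi\<^sub>M (UNIV :: 'n::finite set) (\<lambda>_. lborel :: real measure)"

interpretation PiR: product_sigma_finite "\<lambda>_::'n::finite. lborel :: real measure"
  by standard

lemma Basis_cart: "(Basis :: (real^'n::finite) set) = range (\<lambda>i. axis i 1)"
  by (auto simp: Basis_vec_def)

lemma prod_Basis_cart: "(\<Prod>b\<in>(Basis :: (real^'n::finite) set). f b) = (\<Prod>i\<in>UNIV. f (axis i 1))"
  unfolding Basis_cart by (subst prod.reindex) (auto simp: inj_on_def axis_eq_axis)

lemma One_nth: "(One :: real^'n::finite) $ i = 1"
proof -
  have "(One :: real^'n) \<bullet> b = 1" if "b \<in> Basis" for b :: "real^'n" using that by simp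
  from this[of "axis i 1"] show ?thesis by (simp add: inner_axis Basis_cart del: sum_component)
qed

lemma mem_cube_cart:
  "(x :: real^'n::finite) \<in> cbox 0 One \<longleftrightarrow> (\<forall>i. x $ i \<in> {0..1})"
  "(x :: real^'n::finite) \<in> box 0 One \<longleftrightarrow> (\<forall>i. x $ i \<in> {0<..<1})"
  by (auto simp: mem_box_cart One_nth simp del: sum_component)

lemma measurable_vec_lambda: "(\<lambda>f. \<chi> i. f i) \<in> measurable (PiR :: ('n::finite \<Rightarrow> real) measure) borel"
proof (subst borel_measurable_euclidean_space, rule ballI)
  fix b :: "real^'n" assume "b \<in> Basis"
  then obtain i where b: "b = axis i 1" unfolding Basis_cart by auto
  have "(\<lambda>f. f i) \<in> measurable (PiR :: ('n \<Rightarrow> real) measure) lborel" by measurable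
  then show "(\<lambda>f. (\<chi> i. f i) \<bullet> b) \<in> borel_measurable (PiR :: ('n \<Rightarrow> real) measure)"
    by (simp add: b inner_axis)
qed

text \<open>Lebesgue measure is determined by boxes, and the preimage of a box is a product of
  intervals. This opens the way to Fubini's theorem coordinate by coordinate.\<close>

lemma lborel_PiR: "(lborel :: (real^'n::finite) measure) = distr PiR borel (\<lambda>f. \<chi> i. f i)"
proof (rule lborel_eqI)
  fix l u :: "real^'n" assume lu: "\<And>b. b \<in> Basis \<Longrightarrow> l \<bullet> b \<le> u \<bullet> b"
  then have lu': "l $ i \<le> u $ i" for i using lu[of "axis i 1"] by (simp add: Basis_cart inner_axis)
  have "emeasure (distr PiR borel (\<lambda>f. \<chi> i. f i)) (box l u) =
      emeasure PiR ((\<lambda>f. \<chi> i. f i) -` box l u \<inter> space PiR)"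
    by (rule emeasure_distr[OF measurable_vec_lambda]) simp
  also have "(\<lambda>f. \<chi> i. f i) -` box l u \<inter> space PiR = (\<Pi>\<^sub>E i\<in>UNIV. {l $ i <..< u $ i})"
    by (auto simp: mem_box Basis_cart inner_axis space_PiM PiE_iff)
  also have "emeasure PiR (\<Pi>\<^sub>E i\<in>UNIV. {l $ i <..< u $ i}) = (\<Prod>i\<in>UNIV. emeasure lborel {l $ i <..< u $ i})"
    by (rule PiR.emeasure_PiM) auto
  also have "\<dots> = (\<Prod>i\<in>UNIV. ennreal (u $ i - l $ i))" using lu' by simp
  also have "\<dots> = ennreal (\<Prod>i\<in>UNIV. u $ i - l $ i)" by (rule prod_ennreal) (use lu' in auto)
  also have "(\<Prod>i\<in>UNIV. u $ i - l $ i) = (\<Prod>b\<in>Basis. (u - l) \<bullet> b)"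
    by (simp add: prod_Basis_cart inner_axis)
  finally show "emeasure (distr PiR borel (\<lambda>f. \<chi> i. f i)) (box l u) = (\<Prod>b\<in>Basis. (u - l) \<bullet> b)" .
qed simp

lemma indicator_cube_vec:
  "indicator (cbox 0 One) (\<chi> i. f i) = (\<Prod>i\<in>UNIV. indicator {0..1} (f i :: real) :: real)"
proof (cases "\<forall>i. f i \<in> {0..1}")
  case True
  then have "(\<chi> i. f i) \<in> cbox 0 One" by (simp add: mem_cube_cart)
  then show ?thesis using True by simp
next
  case False
  then obtain i where i: "f i \<notin> {0..1}" by auto
  then have "(\<chi> i. f i) \<notin> cbox 0 One" by (auto simp: mem_cube_cart)
  moreover have "(\<Prod>i\<in>UNIV. indicator {0..1} (f i)) = (0::real)"
    by (rule prod_zero) (use i in \<open>auto intro!: exI[of _ i]\<close>)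
  ultimately show ?thesis by simp
qed

lemma cube_PiR:
  fixes F :: "real^'n::finite \<Rightarrow> real"
  assumes F: "F \<in> borel_measurable cube"
  shows "integrable cube F \<longleftrightarrow> integrable PiR (\<lambda>f. (\<Prod>i\<in>UNIV. indicator {0..1} (f i)) * F (\<chi> i. f i))"
    and "(\<integral>x. F x \<partial>cube) = (\<integral>f. (\<Prod>i\<in>UNIV. indicator {0..1} (f i)) * F (\<chi> i. f i) \<partial>PiR)"
proof -
  let ?G = "\<lambda>x. indicator (cbox 0 One) x *\<^sub>R F x"
  have G: "?G \<in> borel_measurable borel"
    using F by (subst (asm) borel_measurable_restrict_space_iff) auto
  have "integrable cube F \<longleftrightarrow> integrable (distr PiR borel (\<lambda>f. \<chi> i. f i)) ?G"
    by (subst integrable_restrict_space) (simp_all add: lborel_PiR[symmetric])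
  also have "\<dots> \<longleftrightarrow> integrable PiR (\<lambda>f. ?G (\<chi> i. f i))"
    by (rule integrable_distr_eq[OF measurable_vec_lambda G])
  finally show "integrable cube F \<longleftrightarrow> integrable PiR (\<lambda>f. (\<Prod>i\<in>UNIV. indicator {0..1} (f i)) * F (\<chi> i. f i))"
    by (simp add: indicator_cube_vec)
  have "(\<integral>x. F x \<partial>cube) = (\<integral>x. ?G x \<partial>distr PiR borel (\<lambda>f. \<chi> i. f i))"
    by (subst integral_restrict_space) (simp_all add: lborel_PiR[symmetric])
  also have "\<dots> = (\<integral>f. ?G (\<chi> i. f i) \<partial>PiR)"
    by (rule integral_distr[OF measurable_vec_lambda G])
  finally show "(\<integral>x. F x \<partial>cube) = (\<integral>f. (\<Prod>i\<in>UNIV. indicator {0..1} (f i)) * F (\<chi> i. f i) \<partial>PiR)"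
    by (simp add: indicator_cube_vec)
qed

lemma measurable_cube_nth: "(\<lambda>x. x $ m) \<in> measurable (cube :: (real^'n::finite) measure) (cube :: real measure)"
proof (rule measurable_restrict_space2)
  show "(\<lambda>x. x $ m) \<in> space (cube :: (real^'n) measure) \<rightarrow> cbox 0 (One::real)"
    unfolding space_cube by (auto simp: mem_cube_cart)
  show "(\<lambda>x::real^'n. x $ m) \<in> measurable cube lborel"
    by (rule measurable_restrict_space1) (simp add: borel_measurable_continuous_onI continuous_on_component)
qed

lemma prodf_measurable:
  assumes "\<And>m. f m \<in> borel_measurable cube"
  shows "prodf f \<in> borel_measurable cube"
  unfolding prodf_def[abs_def]
  by (intro borel_measurable_prod measurable_compose[OF measurable_cube_nth assms])

lemma prodf_integral:
  fixes f :: "'n::finite \<Rightarrow> real \<Rightarrow> real"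
  assumes f: "\<And>m. integrable cube (f m)"
  shows "integrable cube (prodf f)" "(\<integral>x. prodf f x \<partial>cube) = (\<Prod>m\<in>UNIV. \<integral>x. f m x \<partial>cube)"
proof -
  have meas: "prodf f \<in> borel_measurable cube"
    by (rule prodf_measurable) (use f in \<open>rule borel_measurable_integrable\<close>)
  have eq: "(\<Prod>i\<in>UNIV. indicator {0..1} (y i)) * prodf f (\<chi> i. y i) = (\<Prod>i\<in>UNIV. indicator {0..1} (y i) *\<^sub>R f i (y i))" for y
    by (simp add: prodf_def prod.distrib)
  have int: "integrable lborel (\<lambda>y. indicator {0..1} y *\<^sub>R f m y)" for m
    using f[of m] by (simp add: integrable_restrict_space)
  show "integrable cube (prodf f)"
    unfolding cube_PiR(1)[OF meas] eq
    by (rule PiR.product_integrable_prod[OF _ int]) simp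
  show "(\<integral>x. prodf f x \<partial>cube) = (\<Prod>m\<in>UNIV. \<integral>x. f m x \<partial>cube)"
    unfolding cube_PiR(2)[OF meas] eq
    by (subst PiR.product_integral_prod[OF _ int]) (simp_all add: integral_restrict_space)
qed

lemma prodf_L2:
  assumes f: "\<And>m. f m \<in> L2"
  shows "prodf f \<in> L2"
proof (rule L2I)
  show "prodf f \<in> borel_measurable cube" by (rule prodf_measurable[OF L2_measurable[OF f]])
  have "(\<lambda>x. (prodf f x)\<^sup>2) = prodf (\<lambda>m x. (f m x)\<^sup>2)"
    by (simp add: prodf_def fun_eq_iff prod_power_distrib)
  then show "integrable cube (\<lambda>x. (prodf f x)\<^sup>2)"
    using prodf_integral(1)[OF L2_square[OF f]] by simp
qed

lemma ip_prodf:
  assumes "\<And>m. f m \<in> L2" "\<And>m. g m \<in> L2"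
  shows "ip (prodf f) (prodf g) = (\<Prod>m\<in>UNIV. ip (f m) (g m))"
proof -
  have "(\<lambda>x. prodf f x * prodf g x) = prodf (\<lambda>m x. f m x * g m x)"
    by (simp add: prodf_def fun_eq_iff prod.distrib)
  then show ?thesis
    unfolding ip_def using prodf_integral(2)[OF L2_mult[OF assms]] by simp
qed

lemma AE_cube_nth:
  assumes "AE y in (cube :: real measure). P y"
  shows "AE x in (cube :: (real^'n::finite) measure). P (x $ m)"
proof -
  obtain N where N: "{y \<in> space cube. \<not> P y} \<subseteq> N" "emeasure cube N = 0" "N \<in> sets (cube :: real measure)"
    using assms by (rule AE_E)
  \<comment> \<open>The product of these factors is the indicator of the set where coordinate
    \<open>m\<close> falls into \<open>N\<close>; its integral has the factor 0.\<close>
  define h :: "'n \<Rightarrow> real \<Rightarrow> real" where "h = (\<lambda>_ _. 1)(m := indicator N)"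
  have h: "integrable cube (h k)" for k
    using cube.integrable_const[of "1::real", where 'a = real] N
    by (cases "k = m") (simp_all add: h_def cube.emeasure_finite del: box_real)
  have eq: "prodf h x = indicator N (x $ m)" for x
    unfolding prodf_def by (subst prod.remove[of _ m]) (auto simp: h_def)
  have "(\<integral>x. h m x \<partial>cube) = 0"
    using N(2,3) sets.sets_into_space[OF N(3)] by (simp add: h_def measure_def inf.absorb1)
  then have "(\<integral>x. prodf h x \<partial>cube) = 0"
    unfolding prodf_integral(2)[OF h] by (intro prod_zero) auto
  then have "AE x in cube. prodf h x = 0"
    using prodf_integral(1)[OF h] by (subst (asm) integral_nonneg_eq_0_iff_AE) (auto simp: eq)
  moreover have "AE x in cube. x \<in> space (cube :: (real^'n) measure)" by (rule AE_space)
  ultimately show ?thesis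
  proof (eventually_elim)
    fix x :: "real^'n" assume "prodf h x = 0" "x \<in> space cube"
    then have "x $ m \<notin> N" "x $ m \<in> space (cube :: real measure)"
      using measurable_space[OF measurable_cube_nth, of x m] by (auto simp: eq)
    then show "P (x $ m)" using N(1) by blast
  qed
qed

lemma prodf_L2_eq:
  assumes "\<And>m. L2_eq (f m) (g m)"
  shows "L2_eq (prodf f) (prodf g)"
proof -
  have "AE x in cube. \<forall>m\<in>UNIV. f m (x $ m) = g m (x $ m)"
    using AE_cube_nth[OF assms[unfolded L2_eq_def]] by (intro AE_finite_allI) auto
  then show ?thesis unfolding L2_eq_def prodf_def by eventually_elim simp
qed

text \<open>Expanding the squared norm of the difference leaves inner products of product functions,
  which factor into one-dimensional ones.\<close>

lemma prodf_L2_lim: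
  assumes "\<And>m. L2_lim (\<lambda>k. f k m) (g m)"
  shows "L2_lim (\<lambda>k. prodf (f k)) (prodf g)"
  unfolding L2_lim_def
proof (intro conjI allI)
  have L: "f k m \<in> L2" "g m \<in> L2" for k m using L2_lim_L2[OF assms] by auto
  show P: "prodf (f k) \<in> L2" "prodf g \<in> L2" for k using L by (auto intro: prodf_L2)
  have "(\<lambda>k. ip (prodf (f k)) (prodf (f k)) - 2 * ip (prodf (f k)) (prodf g) + ip (prodf g) (prodf g))
      \<longlonglongrightarrow> ip (prodf g) (prodf g) - 2 * ip (prodf g) (prodf g) + ip (prodf g) (prodf g)"
    unfolding ip_prodf[OF L(1) L(1)] ip_prodf[OF L(1) L(2)] ip_prodf[OF L(2) L(2)]
    by (intro tendsto_intros L2_lim_ip assms L2_lim_const L)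
  then have "(\<lambda>k. ip (\<lambda>x. prodf (f k) x - prodf g x) (\<lambda>x. prodf (f k) x - prodf g x)) \<longlonglongrightarrow> 0"
    using P by (simp add: ip_diff_left ip_diff_right ip_commute[of "prodf g" "prodf (f _)"] algebra_simps)
  then have "(\<lambda>k. sqrt (ip (\<lambda>x. prodf (f k) x - prodf g x) (\<lambda>x. prodf (f k) x - prodf g x))) \<longlonglongrightarrow> sqrt 0"
    by (rule tendsto_real_sqrt)
  then show "(\<lambda>k. L2_norm (\<lambda>x. prodf (f k) x - prodf g x)) \<longlonglongrightarrow> 0" by (simp add: L2_norm_ip)
qed

subsection \<open>Partial derivatives of products\<close>

lemma axis_in_Basis: "axis m (1::real) \<in> Basis"
  by (simp add: Basis_cart)

lemma nth_inner_axis: "x $ m = x \<bullet> axis m 1 + (0::real)"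
  by (simp add: inner_axis)

lemma smooth_prodf: "(\<And>m. smooth (f m)) \<Longrightarrow> smooth (prodf f)"
  unfolding prodf_def[abs_def] nth_inner_axis by (intro smooth_prod smooth_compose_inner)

lemma smooth_nth: "smooth g \<Longrightarrow> smooth (\<lambda>x::real^'n::finite. g (x $ m))"
  unfolding nth_inner_axis by (rule smooth_compose_inner)

lemma pd_nth:
  assumes "smooth g"
  shows "pd (axis m 1) (\<lambda>x::real^'n::finite. g (x $ k)) = (\<lambda>x. if k = m then pd 1 g (x $ k) else 0)"
  unfolding nth_inner_axis pd_compose_inner[OF smooth_differentiable[OF assms]]
  by (auto simp: inner_axis_axis fun_eq_iff)

lemma pd_prod_0:
  assumes "finite I" "\<And>i. i \<in> I \<Longrightarrow> smooth (f i)" "\<And>i. i \<in> I \<Longrightarrow> pd b (f i) = (\<lambda>_. 0)"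
  shows "pd b (\<lambda>x. \<Prod>i\<in>I. f i x) = (\<lambda>_. 0)"
  using assms
proof (induction I rule: finite_induct)
  case (insert i I)
  then have s: "smooth (f i)" "smooth (\<lambda>x. \<Prod>i\<in>I. f i x)" by (auto intro: smooth_prod)
  show ?case
    using insert pd_mult[OF s[THEN smooth_differentiable]] by simp
qed (simp add: pd_const)

lemma pd_prodf:
  assumes f: "\<And>m. smooth (f m)"
  shows "pd (axis m 1) (prodf f) = prodf (f(m := pd 1 (f m)))"
proof -
  let ?r = "\<lambda>x::real^'a. \<Prod>k\<in>UNIV - {m}. f k (x $ k)"
  have split: "prodf g = (\<lambda>x. g m (x $ m) * (\<Prod>k\<in>UNIV - {m}. g k (x $ k)))" for g :: "'a \<Rightarrow> real \<Rightarrow> real"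
    unfolding prodf_def by (subst prod.remove[of _ m]) auto
  have sr: "smooth ?r" by (intro smooth_prod smooth_nth f)
  have 0: "pd (axis m 1) ?r = (\<lambda>_. 0)"
    by (rule pd_prod_0) (auto intro: smooth_nth f simp: pd_nth[OF f])
  show ?thesis
    unfolding split pd_mult[OF smooth_differentiable[OF smooth_nth[OF f]] smooth_differentiable[OF sr]]
      0 pd_nth[OF f]
    by (simp add: fun_eq_iff)
qed

abbreviation axes :: "'n::finite list \<Rightarrow> (real^'n) list" where
  "axes \<equiv> map (\<lambda>m. axis m 1)"

text \<open>For products only the multiplicity of each direction matters, which is how lists of
  directions are compared with weights.\<close>

lemma foldr_pd_prodf:
  assumes f: "\<And>m. f m \<in> test_functions"
  shows "foldr pd (axes ms) (prodf f) = prodf (\<lambda>m. (pd 1 ^^ count_list ms m) (f m))"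
proof (induction ms)
  case (Cons k ms)
  have s: "smooth ((pd 1 ^^ count_list ms m) (f m))" for m
    by (rule test_functions_smooth[OF test_functions_funpow[OF f]])
  have "foldr pd (axes (k # ms)) (prodf f) = pd (axis k 1) (prodf (\<lambda>m. (pd 1 ^^ count_list ms m) (f m)))"
    by (simp add: Cons)
  also have "\<dots> = prodf ((\<lambda>m. (pd 1 ^^ count_list ms m) (f m))(k := pd 1 ((pd 1 ^^ count_list ms k) (f k))))"
    by (rule pd_prodf[OF s])
  also have "(\<lambda>m. (pd 1 ^^ count_list ms m) (f m))(k := pd 1 ((pd 1 ^^ count_list ms k) (f k)))
      = (\<lambda>m. (pd 1 ^^ count_list (k # ms) m) (f m))"
    by (auto simp: fun_eq_iff)
  finally show ?case .
qed simp

lemma prodf_test_functions: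
  assumes f: "\<And>m. f m \<in> test_functions"
  shows "prodf f \<in> test_functions"
proof -
  let ?K = "{x. \<forall>m. x $ m \<in> closure {y. f m y \<noteq> 0}}"
  have "closed ?K"
    by (intro closed_Collect_all closed_vimage[of _ "\<lambda>x. x $ _", unfolded vimage_def])
      (auto intro: continuous_on_component)
  moreover have "{x. prodf f x \<noteq> 0} \<subseteq> ?K"
    using closure_subset by (fastforce simp: prodf_def)
  ultimately have "closure {x. prodf f x \<noteq> 0} \<subseteq> ?K" by (intro closure_minimal)
  also have "?K \<subseteq> box 0 One"
  proof
    fix x assume "x \<in> ?K"
    then have "x $ m \<in> box 0 One" for m using f[of m] by (auto simp: test_functions_def)
    then show "x \<in> box 0 One" by (simp add: mem_cube_cart)
  qed
  finally show ?thesis using smooth_prodf[of f] test_functions_smooth[OF f] by (simp add: test_functions_def)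
qed

subsection \<open>Integration by parts in one coordinate\<close>

lemma slice_derivative:
  fixes \<phi> :: "'a::euclidean_space \<Rightarrow> real"
  assumes "\<phi> differentiable_on UNIV"
  shows "(\<lambda>y::real. \<phi> (a + y *\<^sub>R b)) differentiable_on UNIV"
    and "pd 1 (\<lambda>y::real. \<phi> (a + y *\<^sub>R b)) = (\<lambda>y. pd b \<phi> (a + y *\<^sub>R b))"
proof -
  have *: "((\<lambda>y::real. \<phi> (a + y *\<^sub>R b)) has_derivative (\<lambda>h. pd (h *\<^sub>R b) \<phi> (a + y *\<^sub>R b))) (at y)" for y
    by (rule has_derivative_compose[OF _ has_derivative_pd[OF assms]]) (auto intro!: derivative_eq_intros)
  then show "(\<lambda>y::real. \<phi> (a + y *\<^sub>R b)) differentiable_on UNIV"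
    by (auto simp: differentiable_on_def differentiable_def)
  show "pd 1 (\<lambda>y::real. \<phi> (a + y *\<^sub>R b)) = (\<lambda>y. pd b \<phi> (a + y *\<^sub>R b))"
    using pd_eq[OF *, of 1] by (simp add: fun_eq_iff)
qed

lemma smooth_n_slice:
  fixes \<phi> :: "'a::euclidean_space \<Rightarrow> real"
  assumes b: "b \<in> Basis"
  shows "smooth_n n \<phi> \<Longrightarrow> smooth_n n (\<lambda>y::real. \<phi> (a + y *\<^sub>R b))"
proof (induction n arbitrary: \<phi>)
  case (Suc n)
  then have "\<phi> differentiable_on UNIV" "smooth_n n (pd b \<phi>)" using b by auto
  then show ?case using slice_derivative[of \<phi> a b] Suc.IH[of "pd b \<phi>"] by simp
qed simp

lemma slice_test_function:
  fixes \<phi> :: "real^'n::finite \<Rightarrow> real"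
  assumes \<phi>: "\<phi> \<in> test_functions" and a: "a $ m = 0"
  shows "(\<lambda>y. \<phi> (a + y *\<^sub>R axis m 1)) \<in> test_functions"
proof -
  let ?l = "\<lambda>y::real. a + y *\<^sub>R axis m 1" and ?S = "closure {x. \<phi> x \<noteq> 0}"
  have "closed (?l -` ?S)"
    by (rule closed_vimage) (auto intro!: continuous_intros)
  moreover have "{y. \<phi> (?l y) \<noteq> 0} \<subseteq> ?l -` ?S" using closure_subset by fastforce
  ultimately have "closure {y. \<phi> (?l y) \<noteq> 0} \<subseteq> ?l -` ?S" by (intro closure_minimal)
  also have "\<dots> \<subseteq> box 0 One"
  proof
    fix y assume "y \<in> ?l -` ?S"
    then have "?l y \<in> box 0 One" using \<phi> by (auto simp: test_functions_def)
    then have "?l y $ m \<in> {0<..<1}" unfolding mem_cube_cart by blast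
    then show "y \<in> box 0 One" using a by (simp add: axis_def)
  qed
  finally have "closure {y. \<phi> (?l y) \<noteq> 0} \<subseteq> box 0 One" .
  moreover have "smooth_n n \<phi>" for n using test_functions_smooth[OF \<phi>] by (simp add: smooth_iff)
  then have "smooth (\<lambda>y. \<phi> (?l y))"
    unfolding smooth_iff by (intro allI smooth_n_slice axis_in_Basis)
  ultimately show ?thesis by (simp add: test_functions_def)
qed

text \<open>Fubini's theorem with coordinate \<open>m\<close> integrated first; the remaining
  factors do not depend on it.\<close>

lemma ip_prodf_slices:
  fixes g :: "'n::finite \<Rightarrow> real \<Rightarrow> real"
  assumes g: "\<And>k. g k \<in> L2" and \<psi>: "\<psi> \<in> L2"
  shows "ip (prodf g) \<psi> = (\<integral>x. (\<Prod>k\<in>UNIV - {m}. indicator {0..1} (x k) * g k (x k)) *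
      ip (g m) (\<lambda>y. \<psi> (\<chi> i. (x(m := y)) i)) \<partial>Pi\<^sub>M (UNIV - {m}) (\<lambda>_. lborel))"
proof -
  let ?F = "\<lambda>x. prodf g x * \<psi> x"
  have "integrable cube ?F" by (rule L2_mult[OF prodf_L2[OF g] \<psi>])
  then have Fm: "?F \<in> borel_measurable cube" by (rule borel_measurable_integrable)
  let ?H = "\<lambda>f. (\<Prod>i\<in>UNIV. indicator {0..1} (f i)) * ?F (\<chi> i. f i)"
  have intH: "integrable (Pi\<^sub>M (insert m (UNIV - {m})) (\<lambda>_. lborel)) ?H"
    using cube_PiR(1)[OF Fm] \<open>integrable cube ?F\<close> by (simp add: insert_absorb)
  have "ip (prodf g) \<psi> = (\<integral>f. ?H f \<partial>Pi\<^sub>M (insert m (UNIV - {m})) (\<lambda>_. lborel))"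
    unfolding ip_def cube_PiR(2)[OF Fm] by (simp add: insert_absorb)
  also have "\<dots> = (\<integral>x. (\<integral>y. ?H (x(m := y)) \<partial>lborel) \<partial>Pi\<^sub>M (UNIV - {m}) (\<lambda>_. lborel))"
    by (rule PiR.product_integral_insert[OF _ _ intH]) auto
  also have "\<dots> = (\<integral>x. (\<Prod>k\<in>UNIV - {m}. indicator {0..1} (x k) * g k (x k)) *
      ip (g m) (\<lambda>y. \<psi> (\<chi> i. (x(m := y)) i)) \<partial>Pi\<^sub>M (UNIV - {m}) (\<lambda>_. lborel))"
  proof (rule Bochner_Integration.integral_cong[OF refl])
    fix x :: "'n \<Rightarrow> real"
    let ?c = "\<Prod>k\<in>UNIV - {m}. indicator {0..1} (x k) * g k (x k)"
    have "?H (x(m := y)) = ?c * (indicator {0..1} y * (g m y * \<psi> (\<chi> i. (x(m := y)) i)))" for y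
    proof -
      have 1: "(\<Prod>i\<in>UNIV. indicator {0..1} ((x(m := y)) i)) =
          indicator {0..1} y * (\<Prod>i\<in>UNIV - {m}. indicator {0..1} (x i) :: real)"
        by (subst prod.remove[of _ m]) (auto intro!: prod.cong)
      have 2: "prodf g (\<chi> i. (x(m := y)) i) = g m y * (\<Prod>k\<in>UNIV - {m}. g k (x k))"
        unfolding prodf_def by (subst prod.remove[of _ m]) (auto intro!: prod.cong)
      show ?thesis unfolding 1 2 prod.distrib by (simp only: mult_ac)
    qed
    then have "(\<integral>y. ?H (x(m := y)) \<partial>lborel) = ?c * (\<integral>y. indicator {0..1} y * (g m y * \<psi> (\<chi> i. (x(m := y)) i)) \<partial>lborel)"
      by (simp only: integral_mult_right_zero)
    also have "(\<integral>y. indicator {0..1} y * (g m y * \<psi> (\<chi> i. (x(m := y)) i)) \<partial>lborel) =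
        ip (g m) (\<lambda>y. \<psi> (\<chi> i. (x(m := y)) i))"
      unfolding ip_def by (subst integral_restrict_space) simp_all
    finally show "(\<integral>y. ?H (x(m := y)) \<partial>lborel) = ?c * ip (g m) (\<lambda>y. \<psi> (\<chi> i. (x(m := y)) i))" .
  qed
  finally show ?thesis .
qed

text \<open>Every slice of a test function parallel to the \<open>m\<close>-axis is a
  one-dimensional test function, so the one-dimensional weak derivative can be used inside the outer
  integral.\<close>

lemma ip_prodf_by_parts:
  fixes f :: "'n::finite \<Rightarrow> real \<Rightarrow> real"
  assumes f: "\<And>k. f k \<in> L2" and wd: "weak_deriv (f m) f'" and \<phi>: "\<phi> \<in> test_functions"
  shows "ip (prodf f) (pd (axis m 1) \<phi>) = - ip (prodf (f(m := f'))) \<phi>"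
proof -
  have f': "(f(m := f')) k \<in> L2" for k using f weak_deriv_L2[OF wd] by simp
  \<comment> \<open>Base point with coordinate \<open>m\<close> equal to 0, so that the parameter
    along the slice is the coordinate itself.\<close>
  define a :: "('n \<Rightarrow> real) \<Rightarrow> real^'n" where "a x = (\<chi> i. (x(m := 0)) i)" for x
  have slice: "(\<chi> i. (x(m := y)) i) = a x + y *\<^sub>R axis m 1" for x :: "'n \<Rightarrow> real" and y
    by (simp add: vec_eq_iff axis_def a_def)
  have 1: "ip (f m) (\<lambda>y. pd (axis m 1) \<phi> (\<chi> i. (x(m := y)) i)) = - ip f' (\<lambda>y. \<phi> (\<chi> i. (x(m := y)) i))" for x
    unfolding slice slice_derivative(2)[OF test_functions_differentiable[OF \<phi>], symmetric]
    by (rule weak_derivD[OF wd slice_test_function[OF \<phi>]]) (simp add: a_def)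
  have 2: "(\<Prod>k\<in>UNIV - {m}. indicator {0..1} (x k) * (f(m := f')) k (x k)) =
      (\<Prod>k\<in>UNIV - {m}. indicator {0..1} (x k) * f k (x k))" for x :: "'n \<Rightarrow> real"
    by (rule prod.cong) auto
  show ?thesis
    unfolding ip_prodf_slices[where g = f and m = m, OF f test_functions_L2[OF test_functions_pd[OF \<phi> axis_in_Basis]]]
      ip_prodf_slices[where g = "f(m := f')" and m = m, OF f' test_functions_L2[OF \<phi>]]
    by (simp only: 1 2 fun_upd_same mult_minus_right Bochner_Integration.integral_minus)
qed

section \<open>Tensor products of finite rank operators\<close>

lemma prodf_sum:
  "prodf (f(m := (\<lambda>x. \<Sum>i\<in>I. c i * h i x))) x = (\<Sum>i\<in>I. c i * prodf (f(m := h i)) x)"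
proof -
  have "prodf (f(m := h')) x = h' (x $ m) * (\<Prod>k\<in>UNIV - {m}. f k (x $ k))" for h'
    unfolding prodf_def by (subst prod.remove[of _ m]) (auto intro!: prod.cong)
  then show ?thesis by (simp add: sum_distrib_right mult.assoc)
qed

locale dual_systems =
  fixes N :: "'n::finite \<Rightarrow> nat \<Rightarrow> nat"
    and e g :: "'n \<Rightarrow> nat \<Rightarrow> nat \<Rightarrow> real \<Rightarrow> real"
    and M :: "'n \<Rightarrow> nat \<Rightarrow> nat \<Rightarrow> nat \<Rightarrow> real"
  assumes ds: "\<And>m. dual_system (N m) (e m) (g m) (M m)"
begin

text \<open>An extensional function space, in the form in which products of sums distribute over
  it.\<close>

definition Idx :: "('n \<Rightarrow> nat) \<Rightarrow> ('n \<Rightarrow> nat) set" where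
  "Idx w = (\<Pi>\<^sub>E m\<in>UNIV. {..<N m (w m)})"

definition E :: "('n \<Rightarrow> nat) \<Rightarrow> ('n \<Rightarrow> nat) \<Rightarrow> real^'n \<Rightarrow> real" where
  "E w \<alpha> = prodf (\<lambda>m. e m (w m) (\<alpha> m))"

text \<open>\<open>D w d \<alpha>\<close> is the mixed derivative of order \<open>d\<close> of the product of the functions
  \<open>g m (w m) (\<alpha> m)\<close>.\<close>

definition D :: "('n \<Rightarrow> nat) \<Rightarrow> ('n \<Rightarrow> nat) \<Rightarrow> ('n \<Rightarrow> nat) \<Rightarrow> real^'n \<Rightarrow> real" where
  "D w d \<alpha> = prodf (\<lambda>m. gder (N m) (M m) (g m) (w m) (d m) (\<alpha> m))"

text \<open>An explicit candidate for the tensor product of the one-dimensional finite rank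
  operators of weights \<open>w\<close>. It depends on \<open>f\<close> only through inner products,
  hence only on its class in L2.\<close>

definition T :: "('n \<Rightarrow> nat) \<Rightarrow> (real^'n \<Rightarrow> real) \<Rightarrow> real^'n \<Rightarrow> real" where
  "T w f x = (\<Sum>\<alpha>\<in>Idx w. ip f (D w (\<lambda>_. 0) \<alpha>) * E w \<alpha> x)"

lemma finite_Idx [simp]: "finite (Idx w)"
  unfolding Idx_def by (rule finite_PiE) auto

lemma Idx_less: "\<alpha> \<in> Idx w \<Longrightarrow> \<alpha> m < N m (w m)"
  by (auto simp: Idx_def PiE_iff)

lemma gder_L2: "w \<le> 2 \<Longrightarrow> a < N m w \<Longrightarrow> gder (N m) (M m) (g m) w c a \<in> L2"
proof (induction w arbitrary: c a)
  case 0
  then show ?case using ds[of m] by (cases c) (auto simp: dual_system_def)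
next
  case (Suc w)
  show ?case
  proof (cases c)
    case 0
    then show ?thesis using ds[of m] Suc.prems by (simp add: dual_system_def)
  next
    case (Suc c')
    have "(\<lambda>x. -1 * (\<Sum>a'<N m w. M m w a a' * gder (N m) (M m) (g m) w c' a' x)) \<in> L2"
      by (intro L2_scale L2_sum) (use Suc.IH Suc.prems in auto)
    then show ?thesis using Suc by simp
  qed
qed

lemma e_L2: "w \<le> 2 \<Longrightarrow> a < N m w \<Longrightarrow> e m w a \<in> L2"
  using ds[of m] by (simp add: dual_system_def)

lemma E_L2: "(\<And>m. w m \<le> 2) \<Longrightarrow> \<alpha> \<in> Idx w \<Longrightarrow> E w \<alpha> \<in> L2"
  unfolding E_def by (intro prodf_L2 e_L2 Idx_less)

lemma D_L2: "(\<And>m. w m \<le> 2) \<Longrightarrow> \<alpha> \<in> Idx w \<Longrightarrow> D w d \<alpha> \<in> L2"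
  unfolding D_def by (intro prodf_L2 gder_L2 Idx_less)

lemma T_L2: "(\<And>m. w m \<le> 2) \<Longrightarrow> T w f \<in> L2"
  unfolding T_def[abs_def] by (intro L2_sum L2_scale E_L2)

lemma ip_T:
  assumes "\<And>m. w m \<le> 2" "\<phi> \<in> L2"
  shows "ip (T w f) \<phi> = (\<Sum>\<alpha>\<in>Idx w. ip f (D w (\<lambda>_. 0) \<alpha>) * ip (E w \<alpha>) \<phi>)"
  unfolding T_def[abs_def] using E_L2[OF assms(1)] assms(2)
  by (subst ip_sum_left) (auto simp: ip_scale_left)

text \<open>Integration by parts expresses the derivative of \<open>E\<close> through
  \<open>M\<close>, and the same matrix expresses the derivative of the dual functions of the next
  weight. The matrix thus passes from one factor to the other, and the two minus signs
  cancel.\<close>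

lemma derivative_step:
  assumes w: "\<And>k. w k \<le> 2" "w m < 2" and u: "u \<in> L2" and \<psi>: "\<psi> \<in> test_functions"
  shows "(\<Sum>\<beta>\<in>Idx w. ip u (D w d \<beta>) * ip (E w \<beta>) (pd (axis m 1) \<psi>)) =
    (\<Sum>\<gamma>\<in>Idx (w(m := Suc (w m))). ip u (D (w(m := Suc (w m))) (d(m := Suc (d m))) \<gamma>) *
      ip (E (w(m := Suc (w m))) \<gamma>) \<psi>)"
proof -
  let ?w = "w(m := Suc (w m))" and ?d = "d(m := Suc (d m))"
  let ?n = "N m (w m)" and ?n' = "N m (Suc (w m))" and ?M = "M m (w m)"
  have w': "?w k \<le> 2" for k using w by simp
  have \<psi>L: "\<psi> \<in> L2" by (rule test_functions_L2[OF \<psi>])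
  have upd: "\<beta>(m := b) \<in> Idx ?w" if "\<beta> \<in> Idx w" "b < ?n'" for \<beta> b
    using that by (auto simp: Idx_def PiE_iff)
  have upd': "\<gamma>(m := a) \<in> Idx w" if "\<gamma> \<in> Idx ?w" "a < ?n" for \<gamma> a
    using that unfolding Idx_def PiE_iff by (auto split: if_splits)
  have E_upd: "E ?w (\<beta>(m := b)) = prodf ((\<lambda>k. e k (w k) (\<beta> k))(m := e m (Suc (w m)) b))" for \<beta> b
    unfolding E_def by (rule arg_cong[of _ _ prodf]) (auto simp: fun_eq_iff)
  have D_upd: "D w d (\<gamma>(m := a)) = prodf ((\<lambda>k. gder (N k) (M k) (g k) (?w k) (?d k) (\<gamma> k))
      (m := gder (N m) (M m) (g m) (w m) (d m) a))" for \<gamma> a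
    unfolding D_def by (rule arg_cong[of _ _ prodf]) (auto simp: fun_eq_iff)
  have 1: "ip (E w \<beta>) (pd (axis m 1) \<psi>) = - (\<Sum>b<?n'. ?M b (\<beta> m) * ip (E ?w (\<beta>(m := b))) \<psi>)"
    if \<beta>: "\<beta> \<in> Idx w" for \<beta>
  proof -
    have wd: "weak_deriv (e m (w m) (\<beta> m)) (\<lambda>x. \<Sum>b<?n'. ?M b (\<beta> m) * e m (Suc (w m)) b x)"
      using ds[of m] w(2) Idx_less[OF \<beta>, of m] by (simp add: dual_system_def)
    have "ip (E w \<beta>) (pd (axis m 1) \<psi>) = - ip (prodf ((\<lambda>k. e k (w k) (\<beta> k))
        (m := \<lambda>x. \<Sum>b<?n'. ?M b (\<beta> m) * e m (Suc (w m)) b x))) \<psi>"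
      unfolding E_def
      by (rule ip_prodf_by_parts[where f = "\<lambda>k. e k (w k) (\<beta> k)" and m = m, OF _ wd \<psi>])
        (intro e_L2 w Idx_less[OF \<beta>])
    also have "prodf ((\<lambda>k. e k (w k) (\<beta> k)) (m := \<lambda>x. \<Sum>b<?n'. ?M b (\<beta> m) * e m (Suc (w m)) b x))
        = (\<lambda>x. \<Sum>b<?n'. ?M b (\<beta> m) * E ?w (\<beta>(m := b)) x)"
      unfolding E_upd prodf_sum[abs_def] by (simp add: fun_eq_iff prodf_sum)
    also have "ip \<dots> \<psi> = (\<Sum>b<?n'. ?M b (\<beta> m) * ip (E ?w (\<beta>(m := b))) \<psi>)"
      using E_L2[OF w' upd[OF \<beta>]] \<psi>L by (subst ip_sum_left) (auto simp: ip_scale_left)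
    finally show ?thesis .
  qed
  have 2: "ip u (D ?w ?d \<gamma>) = - (\<Sum>a<?n. ?M (\<gamma> m) a * ip u (D w d (\<gamma>(m := a))))"
    if \<gamma>: "\<gamma> \<in> Idx ?w" for \<gamma>
  proof -
    have "gder (N m) (M m) (g m) (?w m) (?d m) (\<gamma> m) =
        (\<lambda>x. \<Sum>a<?n. - ?M (\<gamma> m) a * gder (N m) (M m) (g m) (w m) (d m) a x)"
      by (simp add: sum_negf)
    then have "D ?w ?d \<gamma> = prodf ((\<lambda>k. gder (N k) (M k) (g k) (?w k) (?d k) (\<gamma> k))
      (m := \<lambda>x. \<Sum>a<?n. - ?M (\<gamma> m) a * gder (N m) (M m) (g m) (w m) (d m) a x))"
      unfolding D_def by (intro arg_cong[of _ _ prodf]) (simp add: fun_eq_iff)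
    also have "\<dots> = (\<lambda>x. \<Sum>a<?n. - ?M (\<gamma> m) a * D w d (\<gamma>(m := a)) x)"
      unfolding D_upd by (simp only: fun_eq_iff prodf_sum) simp
    finally have "ip u (D ?w ?d \<gamma>) = ip u (\<lambda>x. \<Sum>a<?n. - ?M (\<gamma> m) a * D w d (\<gamma>(m := a)) x)" by simp
    also have "\<dots> = (\<Sum>a<?n. - ?M (\<gamma> m) a * ip u (D w d (\<gamma>(m := a))))"
      using D_L2[OF w(1) upd'[OF \<gamma>]] u
      by (subst ip_sum_right) (auto simp only: ip_scale_right intro!: L2_scale)
    finally show ?thesis by (simp add: sum_negf)
  qed
  have "(\<Sum>\<beta>\<in>Idx w. ip u (D w d \<beta>) * ip (E w \<beta>) (pd (axis m 1) \<psi>)) =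
      - (\<Sum>\<beta>\<in>Idx w. \<Sum>b<?n'. ip u (D w d \<beta>) * ?M b (\<beta> m) * ip (E ?w (\<beta>(m := b))) \<psi>)"
    by (simp add: 1 sum_distrib_left sum_negf mult.assoc)
  also have "(\<Sum>\<beta>\<in>Idx w. \<Sum>b<?n'. ip u (D w d \<beta>) * ?M b (\<beta> m) * ip (E ?w (\<beta>(m := b))) \<psi>) =
      (\<Sum>(\<beta>, b)\<in>Idx w \<times> {..<?n'}. ip u (D w d \<beta>) * ?M b (\<beta> m) * ip (E ?w (\<beta>(m := b))) \<psi>)"
    by (rule sum.cartesian_product)
  \<comment> \<open>The entry of the multi-index in direction \<open>m\<close> is exchanged with the
    summation index of the matrix; applying the exchange twice is the identity.\<close>
  also have "\<dots> = (\<Sum>(\<gamma>, a)\<in>Idx ?w \<times> {..<?n}. ip u (D w d (\<gamma>(m := a))) * ?M (\<gamma> m) a * ip (E ?w \<gamma>) \<psi>)"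
  proof (rule sum.reindex_bij_witness[of _ "\<lambda>(\<gamma>, a). (\<gamma>(m := a), \<gamma> m)" "\<lambda>(\<beta>, b). (\<beta>(m := b), \<beta> m)"], goal_cases)
    case (2 p) then show ?case using upd Idx_less[of _ w m] by auto
  next
    case (4 p) then show ?case using upd' Idx_less[of _ ?w m] by auto
  qed auto
  also have "\<dots> = (\<Sum>\<gamma>\<in>Idx ?w. \<Sum>a<?n. ip u (D w d (\<gamma>(m := a))) * ?M (\<gamma> m) a * ip (E ?w \<gamma>) \<psi>)"
    by (rule sum.cartesian_product[symmetric])
  also have "- \<dots> = (\<Sum>\<gamma>\<in>Idx ?w. ip u (D ?w ?d \<gamma>) * ip (E ?w \<gamma>) \<psi>)"
    by (simp add: 2 sum_distrib_left sum_distrib_right sum_negf mult_ac)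
  finally show ?thesis .
qed

lemma derivative_steps:
  assumes "\<And>k. w k + count_list ms k \<le> 2" and u: "u \<in> L2" and \<psi>: "\<psi> \<in> test_functions"
  shows "(\<Sum>\<beta>\<in>Idx w. ip u (D w d \<beta>) * ip (E w \<beta>) (foldr pd (axes ms) \<psi>)) =
    (\<Sum>\<gamma>\<in>Idx (\<lambda>k. w k + count_list ms k). ip u (D (\<lambda>k. w k + count_list ms k) (\<lambda>k. d k + count_list ms k) \<gamma>) *
      ip (E (\<lambda>k. w k + count_list ms k) \<gamma>) \<psi>)"
  using assms(1)
proof (induction ms arbitrary: w d)
  case (Cons m ms)
  let ?w = "w(m := Suc (w m))" and ?d = "d(m := Suc (d m))"
  have le: "?w k + count_list ms k \<le> 2" for k
    using Cons.prems[of k] by (auto split: if_splits)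
  have w: "w k \<le> 2" for k using Cons.prems[of k] by simp
  have wm: "w m < 2" using Cons.prems[of m] by simp
  have "foldr pd (axes ms) \<psi> \<in> test_functions"
    by (rule test_functions_foldr[OF \<psi>]) (auto simp: axis_in_Basis)
  note step = derivative_step[of w m u "foldr pd (axes ms) \<psi>" d, OF w wm u this]
  have fw: "(\<lambda>k. ?w k + count_list ms k) = (\<lambda>k. w k + count_list (m # ms) k)"
    and fd: "(\<lambda>k. ?d k + count_list ms k) = (\<lambda>k. d k + count_list (m # ms) k)"
    by (auto simp: fun_eq_iff)
  show ?case using step Cons.IH[OF le, of ?d] unfolding fw fd by simp
qed simp

text \<open>A single sequence has to serve all lists \<open>ms\<close> at once, since the terms of
  one differential equation carry different derivatives of the same test function.\<close>

lemma D_approx: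
  assumes w: "\<And>k. w k \<le> 2" and \<gamma>: "\<gamma> \<in> Idx w"
  shows "\<exists>\<phi>. (\<forall>n. \<phi> n \<in> test_functions) \<and>
    (\<forall>ms. (\<forall>k. count_list ms k \<le> w k) \<longrightarrow> L2_lim (\<lambda>n. foldr pd (axes ms) (\<phi> n)) (D w (count_list ms) \<gamma>))"
proof -
  have "\<forall>m. \<exists>\<eta>. (\<forall>n. \<eta> n \<in> test_functions) \<and>
      (\<forall>c\<le>w m. L2_lim (\<lambda>n. (pd 1 ^^ c) (\<eta> n)) (gder (N m) (M m) (g m) (w m) c (\<gamma> m)))"
    using dual_system_approx[OF ds w Idx_less[OF \<gamma>]] by blast
  then obtain \<eta> where \<eta>: "\<And>m n. \<eta> m n \<in> test_functions"
    "\<And>m c. c \<le> w m \<Longrightarrow> L2_lim (\<lambda>n. (pd 1 ^^ c) (\<eta> m n)) (gder (N m) (M m) (g m) (w m) c (\<gamma> m))"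
    by metis
  show ?thesis
  proof (intro exI[of _ "\<lambda>n. prodf (\<lambda>m. \<eta> m n)"] conjI allI impI)
    show "prodf (\<lambda>m. \<eta> m n) \<in> test_functions" for n by (rule prodf_test_functions[OF \<eta>(1)])
    fix ms assume ms: "\<forall>k. count_list ms k \<le> w k"
    show "L2_lim (\<lambda>n. foldr pd (axes ms) (prodf (\<lambda>m. \<eta> m n))) (D w (count_list ms) \<gamma>)"
      unfolding foldr_pd_prodf[OF \<eta>(1)] D_def
      by (rule prodf_L2_lim[of "\<lambda>n m. (pd 1 ^^ count_list ms m) (\<eta> m n)"]) (use \<eta>(2) ms in auto)
  qed
qed

text \<open>By approximation the equation may be tested with \<open>D \<omega> (\<lambda>_. 0) \<gamma>\<close>, and both sides of the
  conclusion are combinations of the resulting identities.\<close>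

lemma T_differential_equation:
  assumes X: "finite X" and u: "\<And>x. x \<in> X \<Longrightarrow> u x \<in> L2" and v: "v \<in> L2"
    and \<omega>: "\<And>k. \<omega> k \<le> 2"
    and wt: "\<And>x. x \<in> X \<Longrightarrow> c x \<noteq> 0 \<Longrightarrow> \<omega> = (\<lambda>k. wx x k + count_list (ms x) k)"
    and eq: "\<And>\<phi>. \<phi> \<in> test_functions \<Longrightarrow> (\<Sum>x\<in>X. c x * ip (u x) (foldr pd (axes (ms x)) \<phi>)) = ip v \<phi>"
    and \<phi>: "\<phi> \<in> test_functions"
  shows "(\<Sum>x\<in>X. c x * ip (T (wx x) (u x)) (foldr pd (axes (ms x)) \<phi>)) = ip (T \<omega> v) \<phi>"
proof -
  have cnt: "count_list (ms x) k \<le> \<omega> k" if "x \<in> X" "c x \<noteq> 0" for x k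
    using fun_cong[OF wt[OF that], of k] by simp
  have lim: "(\<Sum>x\<in>X. c x * ip (u x) (D \<omega> (count_list (ms x)) \<gamma>)) = ip v (D \<omega> (\<lambda>_. 0) \<gamma>)"
    if \<gamma>: "\<gamma> \<in> Idx \<omega>" for \<gamma>
  proof -
    obtain \<psi> where \<psi>: "\<And>n. \<psi> n \<in> test_functions"
      "\<And>ms. (\<forall>k. count_list ms k \<le> \<omega> k) \<Longrightarrow> L2_lim (\<lambda>n. foldr pd (axes ms) (\<psi> n)) (D \<omega> (count_list ms) \<gamma>)"
      using D_approx[OF \<omega> \<gamma>] by metis
    have "(\<lambda>n. c x * ip (u x) (foldr pd (axes (ms x)) (\<psi> n))) \<longlonglongrightarrow> c x * ip (u x) (D \<omega> (count_list (ms x)) \<gamma>)"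
      if "x \<in> X" for x
    \<comment> \<open>Convergence is available only for multiplicities bounded by
      \<open>\<omega>\<close>; a nonzero coefficient guarantees this bound.\<close>
    proof (cases "c x = 0")
      case False
      then show ?thesis
        using cnt[OF that] by (intro tendsto_mult tendsto_const L2_lim_ip L2_lim_const u that \<psi>(2)) auto
    qed simp
    then have "(\<lambda>n. \<Sum>x\<in>X. c x * ip (u x) (foldr pd (axes (ms x)) (\<psi> n))) \<longlonglongrightarrow>
        (\<Sum>x\<in>X. c x * ip (u x) (D \<omega> (count_list (ms x)) \<gamma>))" by (rule tendsto_sum)
    moreover have "(\<lambda>n. ip v (\<psi> n)) \<longlonglongrightarrow> ip v (D \<omega> (\<lambda>_. 0) \<gamma>)"
    proof -
      have "L2_lim \<psi> (D \<omega> (\<lambda>_. 0) \<gamma>)" using \<psi>(2)[of "[]"] by (simp add: count_list.simps(1)[abs_def])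
      then show ?thesis by (intro L2_lim_ip L2_lim_const v)
    qed
    ultimately show ?thesis unfolding eq[OF \<psi>(1)] by (rule LIMSEQ_unique)
  qed
  have fL: "foldr pd (axes ms) \<phi> \<in> L2" for ms
    by (intro test_functions_L2 test_functions_foldr[OF \<phi>]) (auto simp: axis_in_Basis)
  have "c x * ip (T (wx x) (u x)) (foldr pd (axes (ms x)) \<phi>) =
      (\<Sum>\<gamma>\<in>Idx \<omega>. c x * ip (u x) (D \<omega> (count_list (ms x)) \<gamma>) * ip (E \<omega> \<gamma>) \<phi>)" if x: "x \<in> X" for x
  proof (cases "c x = 0")
    case False
    note wx = wt[OF x False]
    have le: "wx x k + count_list (ms x) k \<le> 2" for k using \<omega>[of k] fun_cong[OF wx, of k] by simp
    then have le': "wx x k \<le> 2" for k by (metis add_leD1)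
    have "ip (T (wx x) (u x)) (foldr pd (axes (ms x)) \<phi>) =
        (\<Sum>\<gamma>\<in>Idx \<omega>. ip (u x) (D \<omega> (\<lambda>k. 0 + count_list (ms x) k) \<gamma>) * ip (E \<omega> \<gamma>) \<phi>)"
      unfolding ip_T[OF le' fL] wx by (rule derivative_steps[OF le u[OF x] \<phi>])
    then show ?thesis by (simp add: sum_distrib_left mult.assoc)
  qed simp
  then have "(\<Sum>x\<in>X. c x * ip (T (wx x) (u x)) (foldr pd (axes (ms x)) \<phi>)) =
      (\<Sum>x\<in>X. \<Sum>\<gamma>\<in>Idx \<omega>. c x * ip (u x) (D \<omega> (count_list (ms x)) \<gamma>) * ip (E \<omega> \<gamma>) \<phi>)"
    by (intro sum.cong) auto
  also have "\<dots> = (\<Sum>\<gamma>\<in>Idx \<omega>. \<Sum>x\<in>X. c x * ip (u x) (D \<omega> (count_list (ms x)) \<gamma>) * ip (E \<omega> \<gamma>) \<phi>)"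
    by (rule sum.swap)
  also have "\<dots> = (\<Sum>\<gamma>\<in>Idx \<omega>. ip v (D \<omega> (\<lambda>_. 0) \<gamma>) * ip (E \<omega> \<gamma>) \<phi>)"
    by (rule sum.cong) (simp_all add: sum_distrib_right[symmetric] lim)
  also have "\<dots> = ip (T \<omega> v) \<phi>" by (rule ip_T[OF \<omega> test_functions_L2[OF \<phi>], symmetric])
  finally show ?thesis .
qed

lemma T_bounded_linear:
  assumes w: "\<And>k. w k \<le> 2"
  shows "L2_bounded_linear (T w)"
  unfolding L2_bounded_linear_def
proof (intro conjI ballI allI)
  show "T w f \<in> L2" for f by (rule T_L2[OF w])
  show "L2_eq (T w (\<lambda>x. f x + h x)) (\<lambda>x. T w f x + T w h x)" if "f \<in> L2" "h \<in> L2" for f h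
  proof -
    have "T w (\<lambda>x. f x + h x) = (\<lambda>x. T w f x + T w h x)"
      unfolding T_def[abs_def] sum.distrib[symmetric]
      by (intro ext sum.cong refl) (simp add: ip_add_left that D_L2[OF w] distrib_right)
    then show ?thesis by simp
  qed
  show "L2_eq (T w (\<lambda>x. c * f x)) (\<lambda>x. c * T w f x)" for c f
    by (simp add: T_def[abs_def] ip_scale_left sum_distrib_left mult.assoc)
  show "\<exists>C. \<forall>f\<in>L2. L2_norm (T w f) \<le> C * L2_norm f"
  proof (intro exI[of _ "\<Sum>\<alpha>\<in>Idx w. L2_norm (D w (\<lambda>_. 0) \<alpha>) * L2_norm (E w \<alpha>)"] ballI)
    fix f :: "real^'n \<Rightarrow> real" assume f: "f \<in> L2"
    have "L2_norm (T w f) \<le> (\<Sum>\<alpha>\<in>Idx w. L2_norm (\<lambda>x. ip f (D w (\<lambda>_. 0) \<alpha>) * E w \<alpha> x))"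
      unfolding T_def[abs_def] by (intro L2_norm_sum_le L2_scale E_L2[OF w])
    also have "\<dots> \<le> (\<Sum>\<alpha>\<in>Idx w. L2_norm f * L2_norm (D w (\<lambda>_. 0) \<alpha>) * L2_norm (E w \<alpha>))"
      unfolding L2_norm_scale
      by (intro sum_mono mult_right_mono L2_Cauchy_Schwarz f D_L2[OF w] L2_norm_nonneg)
    also have "\<dots> = (\<Sum>\<alpha>\<in>Idx w. L2_norm (D w (\<lambda>_. 0) \<alpha>) * L2_norm (E w \<alpha>)) * L2_norm f"
      by (simp add: sum_distrib_left sum_distrib_right mult_ac)
    finally show "L2_norm (T w f) \<le> \<dots>" .
  qed
qed

text \<open>The sum over multi-indices of products is the product of the one-dimensional
  sums.\<close>

lemma T_prodf:
  assumes w: "\<And>k. w k \<le> 2" and f: "\<And>m. f m \<in> L2"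
  shows "T w (prodf f) = prodf (\<lambda>m. fin_rank (N m (w m)) (e m (w m)) (g m (w m)) (f m))"
proof
  fix x
  have "T w (prodf f) x = (\<Sum>\<alpha>\<in>Idx w. \<Prod>m\<in>UNIV. ip (g m (w m) (\<alpha> m)) (f m) * e m (w m) (\<alpha> m) (x $ m))"
    unfolding T_def
  proof (rule sum.cong[OF refl])
    fix \<alpha> assume \<alpha>: "\<alpha> \<in> Idx w"
    have "g m (w m) (\<alpha> m) \<in> L2" for m using gder_L2[OF w Idx_less[OF \<alpha>], of m 0] by simp
    then have "ip (prodf f) (D w (\<lambda>_. 0) \<alpha>) = (\<Prod>m\<in>UNIV. ip (f m) (g m (w m) (\<alpha> m)))"
      unfolding D_def by (simp add: ip_prodf f)
    then show "ip (prodf f) (D w (\<lambda>_. 0) \<alpha>) * E w \<alpha> x =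
        (\<Prod>m\<in>UNIV. ip (g m (w m) (\<alpha> m)) (f m) * e m (w m) (\<alpha> m) (x $ m))"
      by (simp add: E_def prodf_def prod.distrib ip_commute[of "f _"])
  qed
  also have "\<dots> = (\<Prod>m\<in>UNIV. \<Sum>a<N m (w m). ip (g m (w m) a) (f m) * e m (w m) a (x $ m))"
    unfolding Idx_def by (rule prod_sum_PiE[symmetric]) auto
  finally show "T w (prodf f) x = prodf (\<lambda>m. fin_rank (N m (w m)) (e m (w m)) (g m (w m)) (f m)) x"
    by (simp add: prodf_def fin_rank_def)
qed

lemma T_is_tensor_op:
  assumes w: "\<And>k. w k \<le> 2"
    and A: "\<And>m f. f \<in> L2 \<Longrightarrow> L2_eq (A m f) (fin_rank (N m (w m)) (e m (w m)) (g m (w m)) f)"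
  shows "is_tensor_op A (T w)"
  unfolding is_tensor_op_def
proof (intro conjI allI impI T_bounded_linear w)
  fix f :: "'n \<Rightarrow> real \<Rightarrow> real" assume f: "\<forall>m. f m \<in> L2"
  have "L2_eq (T w (prodf f)) (prodf (\<lambda>m. A m (f m)))"
    unfolding T_prodf[OF w f[rule_format]] by (rule prodf_L2_eq) (rule L2_eq_sym[OF A[OF f[rule_format]]])
  then show "L2_eq (T w (\<lambda>x. \<Prod>m\<in>UNIV. f m (x $ m))) (\<lambda>x. \<Prod>m\<in>UNIV. A m (f m) (x $ m))"
    unfolding prodf_def[abs_def] .
qed

end

section \<open>Uniqueness of the tensor product operator\<close>

lemma L2_bounded_linear_add:
  "L2_bounded_linear T \<Longrightarrow> f \<in> L2 \<Longrightarrow> h \<in> L2 \<Longrightarrow> L2_eq (T (\<lambda>x. f x + h x)) (\<lambda>x. T f x + T h x)"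
  by (simp add: L2_bounded_linear_def)

lemma L2_bounded_linear_scale:
  "L2_bounded_linear T \<Longrightarrow> f \<in> L2 \<Longrightarrow> L2_eq (T (\<lambda>x. c * f x)) (\<lambda>x. c * T f x)"
  by (simp add: L2_bounded_linear_def)

lemma L2_bounded_linear_diff:
  assumes T: "L2_bounded_linear T" and C: "\<And>f. f \<in> L2 \<Longrightarrow> L2_norm (T f) \<le> C * L2_norm f"
    and fh: "f \<in> L2" "h \<in> L2"
  shows "L2_norm (\<lambda>x. T f x - T h x) \<le> C * L2_norm (\<lambda>x. f x - h x)"
proof -
  have TL: "T k \<in> L2" if "k \<in> L2" for k using T that by (simp add: L2_bounded_linear_def)
  have m: "(\<lambda>x. -1 * h x) \<in> L2" by (rule L2_scale[OF fh(2)])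
  have "L2_eq (T (\<lambda>x. f x + -1 * h x)) (\<lambda>x. T f x + T (\<lambda>x. -1 * h x) x)"
    by (rule L2_bounded_linear_add[OF T fh(1) m])
  also have "L2_eq (\<lambda>x. T f x + T (\<lambda>x. -1 * h x) x) (\<lambda>x. T f x + -1 * T h x)"
    by (rule L2_eq_add[OF L2_eq_refl L2_bounded_linear_scale[OF T fh(2)]])
  finally have eq: "L2_eq (T (\<lambda>x. f x - h x)) (\<lambda>x. T f x - T h x)" by simp
  have "L2_norm (\<lambda>x. T f x - T h x) = L2_norm (T (\<lambda>x. f x - h x))"
    by (rule L2_norm_cong[OF L2_eq_sym[OF eq]]) (auto intro: TL fh)
  also have "\<dots> \<le> C * L2_norm (\<lambda>x. f x - h x)" by (rule C) (auto intro: fh)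
  finally show ?thesis .
qed

lemma bump_prodf:
  "bump a b k = prodf (\<lambda>m y. step (real k * y + (- real k * (a $ m) - 1)) * step (- real k * y + (real k * (b $ m) - 1)))"
  by (simp add: bump_def prodf_def fun_eq_iff prod_Basis_cart inner_axis mult.commute)

text \<open>Bump functions are products of one-variable functions, so both operators agree on them
  by definition. The set of agreement is a subspace, dense because it contains the bumps, and
  boundedness extends the agreement to \<open>f\<close>.\<close>

lemma is_tensor_op_unique:
  fixes A :: "'n::finite \<Rightarrow> (real \<Rightarrow> real) \<Rightarrow> (real \<Rightarrow> real)"
  assumes T1: "is_tensor_op A T1" and T2: "is_tensor_op A T2" and f: "f \<in> L2"
  shows "L2_eq (T1 f) (T2 f)"
proof -
  let ?W = "{f \<in> L2. L2_eq (T1 f) (T2 f)}"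
  have bl: "L2_bounded_linear T1" "L2_bounded_linear T2" using T1 T2 by (auto simp: is_tensor_op_def)
  have TL: "T1 k \<in> L2" "T2 k \<in> L2" if "k \<in> L2" for k using bl that by (simp_all add: L2_bounded_linear_def)
  have lin: "L2_eq (T (\<lambda>x. f x + c * h x)) (\<lambda>x. T f x + c * T h x)"
    if "L2_bounded_linear T" "f \<in> L2" "h \<in> L2" for T c and f h :: "real^'n \<Rightarrow> real"
  proof -
    have ch: "(\<lambda>x. c * h x) \<in> L2" by (rule L2_scale[OF that(3)])
    have "L2_eq (T (\<lambda>x. f x + c * h x)) (\<lambda>x. T f x + T (\<lambda>x. c * h x) x)"
      by (rule L2_bounded_linear_add[OF that(1,2) ch])
    also have "L2_eq \<dots> (\<lambda>x. T f x + c * T h x)"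
      by (rule L2_eq_add[OF L2_eq_refl L2_bounded_linear_scale[OF that(1,3)]])
    finally show ?thesis .
  qed
  have zero: "L2_eq (T (\<lambda>_. 0)) (\<lambda>_. 0)" if "L2_bounded_linear T" for T :: "(real^'n \<Rightarrow> real) \<Rightarrow> _"
  proof -
    have "L2_eq (T (\<lambda>x. 0 * (0::real))) (\<lambda>x. 0 * T (\<lambda>_. 0) x)"
      by (rule L2_bounded_linear_scale[OF that L2_0])
    then show ?thesis by simp
  qed
  have "L2_subspace ?W"
    unfolding L2_subspace_def
  proof (intro conjI ballI allI)
    show "(\<lambda>_. 0) \<in> ?W" using L2_eq_trans[OF zero[OF bl(1)] L2_eq_sym[OF zero[OF bl(2)]]] by simp
    fix f h c assume fh: "f \<in> ?W" "h \<in> ?W"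
    then have L: "f \<in> L2" "h \<in> L2" by auto
    have "L2_eq (T1 (\<lambda>x. f x + c * h x)) (\<lambda>x. T1 f x + c * T1 h x)" by (rule lin[OF bl(1) L])
    also have "L2_eq \<dots> (\<lambda>x. T2 f x + c * T2 h x)"
      by (intro L2_eq_add L2_eq_scale) (use fh in auto)
    also have "L2_eq \<dots> (T2 (\<lambda>x. f x + c * h x))" by (rule L2_eq_sym[OF lin[OF bl(2) L]])
    finally show "(\<lambda>x. f x + c * h x) \<in> ?W" using L by auto
  qed auto
  moreover have bump: "bump a b k \<in> ?W" for a b k
  proof -
    define h where "h m y = step (real k * y + (- real k * (a $ m) - 1)) * step (- real k * y + (real k * (b $ m) - 1))"
      for m :: 'n and y
    have "smooth (\<lambda>y::real. step (y \<bullet> real k + (- real k * (a $ m) - 1)) * step (y \<bullet> (- real k) + (real k * (b $ m) - 1)))" for m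
      by (intro smooth_mult smooth_compose_inner smooth_step)
    then have hL: "h m \<in> L2" for m
      unfolding h_def[abs_def] by (intro continuous_L2 smooth_continuous) (simp add: mult.commute)
    have bh: "bump a b k = (\<lambda>x. \<Prod>m\<in>UNIV. h m (x $ m))"
      unfolding bump_prodf h_def prodf_def[abs_def] ..
    have "L2_eq (T1 (bump a b k)) (\<lambda>x. \<Prod>m\<in>UNIV. A m (h m) (x $ m))"
      "L2_eq (T2 (bump a b k)) (\<lambda>x. \<Prod>m\<in>UNIV. A m (h m) (x $ m))"
      unfolding bh using T1 T2 hL unfolding is_tensor_op_def by blast+
    then have "L2_eq (T1 (bump a b k)) (T2 (bump a b k))" using L2_eq_trans L2_eq_sym by blast
    moreover have "bump a b k \<in> L2" by (intro continuous_L2 smooth_continuous smooth_bump)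
    ultimately show ?thesis by simp
  qed
  ultimately obtain w where w: "\<And>n. w n \<in> ?W" "L2_lim w f"
    using L2_dense[OF _ f L2_eq_0_if_orthogonal_to_bumps] by (metis (no_types, lifting))
  obtain C1 where C1: "\<And>f. f \<in> L2 \<Longrightarrow> L2_norm (T1 f) \<le> C1 * L2_norm f"
    using bl(1) unfolding L2_bounded_linear_def by blast
  obtain C2 where C2: "\<And>f. f \<in> L2 \<Longrightarrow> L2_norm (T2 f) \<le> C2 * L2_norm f"
    using bl(2) unfolding L2_bounded_linear_def by blast
  have wL: "w n \<in> L2" for n using w(1) by auto
  have "L2_norm (\<lambda>x. T1 f x - T2 f x) \<le> (C1 + C2) * L2_norm (\<lambda>x. w n x - f x)" for n
  proof -
    have "L2_norm (\<lambda>x. T1 f x - T2 f x) \<le> L2_norm (\<lambda>x. T1 f x - T1 (w n) x) + L2_norm (\<lambda>x. T1 (w n) x - T2 f x)"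
      by (intro L2_triangle_diff TL f wL)
    also have "L2_norm (\<lambda>x. T1 (w n) x - T2 f x) = L2_norm (\<lambda>x. T2 (w n) x - T2 f x)"
    proof (rule L2_norm_cong)
      have "L2_eq (T1 (w n)) (T2 (w n))" using w(1) by simp
      then show "L2_eq (\<lambda>x. T1 (w n) x - T2 f x) (\<lambda>x. T2 (w n) x - T2 f x)"
        unfolding L2_eq_def by (rule AE_mp) auto
    qed (intro L2_diff TL f wL)+
    also have "L2_norm (\<lambda>x. T1 f x - T1 (w n) x) \<le> C1 * L2_norm (\<lambda>x. f x - w n x)"
      by (rule L2_bounded_linear_diff[OF bl(1) C1 f wL])
    also have "L2_norm (\<lambda>x. T2 (w n) x - T2 f x) \<le> C2 * L2_norm (\<lambda>x. w n x - f x)"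
      by (rule L2_bounded_linear_diff[OF bl(2) C2 wL f])
    finally show ?thesis by (simp add: L2_norm_minus_commute[of f] algebra_simps)
  qed
  moreover have "(\<lambda>n. (C1 + C2) * L2_norm (\<lambda>x. w n x - f x)) \<longlonglongrightarrow> (C1 + C2) * 0"
    using w(2) by (intro tendsto_mult tendsto_const) (simp add: L2_lim_def)
  ultimately have "L2_norm (\<lambda>x. T1 f x - T2 f x) \<le> (C1 + C2) * 0" by (intro LIMSEQ_le_const) auto
  then have "L2_norm (\<lambda>x. T1 f x - T2 f x) = 0"
    using L2_norm_nonneg[of "\<lambda>x. T1 f x - T2 f x"] by simp
  then have "L2_eq (\<lambda>x. T1 f x - T2 f x) (\<lambda>_. 0)"
    using L2_norm_eq_0[of "\<lambda>x. T1 f x - T2 f x"] TL f by auto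
  then show ?thesis by (simp add: L2_eq_diff_0)
qed

section \<open>Square-integrable forms\<close>

abbreviation comp :: "(real^'n::_ \<Rightarrow> 'n::{finite,linorder} biform) \<Rightarrow> 'n set \<times> 'n set \<Rightarrow> real^'n::_ \<Rightarrow> real" where
  "comp u q \<equiv> (\<lambda>x. cf (u x) q)"

lemma L2_forms_mono: "V \<subseteq> W \<Longrightarrow> L2_forms V \<subseteq> L2_forms W"
  unfolding L2_forms_def by (auto elim: eventually_mono)

lemma L2_forms_nth: "u \<in> L2_forms V \<Longrightarrow> (\<lambda>x. u x vs ws) \<in> L2"
  by (simp add: L2_forms_def)

lemma L2_forms_comp: "u \<in> L2_forms V \<Longrightarrow> comp u q \<in> L2"
  by (simp add: L2_forms_def cf_def coeff_def)

lemma form_norm_comp: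
  assumes "\<And>q. comp u q \<in> L2"
  shows "(form_norm u)\<^sup>2 = (\<Sum>q\<in>UNIV. (L2_norm (comp u q))\<^sup>2)"
proof -
  have "(\<integral>x. form_inner (u x) (u x) \<partial>cube) = (\<Sum>q\<in>UNIV. ip (comp u q) (comp u q))"
    unfolding form_inner_cf ip_def by (rule Bochner_Integration.integral_sum) (intro L2_mult assms)
  then have "form_norm u = sqrt (\<Sum>q\<in>UNIV. ip (comp u q) (comp u q))" by (simp add: form_norm_def)
  then show ?thesis by (simp add: L2_norm_square sum_nonneg ip_self_nonneg)
qed

lemma form_norm_nonneg:
  assumes "\<And>q. comp u q \<in> L2"
  shows "0 \<le> form_norm u"
proof -
  have "(\<integral>x. form_inner (u x) (u x) \<partial>cube) = (\<Sum>q\<in>UNIV. ip (comp u q) (comp u q))"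
    unfolding form_inner_cf ip_def by (rule Bochner_Integration.integral_sum) (intro L2_mult assms)
  then show ?thesis by (simp add: form_norm_def sum_nonneg ip_self_nonneg)
qed

lemma cf_regular: "cf (regular u \<phi>) q = ip (comp u q) \<phi>"
  by (simp add: cf_def coeff_def regular_def ip_def)

lemma linear_ip:
  fixes F :: "'v::real_vector \<Rightarrow> 'a::euclidean_space \<Rightarrow> real"
  assumes F: "\<And>v. F v \<in> L2" and lin: "AE x in cube. linear (\<lambda>v. F v x)" and \<phi>: "\<phi> \<in> L2"
  shows "linear (\<lambda>v. ip (F v) \<phi>)"
proof (rule linearI)
  fix v w and c :: real
  have "L2_eq (F (v + w)) (\<lambda>x. F v x + F w x)"
    unfolding L2_eq_def using lin by (rule AE_mp) (intro AE_I2 impI, rule linear_add)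
  then have "ip (F (v + w)) \<phi> = ip (\<lambda>x. F v x + F w x) \<phi>"
    by (rule ip_cong) (auto intro: F \<phi>)
  then show "ip (F (v + w)) \<phi> = ip (F v) \<phi> + ip (F w) \<phi>" by (simp add: ip_add_left F \<phi>)
  have "L2_eq (F (c *\<^sub>R v)) (\<lambda>x. c * F v x)"
    unfolding L2_eq_def using lin
    by (rule AE_mp) (intro AE_I2 impI, drule linear_scale[of _ c v], simp)
  then have "ip (F (c *\<^sub>R v)) \<phi> = ip (\<lambda>x. c * F v x) \<phi>"
    by (rule ip_cong) (auto intro: F \<phi>)
  then show "ip (F (c *\<^sub>R v)) \<phi> = c *\<^sub>R ip (F v) \<phi>" by (simp add: ip_scale_left)
qed

lemma ip_AE_0:
  assumes "f \<in> L2" "AE x in cube. f x = 0" "\<phi> \<in> L2"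
  shows "ip f \<phi> = 0"
  using ip_cong[of f "\<lambda>_. 0" \<phi>] assms by (simp add: L2_eq_def)

text \<open>The exceptional null set is the same for all vectors, because the assumption is
  membership of the whole form; each alternation rule can therefore be integrated.\<close>

lemma Alt_ip:
  assumes L: "\<And>vs. (\<lambda>x. \<alpha> x vs) \<in> L2" and A: "AE x in cube. \<alpha> x \<in> Alt k" and \<phi>: "\<phi> \<in> L2"
  shows "(\<lambda>vs. ip (\<lambda>x. \<alpha> x vs) \<phi>) \<in> Alt k"
proof (rule AltI)
  fix vs :: "(real^'a) list" assume "int (length vs) \<noteq> k"
  then have "AE x in cube. \<alpha> x \<in> Alt k \<longrightarrow> \<alpha> x vs = 0" by (auto intro!: AE_I2 Alt_length)
  then show "ip (\<lambda>x. \<alpha> x vs) \<phi> = 0" by (intro ip_AE_0[OF L _ \<phi>]) (rule AE_mp[OF A])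
next
  fix xs ys show "linear (\<lambda>v. ip (\<lambda>x. \<alpha> x (xs @ v # ys)) \<phi>)"
    by (rule linear_ip[OF L AE_mp[OF A] \<phi>]) (auto intro!: AE_I2 Alt_linear)
next
  fix xs v ys zs show "ip (\<lambda>x. \<alpha> x (xs @ v # ys @ v # zs)) \<phi> = 0"
    by (rule ip_AE_0[OF L AE_mp[OF A] \<phi>]) (auto intro!: AE_I2 Alt_repeat)
qed

lemma regular_in_Alt2:
  assumes u: "u \<in> L2_forms (Alt2 k l)" and \<phi>: "\<phi> \<in> L2"
  shows "regular u \<phi> \<in> Alt2 k l"
proof -
  have A: "AE x in cube. u x \<in> Alt2 k l" using u by (simp add: L2_forms_def)
  have "(\<lambda>vs. ip (\<lambda>x. u x vs ws) \<phi>) \<in> Alt k" for ws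
    by (rule Alt_ip[of "\<lambda>x vs. u x vs ws", OF L2_forms_nth[OF u] AE_mp[OF A] \<phi>])
      (auto intro!: AE_I2 Alt2_Alt(2))
  moreover have "(\<lambda>ws. ip (\<lambda>x. u x vs ws) \<phi>) \<in> Alt l" for vs
    by (rule Alt_ip[of "\<lambda>x. u x vs", OF L2_forms_nth[OF u] AE_mp[OF A] \<phi>])
      (auto intro!: AE_I2 Alt2_Alt(1))
  moreover have "regular u \<phi> = (\<lambda>vs ws. ip (\<lambda>x. u x vs ws) \<phi>)"
    by (simp add: fun_eq_iff regular_def ip_def)
  ultimately show ?thesis by (simp add: Alt2_def)
qed

subsection \<open>Coefficients of the BGG operators\<close>

text \<open>\<open>F u\<close> is a differential operator with constant coefficients applied to \<open>u\<close>, such that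
  the weight of a form minus the multi-order of differentiation is preserved.\<close>

definition weighted_diff_op :: "(real^'n::_ \<Rightarrow> 'n::{finite,linorder} biform) set \<Rightarrow> int \<Rightarrow> int \<Rightarrow>
    ((real^'n::_ \<Rightarrow> 'n biform) \<Rightarrow> 'n form_distr) \<Rightarrow> bool" where
  "weighted_diff_op U k l F \<longleftrightarrow> (\<forall>u\<in>U. \<forall>\<phi>\<in>test_functions. F u \<phi> \<in> Alt2 k l) \<and>
     (\<exists>MS c. finite MS \<and>
       (\<forall>p ms q. c p ms q \<noteq> 0 \<longrightarrow> weight p = (\<lambda>m. weight q m + count_list ms m)) \<and>
       (\<forall>u\<in>U. \<forall>\<phi>\<in>test_functions. \<forall>p. cf (F u \<phi>) p =
          (\<Sum>ms\<in>MS. \<Sum>q\<in>UNIV. c p ms q * ip (comp u q) (foldr pd (axes ms) \<phi>))))"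

lemma weighted_diff_opE:
  assumes "weighted_diff_op U k l F"
  obtains MS c where "finite MS"
    "\<And>p ms q. c p ms q \<noteq> 0 \<Longrightarrow> weight p = (\<lambda>m. weight q m + count_list ms m)"
    "\<And>u \<phi> p. u \<in> U \<Longrightarrow> \<phi> \<in> test_functions \<Longrightarrow> cf (F u \<phi>) p =
          (\<Sum>ms\<in>MS. \<Sum>q\<in>UNIV. c p ms q * ip (comp u q) (foldr pd (axes ms) \<phi>))"
proof -
  from assms obtain MS c where *: "finite MS"
    "\<forall>p ms q. c p ms q \<noteq> 0 \<longrightarrow> weight p = (\<lambda>m. weight q m + count_list ms m)"
    "\<forall>u\<in>U. \<forall>\<phi>\<in>test_functions. \<forall>p. cf (F u \<phi>) p =
      (\<Sum>ms\<in>MS. \<Sum>q\<in>UNIV. c p ms q * ip (comp u q) (foldr pd (axes ms) \<phi>))"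
    unfolding weighted_diff_op_def by (elim conjE exE)
  show ?thesis by (rule that[of MS c, OF *(1)]) (use *(2,3) in \<open>simp_all del: split_paired_All\<close>)
qed

lemma weighted_diff_op_Alt2:
  "weighted_diff_op U k l F \<Longrightarrow> u \<in> U \<Longrightarrow> \<phi> \<in> test_functions \<Longrightarrow> F u \<phi> \<in> Alt2 k l"
  by (simp add: weighted_diff_op_def)

lemma weighted_diff_op_regular:
  "weighted_diff_op (L2_forms (Alt2 k l) :: (real^'n::_ \<Rightarrow> 'n::{finite,linorder} biform) set) k l regular"
  unfolding weighted_diff_op_def
proof (intro conjI ballI exI[of _ "{[]}"] exI[of _ "\<lambda>p ms q. if ms = [] \<and> p = q then 1 else 0"] allI impI)
  fix u :: "real^'n::_ \<Rightarrow> 'n biform" and \<phi> :: "real^'n::_ \<Rightarrow> real" and p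
  show "cf (regular u \<phi>) p = (\<Sum>ms\<in>{[]}. \<Sum>q\<in>UNIV. (if ms = [] \<and> p = q then 1 else 0) * ip (comp u q) (foldr pd (axes ms) \<phi>))"
    by (simp add: cf_regular if_distrib[of "\<lambda>x. x * _"] cong: if_cong)
qed (auto intro: regular_in_Alt2 test_functions_L2 split: if_splits)

text \<open>The coefficients are multiplied by the matrix of \<open>A\<close>; a nonzero product
  passes through an intermediate index of the same weight as the row.\<close>

lemma weighted_diff_op_app:
  fixes F :: "(real^'n::_ \<Rightarrow> 'n::{finite,linorder} biform) \<Rightarrow> 'n form_distr"
  assumes F: "weighted_diff_op U k l F" and A: "weight_shift (\<lambda>_. 0) (Alt2 k l) A"
    "\<And>\<mu>. \<mu> \<in> Alt2 k l \<Longrightarrow> A \<mu> \<in> Alt2 k' l'"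
  shows "weighted_diff_op U k' l' (\<lambda>u. app_distr A (F u))"
proof -
  obtain MS c where c: "finite MS"
    "\<And>p ms q. c p ms q \<noteq> 0 \<Longrightarrow> weight p = (\<lambda>m. weight q m + count_list ms m)"
    "\<And>u \<phi> p. u \<in> U \<Longrightarrow> \<phi> \<in> test_functions \<Longrightarrow> cf (F u \<phi>) p =
          (\<Sum>ms\<in>MS. \<Sum>q\<in>UNIV. c p ms q * ip (comp u q) (foldr pd (axes ms) \<phi>))"
    using F by (rule weighted_diff_opE) (rule that)
  obtain K where K: "\<And>\<mu> p. \<mu> \<in> Alt2 k l \<Longrightarrow> cf (A \<mu>) p = (\<Sum>q\<in>UNIV. K p q * cf \<mu> q)"
    "\<And>p q. K p q \<noteq> 0 \<Longrightarrow> weight p = weight q"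
    using A(1) unfolding weight_shift_def by auto
  define c' where "c' p ms q = (\<Sum>r\<in>UNIV. K p r * c r ms q)" for p ms q
  show ?thesis unfolding weighted_diff_op_def app_distr_def
  proof (intro conjI ballI exI[of _ MS] exI[of _ c'] allI impI c(1))
    show "A (F u \<phi>) \<in> Alt2 k' l'" if "u \<in> U" "\<phi> \<in> test_functions" for u \<phi>
      by (intro A(2) weighted_diff_op_Alt2[OF F] that)
    fix p ms q assume "c' p ms q \<noteq> 0"
    then obtain r where "K p r * c r ms q \<noteq> 0"
      unfolding c'_def by (rule sum.not_neutral_contains_not_neutral)
    then show "weight p = (\<lambda>m. weight q m + count_list ms m)" using K(2)[of p r] c(2)[of r ms q] by auto
  next
    fix u p and \<phi> :: "real^'n::_ \<Rightarrow> real" assume u: "u \<in> U" and \<phi>: "\<phi> \<in> test_functions"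
    let ?I = "\<lambda>q ms. ip (comp u q) (foldr pd (axes ms) \<phi>)"
    have "cf (A (F u \<phi>)) p = (\<Sum>r\<in>UNIV. \<Sum>ms\<in>MS. \<Sum>q\<in>UNIV. K p r * c r ms q * ?I q ms)"
      unfolding K(1)[OF weighted_diff_op_Alt2[OF F u \<phi>]] c(3)[OF u \<phi>] by (simp only: sum_distrib_left mult.assoc)
    also have "\<dots> = (\<Sum>ms\<in>MS. \<Sum>r\<in>UNIV. \<Sum>q\<in>UNIV. K p r * c r ms q * ?I q ms)" by (rule sum.swap)
    also have "\<dots> = (\<Sum>ms\<in>MS. \<Sum>q\<in>UNIV. \<Sum>r\<in>UNIV. K p r * c r ms q * ?I q ms)"
      by (intro sum.cong[OF refl] sum.swap)
    also have "\<dots> = (\<Sum>ms\<in>MS. \<Sum>q\<in>UNIV. c' p ms q * ?I q ms)"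
      by (simp only: c'_def sum_distrib_right)
    finally show "cf (A (F u \<phi>)) p = \<dots>" .
  qed
qed

lemma d_distr_wedge1:
  "d_distr T \<phi> = (\<lambda>vs ws. \<Sum>m\<in>UNIV. - 1 * wedge1 m (T (pd (axis m 1) \<phi>)) vs ws)"
  by (auto simp: fun_eq_iff d_distr_def pd_distr_def wedge1_def dx_wedge_def sum_negf)

text \<open>Differentiating in direction \<open>m\<close> and wedging with dx^m raise the order and
  the weight in the same coordinate, so the balance is kept. The sign comes from moving the
  derivative to the test function.\<close>

lemma weighted_diff_op_d:
  fixes F :: "(real^'n::_ \<Rightarrow> 'n::{finite,linorder} biform) \<Rightarrow> 'n form_distr"
  assumes F: "weighted_diff_op U k l F"
  shows "weighted_diff_op U (k + 1) l (\<lambda>u. d_distr (F u))"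
proof -
  obtain MS c where c: "finite MS"
    "\<And>p ms q. c p ms q \<noteq> 0 \<Longrightarrow> weight p = (\<lambda>m. weight q m + count_list ms m)"
    "\<And>u \<phi> p. u \<in> U \<Longrightarrow> \<phi> \<in> test_functions \<Longrightarrow> cf (F u \<phi>) p =
          (\<Sum>ms\<in>MS. \<Sum>q\<in>UNIV. c p ms q * ip (comp u q) (foldr pd (axes ms) \<phi>))"
    using F by (rule weighted_diff_opE) (rule that)
  define W where "W m K \<longleftrightarrow> (\<forall>\<mu>\<in>Alt2 k l. \<forall>p. cf (wedge1 m \<mu>) p = (\<Sum>q\<in>UNIV. K p q * cf \<mu> q)) \<and>
     (\<forall>p q. K p q \<noteq> 0 \<longrightarrow> weight p = (\<lambda>m'. weight q m' + (if m' = m then 1 else 0)))"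
    for m :: 'n and K :: "'n set \<times> 'n set \<Rightarrow> 'n set \<times> 'n set \<Rightarrow> real"
  have "\<forall>m. \<exists>K. W m K"
    using weight_shift_wedge1[of _ k l, where 'n = 'n] unfolding weight_shift_def W_def by blast
  then obtain K where "\<And>m. W m (K m)" by metis
  then have K: "\<And>m \<mu> p. \<mu> \<in> Alt2 k l \<Longrightarrow> cf (wedge1 m \<mu>) p = (\<Sum>q\<in>UNIV. K m p q * cf \<mu> q)"
    "\<And>m p q. K m p q \<noteq> 0 \<Longrightarrow> weight p = (\<lambda>m'. weight q m' + (if m' = m then 1 else 0))"
    unfolding W_def by blast+
  let ?s = "\<lambda>(ms, m::'n). ms @ [m]"
  \<comment> \<open>Evaluating \<open>F u\<close> at a differentiated test function appends the new
    direction at the end of the list, where \<open>foldr\<close> applies it first; the empty list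
    does not occur and gets 0.\<close>
  define c' where "c' p ms q = (if ms = [] then 0 else \<Sum>r\<in>UNIV. - K (last ms) p r * c r (butlast ms) q)" for p ms q
  show ?thesis unfolding weighted_diff_op_def
  proof (intro conjI ballI exI[of _ "?s ` (MS \<times> UNIV)"] exI[of _ c'] allI impI)
    show "finite (?s ` (MS \<times> UNIV))" using c(1) by simp
    show "d_distr (F u) \<phi> \<in> Alt2 (k + 1) l" if "u \<in> U" "\<phi> \<in> test_functions" for u \<phi>
      unfolding d_distr_wedge1
      by (intro Alt2_sum Alt2_scale wedge1_in_Alt2 weighted_diff_op_Alt2[OF F] that test_functions_pd axis_in_Basis)
    fix p ms q assume nz: "c' p ms q \<noteq> 0"
    then have "ms \<noteq> []" "(\<Sum>r\<in>UNIV. - K (last ms) p r * c r (butlast ms) q) \<noteq> 0"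
      by (auto simp: c'_def split: if_splits)
    then obtain r where "- K (last ms) p r * c r (butlast ms) q \<noteq> 0"
      by (elim sum.not_neutral_contains_not_neutral)
    then have 1: "weight p = (\<lambda>m'. weight r m' + (if m' = last ms then 1 else 0))"
      "weight r = (\<lambda>m. weight q m + count_list (butlast ms) m)"
      using K(2)[of "last ms" p r] c(2)[of r "butlast ms" q] by auto
    have "count_list (butlast ms @ [last ms]) m' = count_list (butlast ms) m' + (if m' = last ms then 1 else 0)" for m'
      by simp
    then have "count_list ms m' = count_list (butlast ms) m' + (if m' = last ms then 1 else 0)" for m'
      using \<open>ms \<noteq> []\<close> by simp
    then show "weight p = (\<lambda>m. weight q m + count_list ms m)"
      unfolding 1 by (simp add: fun_eq_iff)
  next
    fix u p and \<phi> :: "real^'n::_ \<Rightarrow> real" assume u: "u \<in> U" and \<phi>: "\<phi> \<in> test_functions"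
    let ?I = "\<lambda>q ms. ip (comp u q) (foldr pd (axes ms) \<phi>)"
    have pdT: "pd (axis m 1) \<phi> \<in> test_functions" for m :: 'n by (rule test_functions_pd[OF \<phi> axis_in_Basis])
    have "cf (d_distr (F u) \<phi>) p = (\<Sum>m\<in>UNIV. - 1 * (\<Sum>r\<in>UNIV. K m p r * cf (F u (pd (axis m 1) \<phi>)) r))"
      unfolding d_distr_wedge1 cf_sum cf_scale K(1)[OF weighted_diff_op_Alt2[OF F u pdT]] ..
    also have "\<dots> = (\<Sum>m\<in>UNIV. \<Sum>r\<in>UNIV. \<Sum>ms\<in>MS. \<Sum>q\<in>UNIV. - K m p r * c r ms q * ?I q (ms @ [m]))"
      unfolding c(3)[OF u pdT] by (simp add: sum_distrib_left sum_negf mult.assoc)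
    also have "\<dots> = (\<Sum>m\<in>UNIV. \<Sum>ms\<in>MS. \<Sum>r\<in>UNIV. \<Sum>q\<in>UNIV. - K m p r * c r ms q * ?I q (ms @ [m]))"
      by (intro sum.cong[OF refl] sum.swap)
    also have "\<dots> = (\<Sum>m\<in>UNIV. \<Sum>ms\<in>MS. \<Sum>q\<in>UNIV. \<Sum>r\<in>UNIV. - K m p r * c r ms q * ?I q (ms @ [m]))"
      by (intro sum.cong[OF refl] sum.swap)
    also have "\<dots> = (\<Sum>m\<in>UNIV. \<Sum>ms\<in>MS. \<Sum>q\<in>UNIV. c' p (ms @ [m]) q * ?I q (ms @ [m]))"
      by (simp add: c'_def sum_distrib_right)
    also have "\<dots> = (\<Sum>ms\<in>MS. \<Sum>m\<in>UNIV. \<Sum>q\<in>UNIV. c' p (ms @ [m]) q * ?I q (ms @ [m]))"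
      by (rule sum.swap)
    also have "\<dots> = (\<Sum>x\<in>MS \<times> UNIV. \<Sum>q\<in>UNIV. c' p (?s x) q * ?I q (?s x))"
      by (subst sum.cartesian_product, rule sum.cong) auto
    also have "\<dots> = (\<Sum>ms\<in>?s ` (MS \<times> UNIV). \<Sum>q\<in>UNIV. c' p ms q * ?I q ms)"
      by (subst sum.reindex) (auto simp: inj_on_def)
    finally show "cf (d_distr (F u) \<phi>) p = \<dots>" .
  qed
qed

text \<open>All three forms of the operator are composed of d and of an algebraic map preserving
  weights, the projection or the inverse of s.\<close>

lemma weighted_diff_op_BGG:
  "weighted_diff_op (L2_forms (Alt2 k (ldeg J k))) (k + 1) (ldeg J (k + 1)) (\<lambda>u. BGG J k (regular u))"
proof -
  consider "k < J - 1" | "k = J - 1" | "k \<ge> J" by linarith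
  then show ?thesis
  proof cases
    case 1
    have "weighted_diff_op (L2_forms (Alt2 k (J - 1))) (k + 1) (J - 1)
        (\<lambda>u. app_distr (perp_proj J k) (d_distr (regular u)))"
      by (rule weighted_diff_op_app[OF weighted_diff_op_d[OF weighted_diff_op_regular] weight_shift_perp_proj])
        (rule s_range_perp_Alt2[OF perp_proj(1)])
    then show ?thesis using 1 by (simp add: BGG_def ldeg_def)
  next
    case 2
    have "weighted_diff_op (L2_forms (Alt2 (J - 1) (J - 1))) (J - 1 + 1) (J - 1) (\<lambda>u. d_distr (regular u))"
      by (rule weighted_diff_op_d[OF weighted_diff_op_regular])
    then have "weighted_diff_op (L2_forms (Alt2 (J - 1) (J - 1))) J (J - 1) (\<lambda>u. d_distr (regular u))"
      by simp
    then have "weighted_diff_op (L2_forms (Alt2 (J - 1) (J - 1))) (J - 1) J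
        (\<lambda>u. app_distr (s_inv J) (d_distr (regular u)))"
      by (rule weighted_diff_op_app[OF _ weight_shift_s_inv s_inv(1)])
    from weighted_diff_op_d[OF this] show ?thesis
      using 2 by (simp add: BGG_def ldeg_def s_inv_def)
  next
    case 3
    then show ?thesis
      using weighted_diff_op_d[OF weighted_diff_op_regular[of k J]] by (simp add: BGG_def ldeg_def)
  qed
qed

text \<open>Test functions separate L2 coefficients, so the choice made in \<open>H_norm\<close>
  does not affect its value.\<close>

lemma is_BGG_L2_form_norm_unique:
  fixes v v' :: "real^'n::_ \<Rightarrow> 'n::{finite,linorder} biform"
  assumes "is_BGG_L2 J k u v" "is_BGG_L2 J k u v'"
  shows "form_norm v = form_norm v'"
proof -
  have L: "v \<in> L2_forms (EE J (k + 1))" "v' \<in> L2_forms (EE J (k + 1))"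
    using assms by (auto simp: is_BGG_L2_def)
  have eq: "L2_eq (comp v q) (comp v' q)" for q
  proof (rule L2_eq_if_equal_on_tests)
    fix \<phi> :: "real^'n::_ \<Rightarrow> real" assume "\<phi> \<in> test_functions"
    then have "regular v \<phi> = regular v' \<phi>" using assms unfolding is_BGG_L2_def by metis
    then show "ip (comp v q) \<phi> = ip (comp v' q) \<phi>" by (simp add: cf_regular[symmetric])
  qed (rule L2_forms_comp[OF L(1)] L2_forms_comp[OF L(2)])+
  have "L2_norm (comp v q) = L2_norm (comp v' q)" for q
    by (rule L2_norm_cong[OF eq L2_forms_comp[OF L(1)] L2_forms_comp[OF L(2)]])
  then have "(form_norm v)\<^sup>2 = (form_norm v')\<^sup>2"
    using form_norm_comp[of v, OF L2_forms_comp[OF L(1)]] form_norm_comp[of v', OF L2_forms_comp[OF L(2)]] by simp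
  then show ?thesis
    using form_norm_nonneg[of v, OF L2_forms_comp[OF L(1)]] form_norm_nonneg[of v', OF L2_forms_comp[OF L(2)]]
    by simp
qed

section \<open>The tensor product quasi-interpolation\<close>

lemma weight_le_2: "weight q m \<le> 2"
  by (auto simp: weight_def indicator_def)

locale quasi_interp_tensor = dual_systems N e g M
  for N :: "'n::{finite,linorder} \<Rightarrow> nat \<Rightarrow> nat" and e g M +
  fixes p :: "'n \<Rightarrow> nat \<Rightarrow> nat \<Rightarrow> (real \<Rightarrow> real) \<Rightarrow> (real \<Rightarrow> real)"
  assumes p: "\<And>m i j f. i \<in> {0,1} \<Longrightarrow> j \<in> {0,1} \<Longrightarrow> f \<in> L2 \<Longrightarrow>
    L2_eq (p m i j f) (fin_rank (N m (i + j)) (e m (i + j)) (g m (i + j)) f)"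
begin

definition Q :: "'n set \<times> 'n set \<Rightarrow> (real^'n::_ \<Rightarrow> real) \<Rightarrow> real^'n::_ \<Rightarrow> real" where
  "Q q = tensor_op (\<lambda>m. p m (indicator (fst q) m) (indicator (snd q) m))"

lemma Q_tensor_op:
  "is_tensor_op (\<lambda>m. p m (indicator (fst q) m) (indicator (snd q) m)) (T (weight q))"
  "is_tensor_op (\<lambda>m. p m (indicator (fst q) m) (indicator (snd q) m)) (Q q)"
proof -
  show T: "is_tensor_op (\<lambda>m. p m (indicator (fst q) m) (indicator (snd q) m)) (T (weight q))"
    unfolding weight_def[abs_def]
  proof (rule T_is_tensor_op)
    show "indicator (fst q) k + indicator (snd q) k \<le> (2::nat)" for k by (auto simp: indicator_def)
    show "L2_eq (p m (indicator (fst q) m) (indicator (snd q) m) f)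
        (fin_rank (N m (indicator (fst q) m + indicator (snd q) m))
          (e m (indicator (fst q) m + indicator (snd q) m)) (g m (indicator (fst q) m + indicator (snd q) m)) f)"
      if "f \<in> L2" for m f by (rule p[OF _ _ that]) (auto simp: indicator_def)
  qed
  then show "is_tensor_op (\<lambda>m. p m (indicator (fst q) m) (indicator (snd q) m)) (Q q)"
    unfolding Q_def tensor_op_def
    by (rule someI[of "is_tensor_op (\<lambda>m. p m (indicator (fst q) m) (indicator (snd q) m))"])
qed

text \<open>Up to null sets, the operator on the component \<open>q\<close> depends on
  \<open>q\<close> through its weight alone.\<close>

lemma Q_eq_T: "f \<in> L2 \<Longrightarrow> L2_eq (Q q f) (T (weight q) f)"
  by (rule is_tensor_op_unique[OF Q_tensor_op(2) Q_tensor_op(1)])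

lemma Q_bounded_linear: "L2_bounded_linear (Q q)"
  using Q_tensor_op(2) by (simp add: is_tensor_op_def)

lemma Q_L2: "f \<in> L2 \<Longrightarrow> Q q f \<in> L2"
  using Q_bounded_linear by (simp add: L2_bounded_linear_def)

lemma pi_tensor_Q:
  "pi_tensor p k l u x = (\<lambda>vs ws. \<Sum>q\<in>degs k l. Q q (comp u q) x * dx2 q vs ws)"
proof -
  have "degs k l = {\<sigma>::'n set. int (card \<sigma>) = k} \<times> {\<tau>. int (card \<tau>) = l}"
    by (auto simp: degs_def)
  then show ?thesis
    by (auto simp: fun_eq_iff pi_tensor_def Q_def dx2_def cf_def sum.cartesian_product case_prod_beta mult.assoc)
qed

lemma cf_pi_tensor: "cf (pi_tensor p k l u x) q = (if q \<in> degs k l then Q q (comp u q) x else 0)"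
proof -
  have "cf (pi_tensor p k l u x) q = (\<Sum>r\<in>degs k l. if q = r then Q r (comp u r) x else 0)"
    unfolding pi_tensor_Q cf_sum cf_scale by (rule sum.cong) (auto simp: cf_dx2)
  then show ?thesis by (simp add: sum.delta')
qed

lemma pi_tensor_in_Alt2: "pi_tensor p k l u x \<in> Alt2 k l"
  unfolding pi_tensor_Q by (intro Alt2_sum Alt2_scale dx2_in_Alt2)

lemma pi_tensor_L2_forms:
  assumes "\<And>q. comp u q \<in> L2"
  shows "pi_tensor p k l u \<in> L2_forms (Alt2 k l)"
proof -
  have "(\<lambda>x. \<Sum>q\<in>degs k l. dx2 q vs ws * Q q (comp u q) x) \<in> L2" for vs ws
    by (intro L2_sum L2_scale Q_L2 assms)
  then have "(\<lambda>x. pi_tensor p k l u x vs ws) \<in> L2" for vs ws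
    unfolding pi_tensor_Q by (simp add: mult.commute)
  then show ?thesis by (simp add: L2_forms_def pi_tensor_in_Alt2)
qed

lemma pi_tensor_bound:
  "\<exists>C>0. \<forall>u. (\<forall>q. comp u q \<in> L2) \<longrightarrow> form_norm (pi_tensor p k l u) \<le> C * form_norm u"
proof -
  have "\<forall>q. \<exists>C. \<forall>f\<in>L2. L2_norm (Q q f) \<le> C * L2_norm f"
    using Q_bounded_linear by (simp add: L2_bounded_linear_def)
  then obtain B where B: "\<And>q f. f \<in> L2 \<Longrightarrow> L2_norm (Q q f) \<le> B q * L2_norm f" by metis
  \<comment> \<open>The added 1 makes the constant positive whatever the individual bounds
    \<open>B q\<close> are.\<close>
  define C where "C = 1 + (\<Sum>q\<in>UNIV. \<bar>B q\<bar>)"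
  have C: "C > 0" unfolding C_def by (intro add_pos_nonneg sum_nonneg) auto
  have BC: "B q \<le> C" for q
    using member_le_sum[of q UNIV "\<lambda>q. \<bar>B q\<bar>"] unfolding C_def by auto
  have "form_norm (pi_tensor p k l u) \<le> C * form_norm u" if u: "\<forall>q. comp u q \<in> L2" for u
  proof (rule power2_le_imp_le)
    note piL = L2_forms_comp[OF pi_tensor_L2_forms[of u k l, OF u[rule_format]]]
    have "L2_norm (comp (pi_tensor p k l u) q) \<le> C * L2_norm (comp u q)" for q
    proof (cases "q \<in> degs k l")
      case True
      have "L2_norm (Q q (comp u q)) \<le> B q * L2_norm (comp u q)" using B u by blast
      also have "\<dots> \<le> C * L2_norm (comp u q)" by (rule mult_right_mono[OF BC]) simp
      finally show ?thesis using True by (simp add: cf_pi_tensor)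
    next
      case False
      then have "L2_norm (comp (pi_tensor p k l u) q) = 0" by (simp add: cf_pi_tensor L2_norm_def)
      then show ?thesis using C by simp
    qed
    then have "(L2_norm (comp (pi_tensor p k l u) q))\<^sup>2 \<le> C\<^sup>2 * (L2_norm (comp u q))\<^sup>2" for q
      unfolding power_mult_distrib[symmetric] by (rule power_mono) simp
    then have "(form_norm (pi_tensor p k l u))\<^sup>2 \<le> (\<Sum>q\<in>UNIV. C\<^sup>2 * (L2_norm (comp u q))\<^sup>2)"
      unfolding form_norm_comp[of "pi_tensor p k l u", OF piL] by (intro sum_mono)
    also have "\<dots> = (C * form_norm u)\<^sup>2"
      unfolding power_mult_distrib form_norm_comp[of u, OF u[rule_format]] by (rule sum_distrib_left[symmetric])
    finally show "(form_norm (pi_tensor p k l u))\<^sup>2 \<le> (C * form_norm u)\<^sup>2" .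
    show "0 \<le> C * form_norm u" using C form_norm_nonneg[of u] u by simp
  qed
  then show ?thesis using C by blast
qed

text \<open>All inner products defining \<open>T w f\<close> vanish, so the result is 0 at every
  point and not merely almost everywhere.\<close>

lemma T_cong_0:
  assumes "\<And>m. w m \<le> 2" "f \<in> L2" "AE x in cube. f x = 0"
  shows "T w f = (\<lambda>_. 0)"
  unfolding T_def[abs_def]
  by (intro ext sum.neutral ballI) (simp add: ip_AE_0[OF assms(2,3) D_L2[OF assms(1)]])

lemma T_sum:
  assumes w: "\<And>m. w m \<le> 2" and f: "\<And>i. i \<in> I \<Longrightarrow> f i \<in> L2"
  shows "T w (\<lambda>x. \<Sum>i\<in>I. c i * f i x) x = (\<Sum>i\<in>I. c i * T w (f i) x)"
proof -
  have "T w (\<lambda>x. \<Sum>i\<in>I. c i * f i x) x =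
      (\<Sum>\<alpha>\<in>Idx w. \<Sum>i\<in>I. c i * (ip (f i) (D w (\<lambda>_. 0) \<alpha>) * E w \<alpha> x))"
    unfolding T_def
  proof (rule sum.cong[OF refl])
    fix \<alpha> assume "\<alpha> \<in> Idx w"
    then have "ip (\<lambda>x. \<Sum>i\<in>I. c i * f i x) (D w (\<lambda>_. 0) \<alpha>) = (\<Sum>i\<in>I. c i * ip (f i) (D w (\<lambda>_. 0) \<alpha>))"
      using f D_L2[OF w] by (subst ip_sum_left) (auto simp: ip_scale_left)
    then show "ip (\<lambda>x. \<Sum>i\<in>I. c i * f i x) (D w (\<lambda>_. 0) \<alpha>) * E w \<alpha> x =
        (\<Sum>i\<in>I. c i * (ip (f i) (D w (\<lambda>_. 0) \<alpha>) * E w \<alpha> x))"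
      by (simp add: sum_distrib_right mult.assoc)
  qed
  also have "\<dots> = (\<Sum>i\<in>I. c i * T w (f i) x)"
    unfolding T_def sum_distrib_left by (rule sum.swap)
  finally show ?thesis .
qed

lemma comp_outside:
  assumes "u \<in> L2_forms (Alt2 k l)" "q \<notin> degs k l"
  shows "AE x in cube. comp u q x = 0"
  using assms(1) unfolding L2_forms_def
  by (auto intro: cf_outside[OF _ assms(2)] elim!: eventually_mono)

text \<open>For indices outside the degrees both sides vanish, so later sums may run over all
  indices.\<close>

lemma comp_pi_tensor:
  assumes u: "u \<in> L2_forms (Alt2 k l)"
  shows "L2_eq (comp (pi_tensor p k l u) q) (T (weight q) (comp u q))"
proof (cases "q \<in> degs k l")
  case True
  then show ?thesis using Q_eq_T[OF L2_forms_comp[OF u]] by (simp add: cf_pi_tensor)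
next
  case False
  then show ?thesis
    using T_cong_0[where w = "weight q", OF weight_le_2 L2_forms_comp[OF u] comp_outside[OF u False]]
    by (simp add: cf_pi_tensor)
qed

text \<open>Each defining equation of the space involves components of one weight only, so the
  operator \<open>T\<close> of that weight can be taken out of the equation by linearity.\<close>

lemma pi_tensor_EE:
  assumes u: "u \<in> L2_forms (EE J k)"
  shows "pi_tensor p k (ldeg J k) u \<in> L2_forms (EE J k)"
proof -
  let ?l = "ldeg J k" and ?\<pi> = "pi_tensor p k (ldeg J k) u"
  have u': "u \<in> L2_forms (Alt2 k ?l)" using u L2_forms_mono[OF EE_subset_Alt2] by blast
  note uL = L2_forms_comp[OF u]
  obtain L where L: "\<And>p q. L p q \<noteq> 0 \<Longrightarrow> weight p = weight q"
    "\<And>\<mu>. \<mu> \<in> Alt2 k ?l \<Longrightarrow> \<mu> \<in> (EE J k :: 'n biform set) \<longleftrightarrow> (\<forall>p. (\<Sum>q\<in>UNIV. L p q * cf \<mu> q) = 0)"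
    by (rule EE_equations[of k J]) (rule that)
  have zero: "(\<Sum>q\<in>UNIV. L r q * T (weight q) (comp u q) x) = 0" for r x
  proof -
    have "(\<Sum>q\<in>UNIV. L r q * T (weight q) (comp u q) x) = (\<Sum>q\<in>UNIV. L r q * T (weight r) (comp u q) x)"
      by (rule sum.cong[OF refl]) (use L(1)[of r] in fastforce)
    also have "\<dots> = T (weight r) (\<lambda>x. \<Sum>q\<in>UNIV. L r q * comp u q x) x"
      by (rule T_sum[symmetric]) (rule weight_le_2, rule uL)
    also have "T (weight r) (\<lambda>x. \<Sum>q\<in>UNIV. L r q * comp u q x) = (\<lambda>_. 0)"
    proof (rule T_cong_0[OF weight_le_2])
      show "(\<lambda>x. \<Sum>q\<in>UNIV. L r q * comp u q x) \<in> L2" by (intro L2_sum L2_scale uL)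
      have "AE x in cube. u x \<in> EE J k" using u by (simp add: L2_forms_def)
      then show "AE x in cube. (\<Sum>q\<in>UNIV. L r q * comp u q x) = 0"
      proof (rule AE_mp, intro AE_I2 impI)
        fix x assume "u x \<in> EE J k"
        then show "(\<Sum>q\<in>UNIV. L r q * cf (u x) q) = 0"
          using L(2)[of "u x"] EE_subset_Alt2[of J k] by blast
      qed
    qed
    finally show ?thesis .
  qed
  have "AE x in cube. \<forall>q\<in>UNIV. comp ?\<pi> q x = T (weight q) (comp u q) x"
    using comp_pi_tensor[OF u'] unfolding L2_eq_def by (intro AE_finite_allI) auto
  then have "AE x in cube. ?\<pi> x \<in> EE J k"
  proof (rule AE_mp, intro AE_I2 impI)
    fix x assume *: "\<forall>q\<in>UNIV. comp ?\<pi> q x = T (weight q) (comp u q) x"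
    have "(\<Sum>q\<in>UNIV. L r q * cf (?\<pi> x) q) = (\<Sum>q\<in>UNIV. L r q * T (weight q) (comp u q) x)" for r
      by (simp only: *[rule_format, OF UNIV_I])
    then have "(\<Sum>q\<in>UNIV. L r q * cf (?\<pi> x) q) = 0" for r unfolding zero .
    then show "?\<pi> x \<in> EE J k" using L(2)[OF pi_tensor_in_Alt2] by blast
  qed
  then show ?thesis using pi_tensor_L2_forms[of u k ?l, OF uL] by (simp add: L2_forms_def)
qed

text \<open>Commutation of the interpolation with the BGG operator. Row by row it is an instance of
  \<open>T_differential_equation\<close>, whose matching of weights is what
  \<open>weighted_diff_op_BGG\<close> provides.\<close>

lemma pi_tensor_BGG:
  assumes u: "u \<in> L2_forms (EE J k)" and uv: "is_BGG_L2 J k u v"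
  shows "is_BGG_L2 J k (pi_tensor p k (ldeg J k) u) (pi_tensor p (k + 1) (ldeg J (k + 1)) v)"
  unfolding is_BGG_L2_def
proof (intro conjI ballI)
  let ?\<pi>u = "pi_tensor p k (ldeg J k) u" and ?\<pi>v = "pi_tensor p (k + 1) (ldeg J (k + 1)) v"
  have v: "v \<in> L2_forms (EE J (k + 1))"
    and eq: "\<And>\<phi>. \<phi> \<in> test_functions \<Longrightarrow> BGG J k (regular u) \<phi> = regular v \<phi>"
    using uv by (auto simp: is_BGG_L2_def)
  show "?\<pi>v \<in> L2_forms (EE J (k + 1))" by (rule pi_tensor_EE[OF v])
  have u': "u \<in> L2_forms (Alt2 k (ldeg J k))" using u L2_forms_mono[OF EE_subset_Alt2] by blast
  have v': "v \<in> L2_forms (Alt2 (k + 1) (ldeg J (k + 1)))" using v L2_forms_mono[OF EE_subset_Alt2] by blast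
  note \<pi>u = pi_tensor_L2_forms[of u k "ldeg J k", OF L2_forms_comp[OF u]]
  note \<pi>v = pi_tensor_L2_forms[of v "k + 1" "ldeg J (k + 1)", OF L2_forms_comp[OF v]]
  fix \<phi> :: "real^'n::_ \<Rightarrow> real" assume \<phi>: "\<phi> \<in> test_functions"
  have ip_pi: "ip (comp (pi_tensor p k' l' w) q) \<psi> = ip (T (weight q) (comp w q)) \<psi>"
    if w: "w \<in> L2_forms (Alt2 k' l')" and "\<psi> \<in> L2" for k' l' w q \<psi>
    by (rule ip_cong[OF comp_pi_tensor[OF w] L2_forms_comp[OF pi_tensor_L2_forms[OF L2_forms_comp[OF w]]] T_L2[OF weight_le_2]])
      (rule that)
  obtain MS c where c: "finite MS"
    "\<And>p ms q. c p ms q \<noteq> 0 \<Longrightarrow> weight p = (\<lambda>m. weight q m + count_list ms m)"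
    "\<And>(u :: real^'n::_ \<Rightarrow> 'n biform) \<phi> p. u \<in> L2_forms (Alt2 k (ldeg J k)) \<Longrightarrow> \<phi> \<in> test_functions \<Longrightarrow> cf (BGG J k (regular u) \<phi>) p =
          (\<Sum>ms\<in>MS. \<Sum>q\<in>UNIV. c p ms q * ip (comp u q) (foldr pd (axes ms) \<phi>))"
    using weighted_diff_op_BGG by (rule weighted_diff_opE) (rule that)
  show "BGG J k (regular ?\<pi>u) \<phi> = regular ?\<pi>v \<phi>"
  proof (rule Alt2_eqI)
    show "BGG J k (regular ?\<pi>u) \<phi> \<in> Alt2 (k + 1) (ldeg J (k + 1))"
      by (rule weighted_diff_op_Alt2[OF weighted_diff_op_BGG \<pi>u \<phi>])
    show "regular ?\<pi>v \<phi> \<in> Alt2 (k + 1) (ldeg J (k + 1))"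
      by (rule regular_in_Alt2[OF \<pi>v test_functions_L2[OF \<phi>]])
    fix r
    have fL: "foldr pd (axes ms) \<phi> \<in> L2" for ms
      by (intro test_functions_L2 test_functions_foldr[OF \<phi>]) (auto simp: axis_in_Basis)
    have "cf (BGG J k (regular ?\<pi>u) \<phi>) r =
        (\<Sum>ms\<in>MS. \<Sum>q\<in>UNIV. c r ms q * ip (T (weight q) (comp u q)) (foldr pd (axes ms) \<phi>))"
      unfolding c(3)[OF \<pi>u \<phi>] ip_pi[OF u' fL] ..
    also have "\<dots> = (\<Sum>x\<in>MS \<times> UNIV. c r (fst x) (snd x) *
        ip (T (weight (snd x)) (comp u (snd x))) (foldr pd (axes (fst x)) \<phi>))"
      by (simp add: sum.cartesian_product case_prod_beta)
    also have "\<dots> = ip (T (weight r) (comp v r)) \<phi>"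
    \<comment> \<open>The terms of the equation are indexed by pairs of a list of directions and a
      component of \<open>u\<close>.\<close>
    proof (rule T_differential_equation[OF _ _ _ weight_le_2 _ _ \<phi>])
      show "finite (MS \<times> (UNIV :: ('n set \<times> 'n set) set))" using c(1) by simp
      show "comp u (snd x) \<in> L2" for x :: "'n list \<times> ('n set \<times> 'n set)" by (rule L2_forms_comp[OF u])
      show "comp v r \<in> L2" by (rule L2_forms_comp[OF v])
      show "weight r = (\<lambda>k. weight (snd x) k + count_list (fst x) k)" if "c r (fst x) (snd x) \<noteq> 0" for x
        by (rule c(2)[OF that])
      show "(\<Sum>x\<in>MS \<times> UNIV. c r (fst x) (snd x) * ip (comp u (snd x)) (foldr pd (axes (fst x)) \<psi>)) =
          ip (comp v r) \<psi>" if \<psi>: "\<psi> \<in> test_functions" for \<psi>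
      proof -
        have "(\<Sum>x\<in>MS \<times> UNIV. c r (fst x) (snd x) * ip (comp u (snd x)) (foldr pd (axes (fst x)) \<psi>)) =
            cf (BGG J k (regular u) \<psi>) r"
          unfolding c(3)[OF u' \<psi>] by (simp add: sum.cartesian_product case_prod_beta)
        then show ?thesis by (simp add: eq[OF \<psi>] cf_regular)
      qed
    qed
    also have "\<dots> = cf (regular ?\<pi>v \<phi>) r"
      unfolding cf_regular ip_pi[OF v' test_functions_L2[OF \<phi>]] ..
    finally show "cf (BGG J k (regular ?\<pi>u) \<phi>) r = cf (regular ?\<pi>v \<phi>) r" .
  qed
qed

text \<open>By commutation the second part of the graph norm is the L2 norm of the interpolation of
  \<open>v\<close> in degree \<open>k + 1\<close>, so two L2 bounds suffice and their maximum serves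
  both parts.\<close>

lemma pi_tensor_H_bound:
  "\<exists>C>0. \<forall>u\<in>H_BGG J k. pi_tensor p k (ldeg J k) u \<in> H_BGG J k \<and>
     H_norm J k (pi_tensor p k (ldeg J k) u) \<le> C * H_norm J k u"
proof -
  obtain C1 where C1: "C1 > 0" "\<And>u. (\<forall>q. comp u q \<in> L2) \<Longrightarrow>
      form_norm (pi_tensor p k (ldeg J k) u) \<le> C1 * form_norm u"
    using pi_tensor_bound by blast
  obtain C2 where C2: "C2 > 0" "\<And>u. (\<forall>q. comp u q \<in> L2) \<Longrightarrow>
      form_norm (pi_tensor p (k + 1) (ldeg J (k + 1)) u) \<le> C2 * form_norm u"
    using pi_tensor_bound by blast
  define C where "C = max C1 C2"
  have "pi_tensor p k (ldeg J k) u \<in> H_BGG J k \<and>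
      H_norm J k (pi_tensor p k (ldeg J k) u) \<le> C * H_norm J k u" if u: "u \<in> H_BGG J k" for u
  proof -
    let ?\<pi>u = "pi_tensor p k (ldeg J k) u"
    have uE: "u \<in> L2_forms (EE J k)" using u by (simp add: H_BGG_def)
    define v where "v = (SOME v. is_BGG_L2 J k u v)"
    obtain v0 where "is_BGG_L2 J k u v0" using u by (auto simp: H_BGG_def)
    then have v: "is_BGG_L2 J k u v" unfolding v_def by (rule someI[of "is_BGG_L2 J k u"])
    define v' where "v' = (SOME v. is_BGG_L2 J k ?\<pi>u v)"
    note \<pi>v = pi_tensor_BGG[OF uE v]
    have v': "is_BGG_L2 J k ?\<pi>u v'" unfolding v'_def by (rule someI[of "is_BGG_L2 J k ?\<pi>u", OF \<pi>v])
    have vE: "v \<in> L2_forms (EE J (k + 1))" using v by (simp add: is_BGG_L2_def)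
    have \<pi>uE: "?\<pi>u \<in> L2_forms (EE J k)" by (rule pi_tensor_EE[OF uE])
    have v'E: "v' \<in> L2_forms (EE J (k + 1))" using v' by (simp add: is_BGG_L2_def)
    have nn: "0 \<le> form_norm u" "0 \<le> form_norm v" "0 \<le> form_norm ?\<pi>u" "0 \<le> form_norm v'"
      using form_norm_nonneg L2_forms_comp uE vE \<pi>uE v'E by blast+
    have 1: "form_norm ?\<pi>u \<le> C * form_norm u"
    proof -
      have "form_norm ?\<pi>u \<le> C1 * form_norm u" using C1(2)[of u] L2_forms_comp[OF uE] by blast
      also have "\<dots> \<le> C * form_norm u" unfolding C_def by (intro mult_right_mono nn) simp
      finally show ?thesis .
    qed
    have 2: "form_norm v' \<le> C * form_norm v"
    proof -
      have "form_norm v' = form_norm (pi_tensor p (k + 1) (ldeg J (k + 1)) v)"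
        by (rule is_BGG_L2_form_norm_unique[OF v' \<pi>v])
      also have "\<dots> \<le> C2 * form_norm v" using C2(2)[of v] L2_forms_comp[OF vE] by blast
      also have "\<dots> \<le> C * form_norm v" unfolding C_def by (intro mult_right_mono nn) simp
      finally show ?thesis .
    qed
    have C0: "0 \<le> C" using C1(1) by (simp add: C_def)
    have "(form_norm ?\<pi>u)\<^sup>2 + (form_norm v')\<^sup>2 \<le> (C * form_norm u)\<^sup>2 + (C * form_norm v)\<^sup>2"
      by (intro add_mono power_mono 1 2 nn)
    also have "\<dots> = C\<^sup>2 * ((form_norm u)\<^sup>2 + (form_norm v)\<^sup>2)" by (simp add: power_mult_distrib distrib_left)
    finally have "sqrt ((form_norm ?\<pi>u)\<^sup>2 + (form_norm v')\<^sup>2) \<le> sqrt (C\<^sup>2 * ((form_norm u)\<^sup>2 + (form_norm v)\<^sup>2))"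
      by (rule real_sqrt_le_mono)
    also have "\<dots> = C * sqrt ((form_norm u)\<^sup>2 + (form_norm v)\<^sup>2)" using C0 by (simp add: real_sqrt_mult)
    finally have "H_norm J k ?\<pi>u \<le> C * H_norm J k u" by (simp add: H_norm_def v_def v'_def)
    moreover have "?\<pi>u \<in> H_BGG J k" using \<pi>uE \<pi>v unfolding H_BGG_def by blast
    ultimately show ?thesis by blast
  qed
  moreover have "C > 0" using C1(1) by (simp add: C_def)
  ultimately show ?thesis by blast
qed

end

theorem theorem3:
  fixes S :: "'n::{finite,linorder} \<Rightarrow> nat \<Rightarrow> (real \<Rightarrow> real) set"
    and p :: "'n \<Rightarrow> nat \<Rightarrow> nat \<Rightarrow> (real \<Rightarrow> real) \<Rightarrow> (real \<Rightarrow> real)"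
    and J k :: int
  assumes "1 \<le> J" and "J \<le> int CARD('n)"
    and "\<And>m. quasi_interp_1d (S m) (p m)"
    and "0 \<le> k" and "k \<le> int CARD('n)"
  shows "(\<exists>C>0. \<forall>u \<in> L2_forms (EE J k).
            pi_tensor p k (ldeg J k) u \<in> L2_forms (Alt2 k (ldeg J k)) \<and>
            form_norm (pi_tensor p k (ldeg J k) u) \<le> C * form_norm u) \<and>
         (\<exists>C>0. \<forall>u \<in> H_BGG J k.
            pi_tensor p k (ldeg J k) u \<in> H_BGG J k \<and>
            H_norm J k (pi_tensor p k (ldeg J k) u) \<le> C * H_norm J k u)"
proof -
  have "\<forall>m. \<exists>N e g M. dual_system N e g M \<and> (\<forall>i\<in>{0,1}. \<forall>j\<in>{0,1}. \<forall>f\<in>L2.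
      L2_eq (p m i j f) (fin_rank (N (i + j)) (e (i + j)) (g (i + j)) f))"
    using quasi_interp_dual_system[OF assms(3)] by blast
  then obtain N e g M where *: "\<And>m. dual_system (N m) (e m) (g m) (M m)"
    "\<And>m. \<forall>i\<in>{0,1}. \<forall>j\<in>{0,1}. \<forall>f\<in>L2.
      L2_eq (p m i j f) (fin_rank (N m (i + j)) (e m (i + j)) (g m (i + j)) f)"
    by metis
  interpret quasi_interp_tensor N e g M p
    by standard (use * in blast)+
  obtain C where C: "C > 0" "\<And>u. (\<forall>q. comp u q \<in> L2) \<Longrightarrow>
      form_norm (pi_tensor p k (ldeg J k) u) \<le> C * form_norm u"
    using pi_tensor_bound by blast
  have "pi_tensor p k (ldeg J k) u \<in> L2_forms (Alt2 k (ldeg J k)) \<and>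
      form_norm (pi_tensor p k (ldeg J k) u) \<le> C * form_norm u" if "u \<in> L2_forms (EE J k)" for u
    using pi_tensor_L2_forms C(2) L2_forms_comp[OF that] by blast
  then show ?thesis using C(1) pi_tensor_H_bound by blast
qed

end
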